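(* Let $m\ge2$, let $p_1,\dots,p_m\ge 2$ be pairwise coprime integers, and let $\Gamma$ be a graph representing the regular fiber of the Brieskorn complete intersection $\Sigma(p_1,\dots,p_m)$, given as an unweighted vertex $u_0$ adjacent to the central vertex $v_0$ of the star-shaped negative definite plumbing graph of $\Sigma(p_1,\dots,p_m)$. Let $s$ be the number of weighted vertices, $\mathfrak t$ the unique $\mathrm{Spin}^c$ structure, and $$\alpha=\prod_{i=1}^m p_i,\qquad \gamma=\alpha\Bigl(m-2-\sum_{i=1}^m\frac1{p_i}\Bigr).$$ Then $\mathbb{CFK}^\natural(\Gamma,\mathfrak t)$, together with its flip map $\Gamma$ and its involutions $\mathfrak I$, $\mathfrak J$, is equivalent to a doubly filtered simplicial integer line (heights on edges being the minima over endpoints) such that for $l\in\mathbb Z$ $$h_1(l)=\frac{K_{con}^2+s}{4}-2\tau(l),\quad h_2(l)=h_1(l-\alpha),\quad \Gamma(l)=l-\alpha,\quad \mathfrak I(l)=1+\gamma-l,\quad \mathfrak J(l)=1+\gamma+\alpha-l,$$ with higher coherence relations on $\mathfrak I$ and $\mathfrak J$ determined by $\mathfrak I^2=\mathrm{id}$ and $\mathfrak J^2=\mathrm{id}$. If $1+\gamma$ is positive, $\mathbb{CFK}^\natural(\Gamma,\mathfrak t)$ is supported on the filtered line segment from $0$ to $1+\gamma+\alpha$ (i.e. it is doubly filtered homotopy equivalent to that segment). Here $\tau\colon\mathbb Z\to\mathbb Z$ is determined by $$\tau(0)=0,\qquad \tau(l+1)-\tau(l)=1-e_0l-\sum_{i=1}^m\left\lceil\frac{lq_i}{p_i}\right\rceil,$$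 where $e_0$ and $q_1,\dots,q_m$ are the unique integers with $1\le q_i\le p_i-1$ for all $i$ and $$e_0p_1p_2\cdots p_m+q_1p_2p_3\cdots p_m+\cdots+q_mp_1p_2\cdots p_{m-1}=-1.$$
   Context: The star-shaped graph has a central vertex $v_0$ of weight $e_0$ and $m$ legs, the $i$-th leg being a chain of vertices of weights $-b_{i,1},-b_{i,2},\dots$ (starting next to $v_0$), where $p_i/q_i=b_{i,1}-\frac{1}{b_{i,2}-\cdots}$ with all $b_{i,j}\ge2$. For a negative definite weighted forest $H$ with plumbing 4-manifold $X_H$ and an unweighted vertex $u_0$, representing the knot $\mu\subset Y_H=\partial X_H$ that bounds a disk fiber over the vertex adjacent to $u_0$: $\mathrm{Char}(H)\subset H^2(X_H;\mathbb Z)$ is the set of characteristic classes, $\mathrm{Char}(H,\mathfrak t)$ the $H_2(X_H;\mathbb Z)$-orbit corresponding to $\mathfrak t\in\mathrm{Spin}^c(Y_H)$, where classes $S\in H_2(X_H,Y_H;\mathbb Z)$ (including vertices, and the disk class $u_0$) act by $k+S=k+2PD[S]$. The cube $[k,E]$ ($E$ a set of vertices of $H$) is the convex hull of $k+\sum_{v\in I}v$, $I\subseteq E$. $h_U(k)=\frac{k^2+s}{4}$ with $s$ the number of vertices of $H$; $h_U([k,E])$ is the minimum over the vertices of the cube; $h_V([k,E])=h_U([k+u_0,E])$. $\mathbb{CFK}^\natural$ is the simplicial set, with two height functions, obtained as the homotopy colimit of points of double height $(h_U,h_V)([k,E])$ over the category of cubes for $\mathfrak t$ with morphisms from cubes to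 their faces; up to doubly filtered homotopy it is the cubed Euclidean space with these heights on cubes. The flip map is induced by $[k,E]\mapsto[k+u_0,E]$ (filtered from $h_V$ to $h_U$), $\mathfrak I$ by $[k,E]\mapsto[-k-\sum_{v\in E}v,E]$ (preserving $h_U$), and $\mathfrak J$ by $[k,E]\mapsto[-k-u_0-\sum_{v\in E}v,E]$ (exchanging $h_U$ and $h_V$). $K_{con}$ is the characteristic class with $K_{con}(v)=-v^2-2$ for all vertices $v$. The simplicial integer line is the 1-dimensional simplicial set with vertices the integers and nondegenerate edges $[l,l+1]$; a double filtration assigns heights $(h_1,h_2)$ to simplices so that an edge has height at most that of its endpoints. Equivalence is doubly filtered homotopy equivalence (maps and homotopies do not decrease heights), compatible up to coherent homotopy with $\Gamma$, $\mathfrak I$, $\mathfrak J$. *)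

theory Defs
  imports "HOL-Analysis.Analysis"
begin

section \<open>Doubly filtered spaces\<close>

text \<open>A simplex is given by its finite set of vertices. This suffices for the simplicial sets used
  below (nerves of posets and the integer line): their non-degenerate simplices have distinct
  vertices and are determined by their vertex sets. The direction of the edges plays no role in the
  geometric realization, where all maps and homotopies live; note that a reflection of the integer
  line reverses its edges, so that it is a map of the realization but not of the simplicial set.\<close>

record 'a df_complex =
  simplexes :: "'a set set"
  ht1 :: "'a set \<Rightarrow> real"
  ht2 :: "'a set \<Rightarrow> real"

record 'a df_space =
  space_of :: "'a topology"
  hU :: "'a \<Rightarrow> real"
  hV :: "'a \<Rightarrow> real"

text \<open>Points of the realization are systems of barycentric coordinates.\<close>

definition support :: "('a \<Rightarrow> real) \<Rightarrow> 'a set" where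
  "support x = {a. x a \<noteq> 0}"

definition closed_cell :: "'a set \<Rightarrow> ('a \<Rightarrow> real) set" where
  "closed_cell \<sigma> = {x. (\<forall>a. 0 \<le> x a) \<and> support x \<subseteq> \<sigma> \<and> (\<Sum>a\<in>\<sigma>. x a) = 1}"

definition polyhedron :: "'a set set \<Rightarrow> ('a \<Rightarrow> real) set" where
  "polyhedron K = (\<Union>\<sigma>\<in>K. closed_cell \<sigma>)"

definition weak_topology :: "'a set set \<Rightarrow> ('a \<Rightarrow> real) topology" where
  "weak_topology K = topology (\<lambda>U. U \<subseteq> polyhedron K \<and>
     (\<forall>\<sigma>\<in>K. openin (top_of_set (closed_cell \<sigma>)) (U \<inter> closed_cell \<sigma>)))"

text \<open>The height of a point is the height of the open simplex that contains it.\<close>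

definition realization :: "('a, 'z) df_complex_scheme \<Rightarrow> ('a \<Rightarrow> real) df_space" where
  "realization K = \<lparr>space_of = weak_topology (simplexes K),
     hU = (\<lambda>x. ht1 K (support x)), hV = (\<lambda>x. ht2 K (support x))\<rparr>"

text \<open>The piecewise linear map given by a map of vertices.\<close>

definition pushforward :: "('a \<Rightarrow> 'b) \<Rightarrow> ('a \<Rightarrow> real) \<Rightarrow> 'b \<Rightarrow> real" where
  "pushforward \<phi> x = (\<lambda>b. \<Sum>a\<in>{a\<in>support x. \<phi> a = b}. x a)"

text \<open>Filtered maps do not decrease heights; a homotopy is filtered if all of its stages are.\<close>

definition height_le :: "'a topology \<Rightarrow> ('a \<Rightarrow> real) \<Rightarrow> ('b \<Rightarrow> real) \<Rightarrow> ('a \<Rightarrow> 'b) \<Rightarrow> bool" where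
  "height_le X h h' f \<longleftrightarrow> (\<forall>x\<in>topspace X. h x \<le> h' (f x))"

definition doubly_filtered ::
  "('a, 'y) df_space_scheme \<Rightarrow> ('b, 'z) df_space_scheme \<Rightarrow> ('a \<Rightarrow> 'b) \<Rightarrow> bool" where
  "doubly_filtered X Y f \<longleftrightarrow>
     height_le (space_of X) (hU X) (hU Y) f \<and> height_le (space_of X) (hV X) (hV Y) f"

definition df_map ::
  "('a, 'y) df_space_scheme \<Rightarrow> ('b, 'z) df_space_scheme \<Rightarrow> ('a \<Rightarrow> 'b) \<Rightarrow> bool" where
  "df_map X Y f \<longleftrightarrow> continuous_map (space_of X) (space_of Y) f \<and> doubly_filtered X Y f"

definition df_homotopic ::
  "('a, 'y) df_space_scheme \<Rightarrow> ('b, 'z) df_space_scheme \<Rightarrow> ('a \<Rightarrow> 'b) \<Rightarrow> ('a \<Rightarrow> 'b) \<Rightarrow> bool" where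
  "df_homotopic X Y = homotopic_with (doubly_filtered X Y) (space_of X) (space_of Y)"

definition df_homotopy_equivalence ::
  "('a, 'y) df_space_scheme \<Rightarrow> ('b, 'z) df_space_scheme \<Rightarrow> ('a \<Rightarrow> 'b) \<Rightarrow> bool" where
  "df_homotopy_equivalence X Y f \<longleftrightarrow> df_map X Y f \<and>
     (\<exists>g. df_map Y X g \<and> df_homotopic X X (g \<circ> f) id \<and> df_homotopic Y Y (f \<circ> g) id)"

definition df_homotopy_equivalent ::
  "('a, 'y) df_space_scheme \<Rightarrow> ('b, 'z) df_space_scheme \<Rightarrow> bool" where
  "df_homotopy_equivalent X Y \<longleftrightarrow> (\<exists>f. df_homotopy_equivalence X Y f)"


section \<open>Flip maps, involutions and coherent equivalence\<close>

record 'a knot_space = "'a df_space" +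
  flip :: "'a \<Rightarrow> 'a"
  invI :: "'a \<Rightarrow> 'a"
  invJ :: "'a \<Rightarrow> 'a"

text \<open>The involutions are strict, and they determine the flip map.\<close>

definition is_knot_space :: "('a, 'z) knot_space_scheme \<Rightarrow> bool" where
  "is_knot_space X \<longleftrightarrow>
     continuous_map (space_of X) (space_of X) (flip X) \<and>
     continuous_map (space_of X) (space_of X) (invI X) \<and>
     continuous_map (space_of X) (space_of X) (invJ X) \<and>
     (\<forall>x\<in>topspace (space_of X).
        hV X x \<le> hU X (flip X x) \<and>
        hU X (invI X x) = hU X x \<and> invI X (invI X x) = x \<and>
        hU X (invJ X x) = hV X x \<and> hV X (invJ X x) = hU X x \<and> invJ X (invJ X x) = x \<and>
        invJ X x = invI X (flip X x))"

text \<open>Compatibility of a map \<open>f\<close> with involutions \<open>a\<close> and \<open>b\<close> up to coherent homotopy. The union of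
  the spheres is a contractible space with a free action of the group with two elements,
  so a homotopy coherent equivariant map \<open>X \<rightarrow> Y\<close> is a strictly equivariant map from its product
  with \<open>X\<close> to \<open>Y\<close>. On the 0-sphere this is the pair of maps \<open>f\<close> and \<open>b \<circ> f \<circ> a\<close>, on the
  1-sphere a homotopy between them together with its conjugate, and on the \<open>n\<close>-sphere the
  \<open>n\<close>-th coherence homotopy and its conjugate. The predicate \<open>P\<close> is the filtration condition.\<close>

definition coherently_equivariant ::
  "(('a \<Rightarrow> 'b) \<Rightarrow> bool) \<Rightarrow> 'a topology \<Rightarrow> ('a \<Rightarrow> 'a) \<Rightarrow> 'b topology \<Rightarrow> ('b \<Rightarrow> 'b) \<Rightarrow> ('a \<Rightarrow> 'b) \<Rightarrow> bool"
  where
  "coherently_equivariant P X a Y b f \<longleftrightarrow>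
     (\<exists>F :: (nat \<Rightarrow> real) \<times> 'a \<Rightarrow> 'b.
        (\<forall>x\<in>topspace X. F (\<lambda>i. if i = 0 then 1 else 0, x) = f x) \<and>
        (\<forall>n. continuous_map (prod_topology (nsphere n) X) Y F \<and>
             (\<forall>e\<in>topspace (nsphere n). P (\<lambda>x. F (e, x)) \<and>
                (\<forall>x\<in>topspace X. F (\<lambda>i. - e i, a x) = b (F (e, x))))))"

text \<open>The homotopies for \<open>invI\<close> are filtered for the first height only, those for \<open>invJ\<close> for both
  heights, and the homotopy for the flip map goes from the second height to the first. Since
  the flip map is \<open>invI \<circ> invJ\<close>, composing the homotopies for \<open>invJ\<close> and \<open>invI\<close> gives one for the
  flip map, so no separate coherence between the three has to be imposed. A homotopy inverse of \<open>f\<close>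
  inherits these compatibilities.\<close>

definition knot_space_equivalent ::
  "('a, 'y) knot_space_scheme \<Rightarrow> ('b, 'z) knot_space_scheme \<Rightarrow> bool" where
  "knot_space_equivalent X Y \<longleftrightarrow> is_knot_space X \<and> is_knot_space Y \<and>
     (\<exists>f. df_homotopy_equivalence X Y f \<and>
        homotopic_with (height_le (space_of X) (hV X) (hU Y)) (space_of X) (space_of Y)
          (f \<circ> flip X) (flip Y \<circ> f) \<and>
        coherently_equivariant (height_le (space_of X) (hU X) (hU Y))
          (space_of X) (invI X) (space_of Y) (invI Y) f \<and>
        coherently_equivariant (doubly_filtered X Y)
          (space_of X) (invJ X) (space_of Y) (invJ Y) f)"


section \<open>Weighted graphs and characteristic classes\<close>

text \<open>A weighted graph together with an unweighted vertex \<open>u\<^sub>0\<close>, recorded by the vertex \<open>base\<close>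
  adjacent to it.\<close>

record 'v plumbing =
  verts :: "'v set"
  weight :: "'v \<Rightarrow> int"
  adj :: "'v \<Rightarrow> 'v \<Rightarrow> bool"
  base :: 'v

definition intersection :: "('v, 'z) plumbing_scheme \<Rightarrow> 'v \<Rightarrow> 'v \<Rightarrow> int" where
  "intersection H v w = (if v = w then weight H v else if adj H v w then 1 else 0)"

text \<open>Classes in the second cohomology are integer functions on the vertices, extended by 0.
  Poincare duality sends an absolute class to its intersection numbers with the vertices, and the
  relative class of the disk \<open>u\<^sub>0\<close> to the indicator function of \<open>base\<close>.\<close>

definition PD :: "('v, 'z) plumbing_scheme \<Rightarrow> ('v \<Rightarrow> int) \<Rightarrow> 'v \<Rightarrow> int" where
  "PD H x = (\<lambda>v. if v \<in> verts H then (\<Sum>w\<in>verts H. x w * intersection H w v) else 0)"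

definition PD_disk :: "('v, 'z) plumbing_scheme \<Rightarrow> 'v \<Rightarrow> int" where
  "PD_disk H = indicator {base H}"

definition characteristic :: "('v, 'z) plumbing_scheme \<Rightarrow> ('v \<Rightarrow> int) set" where
  "characteristic H = {k. (\<forall>v. v \<notin> verts H \<longrightarrow> k v = 0) \<and> (\<forall>v\<in>verts H. even (k v - weight H v))}"

text \<open>A spin-c structure on the boundary is identified with the corresponding orbit of
  characteristic classes.\<close>

definition spinc :: "('v, 'z) plumbing_scheme \<Rightarrow> ('v \<Rightarrow> int) set set" where
  "spinc H = (\<lambda>k. range (\<lambda>x v. k v + 2 * PD H x v)) ` characteristic H"

text \<open>The square of \<open>k\<close> is the evaluation of \<open>k\<close> on its Poincare dual, a class with real
  coefficients.\<close>

definition square :: "('v, 'z) plumbing_scheme \<Rightarrow> ('v \<Rightarrow> int) \<Rightarrow> real" where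
  "square H k = (THE r. \<exists>x :: 'v \<Rightarrow> real.
     (\<forall>v\<in>verts H. (\<Sum>w\<in>verts H. x w * of_int (intersection H w v)) = of_int (k v)) \<and>
     r = (\<Sum>v\<in>verts H. of_int (k v) * x v))"

definition K_con :: "('v, 'z) plumbing_scheme \<Rightarrow> 'v \<Rightarrow> int" where
  "K_con H = (\<lambda>v. if v \<in> verts H then - weight H v - 2 else 0)"

definition height_U :: "('v, 'z) plumbing_scheme \<Rightarrow> ('v \<Rightarrow> int) \<Rightarrow> real" where
  "height_U H k = (square H k + of_nat (card (verts H))) / 4"


section \<open>Cubes and the knot lattice space\<close>

text \<open>The cube \<open>[k, E]\<close> is the pair \<open>(k, E)\<close>; its vertices are \<open>translate H k I\<close> for \<open>I \<subseteq> E\<close>.\<close>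

type_synonym 'v cube = "('v \<Rightarrow> int) \<times> 'v set"

definition translate :: "('v, 'z) plumbing_scheme \<Rightarrow> ('v \<Rightarrow> int) \<Rightarrow> 'v set \<Rightarrow> 'v \<Rightarrow> int" where
  "translate H k I = (\<lambda>v. k v + 2 * PD H (indicator I) v)"

definition translate_disk :: "('v, 'z) plumbing_scheme \<Rightarrow> ('v \<Rightarrow> int) \<Rightarrow> 'v \<Rightarrow> int" where
  "translate_disk H k = (\<lambda>v. k v + 2 * PD_disk H v)"

definition cubes :: "('v, 'z) plumbing_scheme \<Rightarrow> ('v \<Rightarrow> int) set \<Rightarrow> 'v cube set" where
  "cubes H t = t \<times> Pow (verts H)"

fun is_face :: "('v, 'z) plumbing_scheme \<Rightarrow> 'v cube \<Rightarrow> 'v cube \<Rightarrow> bool" where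
  "is_face H (k', E') (k, E) \<longleftrightarrow> E' \<subseteq> E \<and> (\<exists>I \<subseteq> E - E'. k' = translate H k I)"

fun cube_height_U :: "('v, 'z) plumbing_scheme \<Rightarrow> 'v cube \<Rightarrow> real" where
  "cube_height_U H (k, E) = Min ((\<lambda>I. height_U H (translate H k I)) ` Pow E)"

fun flip_cube :: "('v, 'z) plumbing_scheme \<Rightarrow> 'v cube \<Rightarrow> 'v cube" where
  "flip_cube H (k, E) = (translate_disk H k, E)"

definition cube_height_V :: "('v, 'z) plumbing_scheme \<Rightarrow> 'v cube \<Rightarrow> real" where
  "cube_height_V H c = cube_height_U H (flip_cube H c)"

fun invI_cube :: "('v, 'z) plumbing_scheme \<Rightarrow> 'v cube \<Rightarrow> 'v cube" where
  "invI_cube H (k, E) = (\<lambda>v. - translate H k E v, E)"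

fun invJ_cube :: "('v, 'z) plumbing_scheme \<Rightarrow> 'v cube \<Rightarrow> 'v cube" where
  "invJ_cube H (k, E) = (\<lambda>v. - translate_disk H (translate H k E) v, E)"

text \<open>The homotopy colimit of points over the category of cubes is the nerve of that category, whose
  non-degenerate simplices \<open>c\<^sub>0 \<rightarrow> \<dots> \<rightarrow> c\<^sub>n\<close> are the chains for the face relation. Such a simplex is a
  copy of the point placed at its source \<open>c\<^sub>0\<close>, and has the heights of that point.\<close>

definition source_cube :: "('v, 'z) plumbing_scheme \<Rightarrow> 'v cube set \<Rightarrow> 'v cube" where
  "source_cube H \<sigma> = (THE c. c \<in> \<sigma> \<and> (\<forall>c'\<in>\<sigma>. is_face H c' c))"

definition cube_nerve ::
  "('v, 'z) plumbing_scheme \<Rightarrow> ('v \<Rightarrow> int) set \<Rightarrow> 'v cube df_complex" where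
  "cube_nerve H t = \<lparr>
     simplexes = {\<sigma>. \<sigma> \<noteq> {} \<and> finite \<sigma> \<and> \<sigma> \<subseteq> cubes H t \<and>
                     (\<forall>c\<in>\<sigma>. \<forall>c'\<in>\<sigma>. is_face H c c' \<or> is_face H c' c)},
     ht1 = (\<lambda>\<sigma>. cube_height_U H (source_cube H \<sigma>)),
     ht2 = (\<lambda>\<sigma>. cube_height_V H (source_cube H \<sigma>))\<rparr>"

definition CFK ::
  "('v, 'z) plumbing_scheme \<Rightarrow> ('v \<Rightarrow> int) set \<Rightarrow> ('v cube \<Rightarrow> real) knot_space" where
  "CFK H t = df_space.extend (realization (cube_nerve H t))
     \<lparr>flip = pushforward (flip_cube H),
      invI = pushforward (invI_cube H),
      invJ = pushforward (invJ_cube H)\<rparr>"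


section \<open>The filtered integer line\<close>

text \<open>The full subcomplex of the integer line on the vertex set \<open>A\<close>; heights on edges are the minima
  over the endpoints.\<close>

definition line_complex ::
  "int set \<Rightarrow> (int \<Rightarrow> real) \<Rightarrow> (int \<Rightarrow> real) \<Rightarrow> int df_complex" where
  "line_complex A h1 h2 = \<lparr>
     simplexes = {\<sigma>. \<sigma> \<subseteq> A \<and> (\<exists>l. \<sigma> = {l} \<or> \<sigma> = {l, l + 1})},
     ht1 = (\<lambda>\<sigma>. Min (h1 ` \<sigma>)),
     ht2 = (\<lambda>\<sigma>. Min (h2 ` \<sigma>))\<rparr>"

definition filtered_line ::
  "(int \<Rightarrow> real) \<Rightarrow> (int \<Rightarrow> real) \<Rightarrow> (int \<Rightarrow> int) \<Rightarrow> (int \<Rightarrow> int) \<Rightarrow> (int \<Rightarrow> int) \<Rightarrow>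
     (int \<Rightarrow> real) knot_space" where
  "filtered_line h1 h2 \<Gamma> I J = df_space.extend (realization (line_complex UNIV h1 h2))
     \<lparr>flip = pushforward \<Gamma>, invI = pushforward I, invJ = pushforward J\<rparr>"

definition filtered_segment ::
  "int \<Rightarrow> int \<Rightarrow> (int \<Rightarrow> real) \<Rightarrow> (int \<Rightarrow> real) \<Rightarrow> (int \<Rightarrow> real) df_space" where
  "filtered_segment a b h1 h2 = realization (line_complex {a..b} h1 h2)"


section \<open>Star-shaped graphs\<close>

text \<open>The continued fraction with minus signs; only its values on non-empty lists matter.\<close>

fun neg_cont_frac :: "int list \<Rightarrow> real" where
  "neg_cont_frac [] = 0"
| "neg_cont_frac [c] = of_int c"
| "neg_cont_frac (c # d # cs) = of_int c - 1 / neg_cont_frac (d # cs)"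

text \<open>\<open>Leg i j\<close> is the vertex in position \<open>j\<close>, counted from 0, on the \<open>i\<close>-th leg.\<close>

datatype star_vertex = Center | Leg nat nat

fun star_weight :: "int \<Rightarrow> (nat \<Rightarrow> int list) \<Rightarrow> star_vertex \<Rightarrow> int" where
  "star_weight e0 b Center = e0"
| "star_weight e0 b (Leg i j) = - (b i ! j)"

fun star_adj :: "star_vertex \<Rightarrow> star_vertex \<Rightarrow> bool" where
  "star_adj Center Center \<longleftrightarrow> False"
| "star_adj Center (Leg i j) \<longleftrightarrow> j = 0"
| "star_adj (Leg i j) Center \<longleftrightarrow> j = 0"
| "star_adj (Leg i j) (Leg i' j') \<longleftrightarrow> i = i' \<and> (j' = Suc j \<or> j = Suc j')"

text \<open>There are \<open>m\<close> legs, the \<open>i\<close>-th one with weights the negatives of the entries of \<open>b i\<close>; the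
  unweighted vertex is adjacent to the central vertex, so that it represents the regular fiber.\<close>

definition star_graph :: "nat \<Rightarrow> int \<Rightarrow> (nat \<Rightarrow> int list) \<Rightarrow> star_vertex plumbing" where
  "star_graph m e0 b = \<lparr>
     verts = insert Center {Leg i j | i j. i \<in> {1..m} \<and> j < length (b i)},
     weight = star_weight e0 b,
     adj = star_adj,
     base = Center\<rparr>"

end

theory Submission
  imports Defs
begin

text \<open>Write the characteristic classes of the \<open>Spin\<^sup>c\<close> structure as \<open>K + 2 PD z\<close> with \<open>K\<close> the class \<open>K_con\<close> and
  \<open>z\<close> in the lattice spanned by the vertices. The knot lattice space is then the cubed Euclidean space,
  and the coordinate of the central vertex is a map to the line. It commutes with the flip map and
  the involutions on the nose, because all of them act by affine maps, so no higher homotopies are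
  needed and it suffices that this coordinate is a doubly filtered homotopy equivalence. Since the
  disk class is dual to the central vertex, the two heights differ by a function of the central
  coordinate, so a deformation that preserves this coordinate and does not decrease the first height
  is doubly filtered. On a slice the quadratic function splits into a sum over the legs, and on each
  leg the coefficients can be moved to their optimal values, starting with the outermost ones: the
  minimum over the outer coefficients is a convex function of the next one, with minimizer given by
  a rounded continued fraction. This gives the formula for \<open>\<tau>\<close>.\<close>

section \<open>The weak topology\<close>

text \<open>Everything integral comes from the equation for \<open>e0\<close>, which says that the
  intersection form is unimodular: \<open>PD\<close> is bijective on integral classes, so the disk
  class and \<open>K_con\<close> have integral duals. The central coordinates of these duals,
  \<open>- \<alpha>\<close> and \<open>- (1 + \<gamma>)\<close>, are the constants of the
  translation and the reflections of the line. The obstacle is that the height of a cube is a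
  minimum over all of its corners, so a path has to be controlled on every cube it crosses and not
  only at lattice points. If a coefficient moved together with the one before it, some corner would
  combine values that do not fit. The remedy is that the optimal value for \<open>a\<close> remains
  optimal for \<open>a + 1\<close>, so one coefficient can rest while the other moves; the same
  overlap yields the recursion for the minimum over a leg. The factor 2 before \<open>\<tau>\<close>
  arises because the square of \<open>K + 2 PD z\<close> is \<open>K^2 - 4 * energy z\<close>, while
  the minimum of \<open>energy\<close> over a slice is \<open>2 * \<tau>\<close>. The symmetry of
  \<open>\<tau>\<close> is not computed from the ceilings: it is inherited from conjugation, and it
  gives the right end of the segment from the left one.\<close>

lemma openin_weak_topology:
  "openin (weak_topology K) U \<longleftrightarrow> U \<subseteq> polyhedron K \<and>
     (\<forall>\<sigma>\<in>K. openin (top_of_set (closed_cell \<sigma>)) (U \<inter> closed_cell \<sigma>))"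
proof -
  have "istopology (\<lambda>U. U \<subseteq> polyhedron K \<and>
     (\<forall>\<sigma>\<in>K. openin (top_of_set (closed_cell \<sigma>)) (U \<inter> closed_cell \<sigma>)))"
    unfolding istopology_def
  proof (intro conjI allI impI ballI)
    fix S T \<sigma>
    assume *: "S \<subseteq> polyhedron K \<and> (\<forall>\<sigma>\<in>K. openin (top_of_set (closed_cell \<sigma>)) (S \<inter> closed_cell \<sigma>))"
      "T \<subseteq> polyhedron K \<and> (\<forall>\<sigma>\<in>K. openin (top_of_set (closed_cell \<sigma>)) (T \<inter> closed_cell \<sigma>))" "\<sigma> \<in> K"
    have "S \<inter> T \<inter> closed_cell \<sigma> = (S \<inter> closed_cell \<sigma>) \<inter> (T \<inter> closed_cell \<sigma>)" by auto
    then show "openin (top_of_set (closed_cell \<sigma>)) (S \<inter> T \<inter> closed_cell \<sigma>)"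
      using * by (metis openin_Int)
  next
    fix \<K> \<sigma>
    assume *: "\<forall>U\<in>\<K>. U \<subseteq> polyhedron K \<and> (\<forall>\<sigma>\<in>K. openin (top_of_set (closed_cell \<sigma>)) (U \<inter> closed_cell \<sigma>))"
      "\<sigma> \<in> K"
    have "openin (top_of_set (closed_cell \<sigma>)) (\<Union>U\<in>\<K>. U \<inter> closed_cell \<sigma>)"
      by (rule openin_Union) (use * in auto)
    moreover have "\<Union> \<K> \<inter> closed_cell \<sigma> = (\<Union>U\<in>\<K>. U \<inter> closed_cell \<sigma>)" by auto
    ultimately show "openin (top_of_set (closed_cell \<sigma>)) (\<Union> \<K> \<inter> closed_cell \<sigma>)"
      by metis
  qed auto
  then show ?thesis by (simp add: weak_topology_def topology_inverse')
qed

lemma topspace_weak_topology [simp]: "topspace (weak_topology K) = polyhedron K"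
proof
  show "topspace (weak_topology K) \<subseteq> polyhedron K"
    using openin_weak_topology openin_topspace by blast
  have "polyhedron K \<inter> closed_cell \<sigma> = closed_cell \<sigma>" if "\<sigma> \<in> K" for \<sigma>
    using that by (auto simp: polyhedron_def)
  then have "openin (weak_topology K) (polyhedron K)"
    unfolding openin_weak_topology by (auto simp: openin_subtopology_self)
  then show "polyhedron K \<subseteq> topspace (weak_topology K)" by (rule openin_subset)
qed

lemma continuous_map_from_weak_topology:
  assumes "\<And>\<sigma>. \<sigma> \<in> K \<Longrightarrow> continuous_map (top_of_set (closed_cell \<sigma>)) Y f"
  shows "continuous_map (weak_topology K) Y f"
  unfolding continuous_map_def
proof (intro conjI allI impI)
  show "f \<in> topspace (weak_topology K) \<rightarrow> topspace Y"
    using assms by (fastforce simp: polyhedron_def continuous_map_def)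
next
  fix U assume U: "openin Y U"
  show "openin (weak_topology K) {x \<in> topspace (weak_topology K). f x \<in> U}"
    unfolding openin_weak_topology
  proof (intro conjI ballI)
    fix \<sigma> assume \<sigma>: "\<sigma> \<in> K"
    have "{x \<in> topspace (weak_topology K). f x \<in> U} \<inter> closed_cell \<sigma> =
       {x \<in> topspace (top_of_set (closed_cell \<sigma>)). f x \<in> U}"
      using \<sigma> by (auto simp: polyhedron_def)
    then show "openin (top_of_set (closed_cell \<sigma>))
       ({x \<in> topspace (weak_topology K). f x \<in> U} \<inter> closed_cell \<sigma>)"
      using assms[OF \<sigma>] U by (simp add: continuous_map_def)
  qed auto
qed

lemma continuous_map_cell_weak_topology:
  assumes "\<sigma> \<in> K"
  shows "continuous_map (top_of_set (closed_cell \<sigma>)) (weak_topology K) (\<lambda>x. x)"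
  unfolding continuous_map_def
proof (intro conjI allI impI)
  show "(\<lambda>x. x) \<in> topspace (top_of_set (closed_cell \<sigma>)) \<rightarrow> topspace (weak_topology K)"
    using assms by (auto simp: polyhedron_def)
next
  fix U assume "openin (weak_topology K) U"
  then have "openin (top_of_set (closed_cell \<sigma>)) (U \<inter> closed_cell \<sigma>)"
    using assms by (simp add: openin_weak_topology)
  moreover have "{x \<in> topspace (top_of_set (closed_cell \<sigma>)). x \<in> U} = U \<inter> closed_cell \<sigma>" by auto
  ultimately show "openin (top_of_set (closed_cell \<sigma>)) {x \<in> topspace (top_of_set (closed_cell \<sigma>)). x \<in> U}"
    by simp
qed

definition is_complex :: "'a set set \<Rightarrow> bool" where
  "is_complex K \<longleftrightarrow> (\<forall>\<sigma>\<in>K. finite \<sigma> \<and> (\<forall>\<rho>\<subseteq>\<sigma>. \<rho> \<noteq> {} \<longrightarrow> \<rho> \<in> K))"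

lemma closed_closed_cell: "closed (closed_cell \<sigma>)"
proof -
  have "closed_cell \<sigma> = (\<Inter>a. {x. 0 \<le> x a}) \<inter> (\<Inter>a\<in>-\<sigma>. {x. x a = 0}) \<inter> {x. (\<Sum>a\<in>\<sigma>. x a) = 1}"
    by (auto simp: closed_cell_def support_def)
  moreover have "closed {x::'a \<Rightarrow> real. 0 \<le> x a}" for a
    by (intro closed_Collect_le continuous_intros continuous_on_product_coordinates)
  moreover have "closed {x::'a \<Rightarrow> real. x a = 0}" for a
    by (intro closed_Collect_eq continuous_intros continuous_on_product_coordinates)
  moreover have "closed {x::'a \<Rightarrow> real. (\<Sum>a\<in>\<sigma>. x a) = 1}"
    by (intro closed_Collect_eq continuous_intros continuous_on_product_coordinates)
  ultimately show ?thesis by (auto intro!: closed_Int closed_INT)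
qed

text \<open>Near every point only finitely many simplices matter, and on each of them the weak topology
  is the product topology.\<close>

lemma continuous_map_into_weak_topology:
  fixes f :: "'b \<Rightarrow> 'a \<Rightarrow> real"
  assumes coord: "\<And>a. continuous_map X euclideanreal (\<lambda>y. f y a)"
    and poly: "\<And>y. y \<in> topspace X \<Longrightarrow> f y \<in> polyhedron K"
    and K: "is_complex K"
    and lf: "\<And>y. y \<in> topspace X \<Longrightarrow>
      \<exists>N W. openin X N \<and> y \<in> N \<and> finite W \<and> (\<forall>y'\<in>N. support (f y') \<subseteq> W)"
  shows "continuous_map X (weak_topology K) f"
proof -
  have sub: "\<rho> \<in> K" if "\<sigma> \<in> K" "\<rho> \<subseteq> \<sigma>" "\<rho> \<noteq> {}" for \<sigma> \<rho>
    using that K by (auto simp: is_complex_def)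
  have fin: "finite \<sigma>" if "\<sigma> \<in> K" for \<sigma>
    using that K by (auto simp: is_complex_def)
  have f_prod: "continuous_map X euclidean f"
    using coord by (simp add: continuous_map_componentwise_UNIV flip: euclidean_product_topology)
  define C where "C \<sigma> = {y \<in> topspace X. f y \<in> closed_cell \<sigma>}" for \<sigma>
  have cloC: "closedin X (C \<sigma>)" for \<sigma>
    unfolding C_def
    by (rule closedin_continuous_map_preimage[OF f_prod]) (simp add: closed_closed_cell flip: closed_closedin)
  have inC: "y \<in> C (support (f y)) \<and> support (f y) \<in> K" if y: "y \<in> topspace X" for y
  proof -
    obtain \<sigma> where \<sigma>: "\<sigma> \<in> K" "f y \<in> closed_cell \<sigma>" using poly[OF y] by (auto simp: polyhedron_def)
    have s: "support (f y) \<subseteq> \<sigma>" and 1: "(\<Sum>a\<in>\<sigma>. f y a) = 1" using \<sigma> by (auto simp: closed_cell_def)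
    have "(\<Sum>a\<in>support (f y). f y a) = (\<Sum>a\<in>\<sigma>. f y a)"
      using s fin[OF \<sigma>(1)] by (intro sum.mono_neutral_left) (auto simp: support_def)
    then have 2: "(\<Sum>a\<in>support (f y). f y a) = 1" using 1 by simp
    then have "support (f y) \<noteq> {}" by (metis sum.empty zero_neq_one)
    then show ?thesis using sub[OF \<sigma>(1) s] \<sigma>(2) 2 y by (auto simp: C_def closed_cell_def)
  qed
  have loc: "continuous_map (subtopology X N) (weak_topology K) f"
    if N: "openin X N" and W: "finite W" "\<forall>y'\<in>N. support (f y') \<subseteq> W" for N W
  proof (rule pasting_lemma_locally_finite[where I = "{\<sigma>\<in>K. \<sigma> \<subseteq> W}" and T = "\<lambda>\<sigma>. N \<inter> C \<sigma>" and f = "\<lambda>_. f"])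
    fix y assume y: "y \<in> topspace (subtopology X N)"
    have "finite {\<sigma>\<in>K. \<sigma> \<subseteq> W}" using W by simp
    then show "\<exists>V. openin (subtopology X N) V \<and> y \<in> V \<and> finite {i \<in> {\<sigma>\<in>K. \<sigma> \<subseteq> W}. N \<inter> C i \<inter> V \<noteq> {}}"
      by (rule_tac exI[of _ "topspace (subtopology X N)"], intro conjI openin_topspace y)
        (erule rev_finite_subset, blast)
    show "\<exists>j. j \<in> {\<sigma>\<in>K. \<sigma> \<subseteq> W} \<and> y \<in> N \<inter> C j \<and> f y = f y"
      using inC[of y] y W by (intro exI[of _ "support (f y)"]) (auto simp: C_def)
  next
    fix \<sigma> assume \<sigma>: "\<sigma> \<in> {\<sigma>\<in>K. \<sigma> \<subseteq> W}"
    show "closedin (subtopology X N) (N \<inter> C \<sigma>)"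
      using cloC by (auto simp: closedin_subtopology)
    have "continuous_map (subtopology X (N \<inter> C \<sigma>)) (top_of_set (closed_cell \<sigma>)) f"
      using f_prod by (auto simp: continuous_map_in_subtopology C_def continuous_map_from_subtopology)
    then have "continuous_map (subtopology X (N \<inter> C \<sigma>)) (weak_topology K) ((\<lambda>x. x) \<circ> f)"
      using \<sigma> by (intro continuous_map_compose[OF _ continuous_map_cell_weak_topology]) auto
    then show "continuous_map (subtopology (subtopology X N) (N \<inter> C \<sigma>)) (weak_topology K) f"
      by (simp add: subtopology_subtopology o_def Int_absorb1)
  qed auto
  show ?thesis
    unfolding continuous_map_def
  proof (intro conjI allI impI)
    show "f \<in> topspace X \<rightarrow> topspace (weak_topology K)" using poly by auto
    fix U assume U: "openin (weak_topology K) U"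
    show "openin X {x \<in> topspace X. f x \<in> U}"
    proof (subst openin_subopen, intro ballI)
      fix y assume y: "y \<in> {x \<in> topspace X. f x \<in> U}"
      then obtain N W where N: "openin X N" "y \<in> N" and W: "finite W" "\<forall>y'\<in>N. support (f y') \<subseteq> W"
        using lf[of y] by auto
      have "openin (subtopology X N) {x \<in> topspace (subtopology X N). f x \<in> U}"
        using loc[OF N(1) W] U by (simp add: continuous_map_def)
      then have "openin X {x \<in> topspace (subtopology X N). f x \<in> U}"
        using N(1) openin_trans_full by blast
      then show "\<exists>T. openin X T \<and> y \<in> T \<and> T \<subseteq> {x \<in> topspace X. f x \<in> U}"
        using y N openin_subset[OF N(1)] by (intro exI[of _ "{x \<in> topspace (subtopology X N). f x \<in> U}"]) auto
    qed
  qed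
qed

section \<open>Affine functions and simplicial maps on a realization\<close>

definition weighted_sum :: "('a \<Rightarrow> real) \<Rightarrow> ('a \<Rightarrow> real) \<Rightarrow> real" where
  "weighted_sum g x = (\<Sum>a\<in>support x. x a * g a)"

lemma weighted_sum_superset:
  "finite \<sigma> \<Longrightarrow> support x \<subseteq> \<sigma> \<Longrightarrow> weighted_sum g x = (\<Sum>a\<in>\<sigma>. x a * g a)"
  unfolding weighted_sum_def by (rule sum.mono_neutral_left) (auto simp: support_def)

lemma continuous_map_weighted_sum:
  assumes "is_complex K"
  shows "continuous_map (weak_topology K) euclideanreal (weighted_sum g)"
proof (rule continuous_map_from_weak_topology)
  fix \<sigma> assume "\<sigma> \<in> K"
  have "continuous_on (closed_cell \<sigma>) (\<lambda>x. \<Sum>a\<in>\<sigma>. x a * g a)"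
    by (intro continuous_intros continuous_on_product_then_coordinatewise[OF continuous_on_id])
  then have "continuous_on (closed_cell \<sigma>) (weighted_sum g)"
    using assms \<open>\<sigma> \<in> K\<close> unfolding is_complex_def
    by (subst continuous_on_cong[OF refl weighted_sum_superset]) (auto simp: closed_cell_def)
  then show "continuous_map (top_of_set (closed_cell \<sigma>)) euclideanreal (weighted_sum g)"
    by (simp add: continuous_map_iff_continuous)
qed

lemma polyhedronD:
  assumes x: "x \<in> polyhedron K" and K: "is_complex K"
  shows "finite (support x)" and "support x \<in> K" and "support x \<noteq> {}"
    and "(\<Sum>a\<in>support x. x a) = 1" and "\<And>a. 0 \<le> x a"
proof -
  obtain \<sigma> where \<sigma>: "\<sigma> \<in> K" "support x \<subseteq> \<sigma>" "\<And>a. 0 \<le> x a" "(\<Sum>a\<in>\<sigma>. x a) = 1"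
    using x by (auto simp: polyhedron_def closed_cell_def)
  show "finite (support x)" using \<sigma> K finite_subset unfolding is_complex_def by blast
  have "(\<Sum>a\<in>support x. x a) = (\<Sum>a\<in>\<sigma>. x a)"
    using \<sigma> K unfolding is_complex_def by (intro sum.mono_neutral_left) (auto simp: support_def)
  then show 1: "(\<Sum>a\<in>support x. x a) = 1" using \<sigma> by simp
  then show ne: "support x \<noteq> {}" by (metis sum.empty zero_neq_one)
  show "support x \<in> K" using \<sigma> ne K unfolding is_complex_def by blast
  show "\<And>a. 0 \<le> x a" using \<sigma> by simp
qed

lemma polyhedronI:
  assumes "support x \<in> K" "(\<Sum>a\<in>support x. x a) = 1" "\<And>a. 0 \<le> x a"
  shows "x \<in> polyhedron K"
  using assms by (auto simp: polyhedron_def closed_cell_def)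

lemma support_pushforward:
  assumes "finite (support x)" "\<And>a. 0 \<le> x a"
  shows "support (pushforward \<phi> x) = \<phi> ` support x"
proof -
  have "pushforward \<phi> x c = 0 \<longleftrightarrow> (\<forall>a\<in>{a \<in> support x. \<phi> a = c}. x a = 0)" for c
    unfolding pushforward_def using assms by (intro sum_nonneg_eq_0_iff) auto
  then show ?thesis by (auto simp: support_def)
qed

lemma weighted_sum_pushforward:
  assumes "finite (support x)" "\<And>a. 0 \<le> x a"
  shows "weighted_sum g (pushforward \<phi> x) = weighted_sum (\<lambda>a. g (\<phi> a)) x"
proof -
  have "weighted_sum g (pushforward \<phi> x)
      = (\<Sum>c\<in>\<phi> ` support x. (\<Sum>a\<in>{a\<in>support x. \<phi> a = c}. x a) * g c)"
    unfolding weighted_sum_def support_pushforward[OF assms] by (simp add: pushforward_def)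
  also have "\<dots> = (\<Sum>c\<in>\<phi> ` support x. \<Sum>a\<in>{a\<in>support x. \<phi> a = c}. x a * g (\<phi> a))"
    unfolding sum_distrib_right by (intro sum.cong refl) auto
  also have "\<dots> = weighted_sum (\<lambda>a. g (\<phi> a)) x"
    unfolding weighted_sum_def using assms by (subst sum.image_gen[of _ _ \<phi>]) auto
  finally show ?thesis .
qed

lemma sum_support_pushforward:
  assumes "finite (support x)" "\<And>a. 0 \<le> x a"
  shows "(\<Sum>c\<in>support (pushforward \<phi> x). pushforward \<phi> x c) = (\<Sum>a\<in>support x. x a)"
  using weighted_sum_pushforward[OF assms, of "\<lambda>_. 1" \<phi>] by (simp add: weighted_sum_def)

section \<open>Doubly filtered maps\<close>

lemma doubly_filtered_compose:
  assumes "continuous_map (space_of X) (space_of Y) f" "doubly_filtered X Y f" "doubly_filtered Y Z g"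
  shows "doubly_filtered X Z (g \<circ> f)"
proof -
  have "f x \<in> topspace (space_of Y)" if "x \<in> topspace (space_of X)" for x
    using assms(1) that by (auto simp: continuous_map_def)
  then show ?thesis
    using assms(2,3) unfolding doubly_filtered_def height_le_def by fastforce
qed

lemma df_map_compose: "df_map X Y f \<Longrightarrow> df_map Y Z g \<Longrightarrow> df_map X Z (g \<circ> f)"
  unfolding df_map_def by (auto intro: continuous_map_compose doubly_filtered_compose)

lemma df_homotopicI:
  fixes h :: "real \<Rightarrow> 'a \<Rightarrow> 'b"
  assumes "continuous_map (prod_topology (top_of_set {0..1}) (space_of X)) (space_of Y) (\<lambda>p. h (fst p) (snd p))"
    and "\<And>x. x \<in> topspace (space_of X) \<Longrightarrow> h 0 x = f x"
    and "\<And>x. x \<in> topspace (space_of X) \<Longrightarrow> h 1 x = g x"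
    and "\<And>t. 0 \<le> t \<Longrightarrow> t \<le> 1 \<Longrightarrow> doubly_filtered X Y (h t)"
  shows "df_homotopic X Y f g"
  unfolding df_homotopic_def
proof (subst homotopic_with)
  show "\<exists>h. continuous_map (prod_topology (top_of_set {0..1::real}) (space_of X)) (space_of Y) h \<and>
        (\<forall>x\<in>topspace (space_of X). h (0, x) = f x) \<and>
        (\<forall>x\<in>topspace (space_of X). h (1, x) = g x) \<and>
        (\<forall>t\<in>{0..1}. doubly_filtered X Y (\<lambda>x. h (t, x)))"
  proof (intro exI[of _ "\<lambda>p. h (fst p) (snd p)"] conjI ballI)
    show "doubly_filtered X Y (\<lambda>x. h (fst (t, x)) (snd (t, x)))" if "t \<in> {0..1}" for t
      using assms(4)[of t] that by simp
  qed (use assms in simp_all)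
qed (auto simp: doubly_filtered_def height_le_def)

lemma df_homotopic_eq:
  assumes "df_map X Y f" "\<And>x. x \<in> topspace (space_of X) \<Longrightarrow> f x = g x"
  shows "df_homotopic X Y f g"
proof (rule df_homotopicI[where h = "\<lambda>_. f"])
  show "continuous_map (prod_topology (top_of_set {0..1}) (space_of X)) (space_of Y) (\<lambda>p. f (snd p))"
    using assms(1) by (intro continuous_map_compose[OF continuous_map_snd, unfolded o_def]) (simp add: df_map_def)
qed (use assms in \<open>auto simp: df_map_def\<close>)

lemma df_homotopic_trans: "df_homotopic X Y f g \<Longrightarrow> df_homotopic X Y g h \<Longrightarrow> df_homotopic X Y f h"
  unfolding df_homotopic_def by (rule homotopic_with_trans)

lemma df_homotopic_sym: "df_homotopic X Y f g \<Longrightarrow> df_homotopic X Y g f"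
  unfolding df_homotopic_def by (rule homotopic_with_symD)

lemma df_homotopic_compose_left:
  assumes "df_homotopic X Y f f'" "df_map Y Z g"
  shows "df_homotopic X Z (g \<circ> f) (g \<circ> f')"
proof -
  have "homotopic_with (\<lambda>h. doubly_filtered X Y h \<and> continuous_map (space_of X) (space_of Y) h)
     (space_of X) (space_of Y) f f'"
    using assms(1) unfolding df_homotopic_def by (rule homotopic_with_mono) auto
  then show ?thesis
    unfolding df_homotopic_def
    by (rule homotopic_with_compose_continuous_map_left)
      (use assms(2) in \<open>auto simp: df_map_def intro: doubly_filtered_compose\<close>)
qed

lemma df_homotopic_compose_right:
  assumes "df_homotopic Y Z g g'" "df_map X Y f"
  shows "df_homotopic X Z (g \<circ> f) (g' \<circ> f)"
  unfolding df_homotopic_def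
  by (rule homotopic_with_compose_continuous_map_right[OF assms(1)[unfolded df_homotopic_def]])
    (use assms(2) in \<open>auto simp: df_map_def intro: doubly_filtered_compose\<close>)

lemma df_homotopy_equivalence_compose:
  assumes "df_homotopy_equivalence X Y f" "df_homotopy_equivalence Y Z g"
  shows "df_homotopy_equivalence X Z (g \<circ> f)"
proof -
  obtain f' where f: "df_map X Y f" "df_map Y X f'" "df_homotopic X X (f' \<circ> f) id" "df_homotopic Y Y (f \<circ> f') id"
    using assms(1) unfolding df_homotopy_equivalence_def by auto
  obtain g' where g: "df_map Y Z g" "df_map Z Y g'" "df_homotopic Y Y (g' \<circ> g) id" "df_homotopic Z Z (g \<circ> g') id"
    using assms(2) unfolding df_homotopy_equivalence_def by auto
  have "df_homotopic X X (f' \<circ> ((g' \<circ> g) \<circ> f)) (f' \<circ> (id \<circ> f))"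
    using f g by (intro df_homotopic_compose_left df_homotopic_compose_right)
  then have 1: "df_homotopic X X ((f' \<circ> g') \<circ> (g \<circ> f)) id"
    using df_homotopic_trans[OF _ f(3)] by (simp add: o_assoc)
  have "df_homotopic Z Z (g \<circ> ((f \<circ> f') \<circ> g')) (g \<circ> (id \<circ> g'))"
    using f g by (intro df_homotopic_compose_left df_homotopic_compose_right)
  then have 2: "df_homotopic Z Z ((g \<circ> f) \<circ> (f' \<circ> g')) id"
    using df_homotopic_trans[OF _ g(4)] by (simp add: o_assoc)
  show ?thesis
    unfolding df_homotopy_equivalence_def
    using 1 2 df_map_compose[OF f(1) g(1)] df_map_compose[OF g(2) f(2)] by blast
qed

lemma df_homotopy_equivalence_iso:
  assumes "df_map X Y f" "df_map Y X g"
    and "\<And>x. x \<in> topspace (space_of X) \<Longrightarrow> g (f x) = x"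
    and "\<And>y. y \<in> topspace (space_of Y) \<Longrightarrow> f (g y) = y"
  shows "df_homotopy_equivalence X Y f"
  unfolding df_homotopy_equivalence_def
proof (intro conjI exI[of _ g])
  show "df_homotopic X X (g \<circ> f) id"
    by (rule df_homotopic_eq[OF df_map_compose[OF assms(1,2)]]) (simp add: assms(3))
  show "df_homotopic Y Y (f \<circ> g) id"
    by (rule df_homotopic_eq[OF df_map_compose[OF assms(2,1)]]) (simp add: assms(4))
qed (use assms in auto)

section \<open>The integer line\<close>

text \<open>The barycentric coordinates of a point of the real line subdivided at the integers: the
  inverse of the chart \<open>weighted_sum real_of_int\<close>.\<close>

definition tent :: "real \<Rightarrow> int \<Rightarrow> real" where
  "tent y = (\<lambda>l. max 0 (1 - \<bar>y - of_int l\<bar>))"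

definition line_space :: "int set \<Rightarrow> (int \<Rightarrow> real) \<Rightarrow> (int \<Rightarrow> real) \<Rightarrow> real df_space" where
  "line_space A h1 h2 = \<lparr>space_of = top_of_set {y. \<lfloor>y\<rfloor> \<in> A \<and> \<lceil>y\<rceil> \<in> A},
     hU = (\<lambda>y. min (h1 \<lfloor>y\<rfloor>) (h1 \<lceil>y\<rceil>)), hV = (\<lambda>y. min (h2 \<lfloor>y\<rfloor>) (h2 \<lceil>y\<rceil>))\<rparr>"

abbreviation near :: "real \<Rightarrow> int set" where
  "near x \<equiv> {\<lfloor>x\<rfloor>, \<lceil>x\<rceil>}"

lemma support_tent: "support (tent y) = near y"
proof -
  have "tent y l \<noteq> 0 \<longleftrightarrow> l = \<lfloor>y\<rfloor> \<or> l = \<lceil>y\<rceil>" for l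
    unfolding tent_def by linarith
  then show ?thesis by (auto simp: support_def)
qed

lemma floor_ceiling_cases:
  fixes y :: real
  obtains "of_int \<lfloor>y\<rfloor> = y" "\<lceil>y\<rceil> = \<lfloor>y\<rfloor>" | "\<lceil>y\<rceil> = \<lfloor>y\<rfloor> + 1" "of_int \<lfloor>y\<rfloor> < y" "y < of_int \<lfloor>y\<rfloor> + 1"
  by linarith

lemma sum_tent: "(\<Sum>l\<in>near y. tent y l * g l) =
   (1 - (y - of_int \<lfloor>y\<rfloor>)) * g \<lfloor>y\<rfloor> + (y - of_int \<lfloor>y\<rfloor>) * g \<lceil>y\<rceil>"
proof (cases rule: floor_ceiling_cases[of y])
  case 1
  have 0: "y - of_int \<lfloor>y\<rfloor> = 0" using 1(1) by linarith
  then have "tent y \<lfloor>y\<rfloor> = 1" unfolding tent_def 0 by simp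
  then show ?thesis unfolding 1(2) 0 by simp
next
  case 2
  have "tent y \<lfloor>y\<rfloor> = 1 - (y - of_int \<lfloor>y\<rfloor>)" "tent y (\<lfloor>y\<rfloor> + 1) = y - of_int \<lfloor>y\<rfloor>"
    using 2 unfolding tent_def by linarith+
  then show ?thesis using 2(1) by simp
qed

lemma weighted_sum_tent: "weighted_sum real_of_int (tent y) = y"
proof -
  have "weighted_sum real_of_int (tent y) =
      (1 - (y - of_int \<lfloor>y\<rfloor>)) * of_int \<lfloor>y\<rfloor> + (y - of_int \<lfloor>y\<rfloor>) * of_int \<lceil>y\<rceil>"
    unfolding weighted_sum_def support_tent by (rule sum_tent)
  also have "\<dots> = y"
    by (cases rule: floor_ceiling_cases[of y]) (auto simp: algebra_simps)
  finally show ?thesis .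
qed

abbreviation line_simplexes :: "int set \<Rightarrow> int set set" where
  "line_simplexes A \<equiv> {\<sigma>. \<sigma> \<subseteq> A \<and> (\<exists>l. \<sigma> = {l} \<or> \<sigma> = {l, l + 1})}"

lemma is_complex_line: "is_complex (line_simplexes A)"
proof -
  have "\<rho> \<in> line_simplexes A" if *: "\<sigma> \<in> line_simplexes A" "\<rho> \<subseteq> \<sigma>" "\<rho> \<noteq> {}" for \<sigma> \<rho>
  proof -
    obtain l where "\<rho> \<subseteq> {l, l + 1}" using * by blast
    then have "\<rho> = {l} \<or> \<rho> = {l + 1} \<or> \<rho> = {l, l + 1}" using *(3) by blast
    then show ?thesis using * by blast
  qed
  moreover have "finite \<sigma>" if "\<sigma> \<in> line_simplexes A" for \<sigma> using that by auto
  ultimately show ?thesis unfolding is_complex_def by blast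
qed

lemma tent_in_line: "\<lfloor>y\<rfloor> \<in> A \<Longrightarrow> \<lceil>y\<rceil> \<in> A \<Longrightarrow> tent y \<in> polyhedron (line_simplexes A)"
proof (rule polyhedronI)
  show "\<lfloor>y\<rfloor> \<in> A \<Longrightarrow> \<lceil>y\<rceil> \<in> A \<Longrightarrow> support (tent y) \<in> line_simplexes A"
    by (cases rule: floor_ceiling_cases[of y]) (auto simp: support_tent)
  show "sum (tent y) (support (tent y)) = 1"
    using sum_tent[of y "\<lambda>_. 1"] by (simp add: support_tent)
qed (simp add: tent_def)

lemma tent_weighted_sum:
  assumes "x \<in> polyhedron (line_simplexes A)"
  shows "tent (weighted_sum real_of_int x) = x"
proof -
  note x = polyhedronD[OF assms is_complex_line]
  from x(2) consider l where "support x = {l}" | l where "support x = {l, l + 1}" by auto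
  then show ?thesis
  proof cases
    case 1
    then have "x l = 1" using x(4) by simp
    moreover have "x k = 0" if "k \<noteq> l" for k using 1 that by (auto simp: support_def)
    moreover have "tent (of_int l) k = (if k = l then 1 else 0)" for k by (auto simp: tent_def)
    ultimately show ?thesis using 1 by (auto simp: weighted_sum_def)
  next
    case 2
    then have 3: "x l + x (l + 1) = 1" using x(4) by simp
    moreover have 0: "x k = 0" if "k \<noteq> l" "k \<noteq> l + 1" for k using 2 that by (auto simp: support_def)
    have "weighted_sum real_of_int x = (x l + x (l + 1)) * of_int l + x (l + 1)"
      unfolding weighted_sum_def 2 by (simp add: algebra_simps)
    then have 4: "weighted_sum real_of_int x = of_int l + x (l + 1)"
      using 3 by simp
    have "tent (of_int l + x (l + 1)) k = x k" for k
    proof -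
      have "0 \<le> x l" "0 \<le> x (l + 1)" using x(5) by auto
      consider "k = l" | "k = l + 1" | "k \<le> l - 1" | "k \<ge> l + 2" by linarith
      then show ?thesis
        using \<open>0 \<le> x l\<close> \<open>0 \<le> x (l + 1)\<close> 3 0[of k]
        by cases (auto simp: tent_def)
    qed
    then show ?thesis using 4 by auto
  qed
qed

lemma support_in_line:
  assumes "x \<in> polyhedron (line_simplexes A)"
  shows "support x = near (weighted_sum real_of_int x)" "support x \<subseteq> A"
  using support_tent[of "weighted_sum real_of_int x"] unfolding tent_weighted_sum[OF assms]
  using polyhedronD(2)[OF assms is_complex_line] by auto

lemma line_complex_chart:
  "df_map (realization (line_complex A h1 h2)) (line_space A h1 h2) (weighted_sum real_of_int)"
  unfolding df_map_def doubly_filtered_def height_le_def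
  using support_in_line[of _ A]
  by (auto simp: realization_def line_complex_def line_space_def continuous_map_in_subtopology
      continuous_map_weighted_sum is_complex_line)

lemma line_complex_chart_inverse:
  "df_map (line_space A h1 h2) (realization (line_complex A h1 h2)) tent"
proof -
  define D where "D = {y::real. \<lfloor>y\<rfloor> \<in> A \<and> \<lceil>y\<rceil> \<in> A}"
  have "continuous_map (top_of_set D) (weak_topology (line_simplexes A)) tent"
  proof (rule continuous_map_into_weak_topology)
    fix l
    have "continuous_on D (\<lambda>y. tent y l)"
      unfolding tent_def by (intro continuous_intros)
    then show "continuous_map (top_of_set D) euclideanreal (\<lambda>y. tent y l)"
      by (simp add: continuous_map_iff_continuous)
  next
    fix y assume "y \<in> topspace (top_of_set D)"
    then have y: "y \<in> D" by simp
    then show "tent y \<in> polyhedron (line_simplexes A)" using tent_in_line[of y A] by (simp add: D_def)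
    have "support (tent y') \<subseteq> {\<lfloor>y\<rfloor> - 2..\<lceil>y\<rceil> + 2}" if "y' \<in> {y-1<..<y+1}" for y'
      using that unfolding support_tent by auto linarith+
    then show "\<exists>N W. openin (top_of_set D) N \<and> y \<in> N \<and> finite W \<and> (\<forall>y'\<in>N. support (tent y') \<subseteq> W)"
      using y by (intro exI[of _ "D \<inter> {y-1<..<y+1}"] exI[of _ "{\<lfloor>y\<rfloor> - 2..\<lceil>y\<rceil> + 2}"] conjI openin_open_Int)
        auto
  qed (rule is_complex_line)
  then show ?thesis
    unfolding df_map_def doubly_filtered_def height_le_def
    by (auto simp: realization_def line_complex_def line_space_def D_def support_tent)
qed

lemma line_complex_df_equivalence:
  "df_homotopy_equivalence (line_space A h1 h2) (realization (line_complex A h1 h2)) tent"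
  by (rule df_homotopy_equivalence_iso[OF line_complex_chart_inverse line_complex_chart])
    (auto simp: weighted_sum_tent tent_weighted_sum realization_def line_complex_def)

lemma min_rounding_le:
  fixes h :: "int \<Rightarrow> real"
  assumes "\<And>l. l \<in> near w \<Longrightarrow> \<exists>l'\<in>near y. h l' \<le> h l"
  shows "min (h \<lfloor>y\<rfloor>) (h \<lceil>y\<rceil>) \<le> min (h \<lfloor>w\<rfloor>) (h \<lceil>w\<rceil>)"
  using assms[of "\<lfloor>w\<rfloor>"] assms[of "\<lceil>w\<rceil>"] by fastforce

text \<open>The point \<open>w\<close> lies on the straight way from \<open>y\<close> to the
  interval from \<open>a\<close> to \<open>b\<close> and stays on the side of \<open>y\<close>, so
  its floor and ceiling have moved in the direction in which \<open>h\<close> does not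
  decrease.\<close>

lemma clamp_height_le:
  fixes h :: "int \<Rightarrow> real" and y t :: real
  assumes "a \<le> b" "mono_on {..a} h" "antimono_on {b..} h" "0 \<le> t" "t \<le> 1"
  defines "w \<equiv> (1 - t) * y + t * max (of_int a) (min (of_int b) y)"
  shows "min (h \<lfloor>y\<rfloor>) (h \<lceil>y\<rceil>) \<le> min (h \<lfloor>w\<rfloor>) (h \<lceil>w\<rceil>)"
proof -
  consider "of_int a \<le> y" "y \<le> of_int b" | "y < of_int a" | "of_int b < y" by linarith
  then show ?thesis
  proof cases
    case 1
    then have "w = y" by (simp add: w_def algebra_simps)
    then show ?thesis by simp
  next
    case 2
    have "w - y = t * (of_int a - y)" "of_int a - w = (1 - t) * (of_int a - y)"
      using 2 assms(1) by (auto simp: w_def algebra_simps)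
    then have "y \<le> w" "w \<le> of_int a"
      using 2 assms(4,5) by (smt (verit) mult_nonneg_nonneg)+
    then have "\<lfloor>y\<rfloor> \<le> \<lfloor>w\<rfloor>" "\<lceil>y\<rceil> \<le> \<lceil>w\<rceil>" "\<lceil>w\<rceil> \<le> a" "\<lfloor>w\<rfloor> \<le> a" by linarith+
    then have "h \<lfloor>y\<rfloor> \<le> h \<lfloor>w\<rfloor>" "h \<lceil>y\<rceil> \<le> h \<lceil>w\<rceil>"
      using assms(2) by (auto simp: monotone_on_def)
    then show ?thesis by auto
  next
    case 3
    have "y - w = t * (y - of_int b)" "w - of_int b = (1 - t) * (y - of_int b)"
      using 3 assms(1) by (auto simp: w_def algebra_simps)
    then have "w \<le> y" "of_int b \<le> w"
      using 3 assms(4,5) by (smt (verit) mult_nonneg_nonneg)+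
    then have "\<lfloor>w\<rfloor> \<le> \<lfloor>y\<rfloor>" "\<lceil>w\<rceil> \<le> \<lceil>y\<rceil>" "b \<le> \<lceil>w\<rceil>" "b \<le> \<lfloor>w\<rfloor>" by linarith+
    then have "h \<lfloor>y\<rfloor> \<le> h \<lfloor>w\<rfloor>" "h \<lceil>y\<rceil> \<le> h \<lceil>w\<rceil>"
      using assms(3) by (auto simp: monotone_on_def)
    then show ?thesis by auto
  qed
qed

lemma line_space_retract:
  assumes ab: "a \<le> b" and h: "mono_on {..a} h1" "antimono_on {b..} h1" "mono_on {..a} h2" "antimono_on {b..} h2"
  shows "df_homotopy_equivalence (line_space UNIV h1 h2) (line_space {a..b} h1 h2)
     (\<lambda>y. max (of_int a) (min (of_int b) y))"
proof -
  define c :: "real \<Rightarrow> real" where "c y = max (of_int a) (min (of_int b) y)" for y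
  have D: "{y::real. \<lfloor>y\<rfloor> \<in> {a..b} \<and> \<lceil>y\<rceil> \<in> {a..b}} = {of_int a..of_int b}"
    by (auto simp: le_floor_iff ceiling_le_iff) linarith+
  have c_id: "c y = y" if "y \<in> {of_int a..of_int b}" for y using that by (auto simp: c_def)
  have c_in: "c y \<in> {of_int a..of_int b}" for y using ab by (auto simp: c_def)
  have le: "min (h \<lfloor>y\<rfloor>) (h \<lceil>y\<rceil>) \<le> min (h \<lfloor>c y\<rfloor>) (h \<lceil>c y\<rceil>)"
    if "mono_on {..a} h" "antimono_on {b..} h" for h :: "int \<Rightarrow> real" and y
    using clamp_height_le[OF ab that, of 1 y] by (simp add: c_def)
  have c: "df_map (line_space UNIV h1 h2) (line_space {a..b} h1 h2) c"
    unfolding df_map_def doubly_filtered_def height_le_def line_space_def D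
    using c_in le h
    by (auto simp: c_def continuous_map_in_subtopology Pi_iff intro!: continuous_intros)
  have i: "df_map (line_space {a..b} h1 h2) (line_space UNIV h1 h2) (\<lambda>y. y)"
    unfolding df_map_def doubly_filtered_def height_le_def line_space_def D by auto
  have "df_homotopic (line_space UNIV h1 h2) (line_space UNIV h1 h2) id ((\<lambda>y. y) \<circ> c)"
  proof (rule df_homotopicI[where h = "\<lambda>t y. (1 - t) * y + t * c y"])
    have "continuous_on ({0..1} \<times> UNIV) (\<lambda>p::real\<times>real. (1 - fst p) * snd p + fst p * c (snd p))"
      unfolding c_def by (intro continuous_intros)
    then show "continuous_map (prod_topology (top_of_set {0..1}) (space_of (line_space UNIV h1 h2)))
      (space_of (line_space UNIV h1 h2)) (\<lambda>p. (1 - fst p) * snd p + fst p * c (snd p))"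
      unfolding line_space_def by (simp add: prod_topology_subtopology(1) subtopology_UNIV flip: continuous_map_iff_continuous)
    show "doubly_filtered (line_space UNIV h1 h2) (line_space UNIV h1 h2) (\<lambda>y. (1 - t) * y + t * c y)"
      if "0 \<le> t" "t \<le> 1" for t
      using clamp_height_le[OF ab h(1,2) that] clamp_height_le[OF ab h(3,4) that]
      unfolding doubly_filtered_def height_le_def line_space_def c_def by auto
  qed auto
  then have "df_homotopic (line_space UNIV h1 h2) (line_space UNIV h1 h2) ((\<lambda>y. y) \<circ> c) id"
    by (rule df_homotopic_sym)
  moreover have "df_homotopic (line_space {a..b} h1 h2) (line_space {a..b} h1 h2) (c \<circ> (\<lambda>y. y)) id"
    by (rule df_homotopic_eq[OF df_map_compose[OF i c]]) (simp only: line_space_def df_space.simps topspace_euclidean_subtopology D comp_apply id_apply c_id)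
  ultimately show ?thesis
    using c i unfolding df_homotopy_equivalence_def c_def by blast
qed

section \<open>Cubes and Euclidean space\<close>

text \<open>The model of the knot lattice space is the Euclidean space with a coordinate for every vertex.
  A point lies in the open cube whose vertices are its coordinatewise roundings.\<close>

definition roundings :: "'v set \<Rightarrow> ('v \<Rightarrow> real) \<Rightarrow> ('v \<Rightarrow> int) set" where
  "roundings V y = {z. \<forall>v. if v \<in> V then z v \<in> near (y v) else z v = 0}"

definition cube_space :: "'v set \<Rightarrow> (('v \<Rightarrow> int) \<Rightarrow> real) \<Rightarrow> (('v \<Rightarrow> int) \<Rightarrow> real) \<Rightarrow> ('v \<Rightarrow> real) df_space" where
  "cube_space V f g = \<lparr>space_of = top_of_set {y. \<forall>v. v \<notin> V \<longrightarrow> y v = 0},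
     hU = (\<lambda>y. Min (f ` roundings V y)), hV = (\<lambda>y. Min (g ` roundings V y))\<rparr>"

lemma finite_functions_on:
  fixes A :: "'v \<Rightarrow> int set"
  assumes "finite V" "\<And>v. v \<in> V \<Longrightarrow> finite (A v)"
  shows "finite {z. \<forall>v. if v \<in> V then z v \<in> A v else z v = 0}"
proof (rule finite_subset)
  show "{z. \<forall>v. if v \<in> V then z v \<in> A v else z v = 0} \<subseteq>
     {z. \<forall>v. (v \<in> V \<longrightarrow> z v \<in> (\<Union>v\<in>V. A v)) \<and> (v \<notin> V \<longrightarrow> z v = 0)}"
    by (auto split: if_splits)
  show "finite {z. \<forall>v. (v \<in> V \<longrightarrow> z v \<in> (\<Union>v\<in>V. A v)) \<and> (v \<notin> V \<longrightarrow> z v = 0)}"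
    using assms by (intro finite_set_of_finite_funs) auto
qed

lemma finite_roundings: "finite V \<Longrightarrow> finite (roundings V y)"
  unfolding roundings_def by (rule finite_functions_on) auto

lemma roundings_nonempty: "roundings V y \<noteq> {}"
proof -
  have "(\<lambda>v. if v \<in> V then \<lfloor>y v\<rfloor> else 0) \<in> roundings V y" by (simp add: roundings_def)
  then show ?thesis by blast
qed

lemma Min_roundings_le:
  fixes f f' :: "('v \<Rightarrow> int) \<Rightarrow> real"
  assumes "finite V" and "\<And>z'. z' \<in> roundings V y' \<Longrightarrow> \<exists>z\<in>roundings V y. f z \<le> f' z'"
  shows "Min (f ` roundings V y) \<le> Min (f' ` roundings V y')"
proof -
  have "Min (f' ` roundings V y') \<in> f' ` roundings V y'"
    using assms(1) by (intro Min_in) (auto simp: finite_roundings roundings_nonempty)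
  then obtain z' where z': "z' \<in> roundings V y'" "Min (f' ` roundings V y') = f' z'" by auto
  obtain z where z: "z \<in> roundings V y" "f z \<le> f' z'" using assms(2)[OF z'(1)] by auto
  have "Min (f ` roundings V y) \<le> f z"
    using assms(1) z(1) by (intro Min_le) (auto simp: finite_roundings)
  then show ?thesis using z z' by simp
qed

text \<open>Twice the distance to the nearest integer: 0 at the integers, 1 at the midpoints between
  them.\<close>

definition int_dist :: "real \<Rightarrow> real" where
  "int_dist r = 1 - \<bar>2 * frac r - 1\<bar>"

lemma int_dist_bounds: "0 \<le> int_dist r" "int_dist r \<le> 1"
  unfolding int_dist_def using frac_ge_0[of r] frac_lt_1[of r] by linarith+

text \<open>Together with \<open>int_dist_vertex\<close> this replaces the discontinuous floor and
  \<open>round\<close> by inequalities against a fixed integer \<open>a\<close>. The thresholds that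
  select a fixed cube then form an interval whose ends vary continuously with the point.\<close>

lemma int_dist_edge:
  assumes "0 < s" "s \<le> 1"
  shows "s \<le> 1 - \<bar>2 * (r - of_int a) - 1\<bar> \<longleftrightarrow> s \<le> int_dist r \<and> a = \<lfloor>r\<rfloor>"
proof
  assume *: "s \<le> 1 - \<bar>2 * (r - of_int a) - 1\<bar>"
  then have "of_int a < r" "r < of_int a + 1" using assms by argo+
  then have "a = \<lfloor>r\<rfloor>" by linarith
  then show "s \<le> int_dist r \<and> a = \<lfloor>r\<rfloor>" using * by (simp add: int_dist_def frac_def)
qed (simp add: int_dist_def frac_def)

lemma int_dist_vertex:
  assumes "0 < s" "s \<le> 1"
  shows "2 * \<bar>r - of_int a\<bar> < s \<longleftrightarrow> \<not> s \<le> int_dist r \<and> a = round r"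
proof
  assume *: "2 * \<bar>r - of_int a\<bar> < s"
  then have "2 * of_int a \<le> 2 * r + 1" "2 * r + 1 < 2 * of_int a + 2" using assms by argo+
  then have a: "a = round r" unfolding round_def by linarith
  have "a = \<lfloor>r\<rfloor> \<or> a = \<lfloor>r\<rfloor> + 1" unfolding a round_def by linarith
  then have "of_int a = (of_int \<lfloor>r\<rfloor> :: real) \<or> of_int a = (of_int \<lfloor>r\<rfloor> + 1 :: real)" by auto
  then have "int_dist r < s" using * unfolding int_dist_def frac_def by argo
  then show "\<not> s \<le> int_dist r \<and> a = round r" using a by simp
next
  assume *: "\<not> s \<le> int_dist r \<and> a = round r"
  then have n: "1 - \<bar>2 * (r - of_int \<lfloor>r\<rfloor>) - 1\<bar> < s" by (simp add: int_dist_def frac_def)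
  have r: "of_int \<lfloor>r\<rfloor> \<le> r" "r < of_int \<lfloor>r\<rfloor> + 1" by linarith+
  have b: "2 * of_int a \<le> 2 * r + 1" "2 * r + 1 < 2 * of_int a + 2" using * unfolding round_def by linarith+
  have "a = \<lfloor>r\<rfloor> \<or> a = \<lfloor>r\<rfloor> + 1" using * unfolding round_def by linarith
  then consider "of_int a = (of_int \<lfloor>r\<rfloor> :: real)" | "of_int a = (of_int \<lfloor>r\<rfloor> + 1 :: real)" by auto
  then show "2 * \<bar>r - of_int a\<bar> < s"
  proof cases
    case 1
    show ?thesis using n r b unfolding 1 by argo
  next
    case 2
    show ?thesis using n r b unfolding 2 by argo
  qed
qed

text \<open>The mean over all thresholds in one coordinate: up to \<open>int_dist r\<close> the cube
  extends and has its midpoint at floor plus 1/2, above it the cube sits at the nearest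
  integer.\<close>

lemma int_dist_average: "int_dist r * (of_int \<lfloor>r\<rfloor> + 1/2) + (1 - int_dist r) * of_int (round r) = r"
proof (cases "frac r < 1/2")
  case True
  then have "round r = \<lfloor>r\<rfloor>" unfolding frac_def round_def by linarith
  moreover have "int_dist r = 2 * frac r" using True by (simp add: int_dist_def abs_if)
  ultimately show ?thesis by (simp add: frac_def algebra_simps)
next
  case False
  then have *: "round r = \<lfloor>r\<rfloor> + 1" unfolding frac_def round_def by linarith
  have "int_dist r = 2 - 2 * frac r" using False by (simp add: int_dist_def abs_if)
  note * = * this
  show ?thesis unfolding * by (simp add: frac_def algebra_simps)
qed

lemma round_floor_cases: "round (r::real) = \<lfloor>r\<rfloor> \<or> round r = \<lfloor>r\<rfloor> + 1"
  unfolding round_def by linarith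

lemma continuous_on_Max_insert:
  fixes f :: "'i \<Rightarrow> 'a::topological_space \<Rightarrow> real"
  assumes "finite I" "\<And>i. i \<in> I \<Longrightarrow> continuous_on S (f i)"
  shows "continuous_on S (\<lambda>x. Max (insert c ((\<lambda>i. f i x) ` I)))"
  using assms
proof (induction I)
  case (insert i I)
  have "Max (insert c ((\<lambda>i. f i x) ` insert i I)) = max (f i x) (Max (insert c ((\<lambda>i. f i x) ` I)))" for x
    using insert.hyps by (simp add: insert_commute[of c])
  then show ?case using insert by (auto intro!: continuous_intros)
qed simp

lemma continuous_on_Min_insert:
  fixes f :: "'i \<Rightarrow> 'a::topological_space \<Rightarrow> real"
  assumes "finite I" "\<And>i. i \<in> I \<Longrightarrow> continuous_on S (f i)"
  shows "continuous_on S (\<lambda>x. Min (insert c ((\<lambda>i. f i x) ` I)))"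
  using assms
proof (induction I)
  case (insert i I)
  have "Min (insert c ((\<lambda>i. f i x) ` insert i I)) = min (f i x) (Min (insert c ((\<lambda>i. f i x) ` I)))" for x
    using insert.hyps by (simp add: insert_commute[of c])
  then show ?case using insert by (auto intro!: continuous_intros)
qed simp

section \<open>Lattice coordinates on the characteristic classes\<close>

lemma PD_add: "PD H (\<lambda>v. x v + y v) = (\<lambda>v. PD H x v + PD H y v)"
  by (auto simp: PD_def distrib_right sum.distrib fun_eq_iff)

lemma PD_minus: "PD H (\<lambda>v. - x v) = (\<lambda>v. - PD H x v)"
  by (auto simp: PD_def sum_negf fun_eq_iff)

text \<open>Bijectivity of \<open>PD\<close> on integral classes is unimodularity of the
  intersection form: there is only one orbit of characteristic classes, and the disk class has an
  integral dual.\<close>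

locale unimodular_plumbing =
  fixes H :: "'v plumbing"
  assumes finite_verts: "finite (verts H)"
    and intersection_sym: "\<And>v w. v \<in> verts H \<Longrightarrow> w \<in> verts H \<Longrightarrow> intersection H v w = intersection H w v"
    and base_in: "base H \<in> verts H"
    and PD_bij: "bij_betw (PD H) {z. \<forall>v. v \<notin> verts H \<longrightarrow> z v = 0} {z. \<forall>v. v \<notin> verts H \<longrightarrow> z v = 0}"
begin

definition lattice :: "('v \<Rightarrow> int) set" where
  "lattice = {z. \<forall>v. v \<notin> verts H \<longrightarrow> z v = 0}"

definition char_of :: "('v \<Rightarrow> int) \<Rightarrow> 'v \<Rightarrow> int" where
  "char_of z = (\<lambda>v. K_con H v + 2 * PD H z v)"

definition coord :: "('v \<Rightarrow> int) \<Rightarrow> 'v \<Rightarrow> int" where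
  "coord = inv_into lattice char_of"

text \<open>In lattice coordinates the flip map is the translation by \<open>disk_dual\<close>, and
  conjugation of characteristic classes is \<open>z \<mapsto> - z - con_dual\<close>.\<close>

definition disk_dual :: "'v \<Rightarrow> int" where
  "disk_dual = inv_into lattice (PD H) (PD_disk H)"

definition con_dual :: "'v \<Rightarrow> int" where
  "con_dual = inv_into lattice (PD H) (K_con H)"

lemma lattice_simps [simp, intro]:
  "I \<subseteq> verts H \<Longrightarrow> indicator I \<in> lattice"
  "x \<in> lattice \<Longrightarrow> y \<in> lattice \<Longrightarrow> (\<lambda>v. x v + y v) \<in> lattice"
  "x \<in> lattice \<Longrightarrow> y \<in> lattice \<Longrightarrow> (\<lambda>v. x v - y v) \<in> lattice"
  "x \<in> lattice \<Longrightarrow> (\<lambda>v. - x v) \<in> lattice"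
  by (auto simp: lattice_def indicator_def)

lemma PD_bij': "bij_betw (PD H) lattice lattice"
  using PD_bij by (simp add: lattice_def)

lemma disk_dual: "disk_dual \<in> lattice" "PD H disk_dual = PD_disk H"
proof -
  have "PD_disk H \<in> PD H ` lattice"
    using base_in bij_betw_imp_surj_on[OF PD_bij'] by (auto simp: PD_disk_def)
  then show "disk_dual \<in> lattice" "PD H disk_dual = PD_disk H"
    unfolding disk_dual_def by (rule inv_into_into, rule f_inv_into_f)
qed

lemma con_dual: "con_dual \<in> lattice" "PD H con_dual = K_con H"
proof -
  have "K_con H \<in> PD H ` lattice"
    unfolding bij_betw_imp_surj_on[OF PD_bij'] by (auto simp: K_con_def lattice_def)
  then show "con_dual \<in> lattice" "PD H con_dual = K_con H"
    unfolding con_dual_def by (rule inv_into_into, rule f_inv_into_f)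
qed

lemma inj_char_of: "inj_on char_of lattice"
proof (rule inj_onI)
  fix x y assume "x \<in> lattice" "y \<in> lattice" "char_of x = char_of y"
  then have "PD H x = PD H y" by (auto simp: char_of_def fun_eq_iff)
  then show "x = y" using PD_bij' \<open>x \<in> lattice\<close> \<open>y \<in> lattice\<close> by (auto simp: bij_betw_def inj_on_def)
qed

lemma coord_char_of [simp]: "z \<in> lattice \<Longrightarrow> coord (char_of z) = z"
  unfolding coord_def using inj_char_of by simp

lemma char_of_eq_iff [simp]: "x \<in> lattice \<Longrightarrow> y \<in> lattice \<Longrightarrow> char_of x = char_of y \<longleftrightarrow> x = y"
  using inj_char_of by (auto simp: inj_on_def)

text \<open>\<open>K_con\<close> has the parity of the weights, and half the difference of two
  characteristic classes lies in the image of \<open>PD\<close> by unimodularity.\<close>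

lemma characteristic_eq: "characteristic H = char_of ` lattice"
proof (intro equalityI subsetI)
  fix k assume k: "k \<in> characteristic H"
  define n where "n v = (k v - K_con H v) div 2" for v
  have n: "2 * n v = k v - K_con H v" for v
  proof (cases "v \<in> verts H")
    case True
    then have "even (k v - K_con H v)" using k by (auto simp: characteristic_def K_con_def)
    then show ?thesis by (simp add: n_def)
  next
    case False
    then show ?thesis using k by (simp add: characteristic_def K_con_def n_def)
  qed
  have "n \<in> lattice" using k by (simp add: lattice_def n_def characteristic_def K_con_def)
  then have "n \<in> PD H ` lattice" unfolding bij_betw_imp_surj_on[OF PD_bij'] .
  then obtain z where z: "z \<in> lattice" "PD H z = n" by auto
  have "k v = char_of z v" for v using n[of v] by (simp add: char_of_def z(2))
  then have "k = char_of z" by (rule ext)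
  then show "k \<in> char_of ` lattice" using z by auto
next
  fix k assume "k \<in> char_of ` lattice"
  then show "k \<in> characteristic H"
    by (auto simp: characteristic_def char_of_def K_con_def lattice_def PD_def)
qed

lemma spinc_eq:
  assumes "t \<in> spinc H"
  shows "t = char_of ` lattice"
proof -
  obtain k where k: "k \<in> characteristic H" "t = range (\<lambda>x v. k v + 2 * PD H x v)"
    using assms by (auto simp: spinc_def)
  then obtain z where z: "z \<in> lattice" "k = char_of z" by (auto simp: characteristic_eq)
  have 1: "(\<lambda>v. k v + 2 * PD H x v) = char_of (\<lambda>v. z v + x v)" for x
    by (auto simp: z(2) char_of_def PD_add algebra_simps)
  \<comment> \<open>The orbit in \<open>spinc\<close> is formed with arbitrary functions
    \<open>x\<close>. Only their values on the vertices enter \<open>PD\<close>, so cutting them off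
    outside gives lattice points.\<close>
  have 2: "PD H x = PD H (\<lambda>v. if v \<in> verts H then x v else 0)" for x
    by (auto simp: PD_def fun_eq_iff intro!: sum.cong)
  have "(\<lambda>v. k v + 2 * PD H x v) \<in> char_of ` lattice" for x
  proof -
    have "(\<lambda>v. k v + 2 * PD H x v) = char_of (\<lambda>v. z v + (if v \<in> verts H then x v else 0))"
      by (simp add: 1[symmetric] 2[of x])
    moreover have "(\<lambda>v. z v + (if v \<in> verts H then x v else 0)) \<in> lattice"
      using z(1) by (auto simp: lattice_def)
    ultimately show ?thesis by blast
  qed
  moreover have "char_of y \<in> t" for y
  proof -
    have "char_of y = (\<lambda>v. k v + 2 * PD H (\<lambda>v. y v - z v) v)" unfolding 1 by simp
    then show ?thesis unfolding k(2) by blast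
  qed
  ultimately show ?thesis unfolding k(2) by blast
qed

abbreviation T :: "('v \<Rightarrow> int) set" where "T \<equiv> char_of ` lattice"

lemma translate_char_of: "translate H (char_of z) I = char_of (\<lambda>v. z v + indicator I v)"
  by (auto simp: translate_def char_of_def PD_add algebra_simps fun_eq_iff)

lemma translate_disk_char_of: "translate_disk H (char_of z) = char_of (\<lambda>v. z v + disk_dual v)"
  by (auto simp: translate_disk_def char_of_def PD_add disk_dual algebra_simps fun_eq_iff)

text \<open>Since \<open>K_con = PD con_dual\<close>, the class \<open>- K_con\<close> equals
  \<open>K_con - 2 PD con_dual\<close>.\<close>

lemma minus_char_of: "(\<lambda>v. - char_of z v) = char_of (\<lambda>v. - z v - con_dual v)"
proof -
  have "(\<lambda>v. - z v - con_dual v) = (\<lambda>v. (- z v) + (- con_dual v))" by simp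
  then show ?thesis
    unfolding char_of_def by (simp only: PD_add PD_minus con_dual) (auto simp: fun_eq_iff)
qed

lemma cubes_iff: "c \<in> cubes H T \<longleftrightarrow> (\<exists>z E. z \<in> lattice \<and> E \<subseteq> verts H \<and> c = (char_of z, E))"
  by (auto simp: cubes_def)

lemma is_face_char_of:
  assumes "z \<in> lattice" "z' \<in> lattice" "E \<subseteq> verts H"
  shows "is_face H (char_of z', E') (char_of z, E) \<longleftrightarrow>
     E' \<subseteq> E \<and> (\<exists>I \<subseteq> E - E'. z' = (\<lambda>v. z v + indicator I v))"
proof -
  have "char_of z' = char_of (\<lambda>v. z v + indicator I v) \<longleftrightarrow> z' = (\<lambda>v. z v + indicator I v)"
    if "I \<subseteq> E - E'" for I
    using that assms by (intro char_of_eq_iff) auto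
  then show ?thesis by (auto simp: translate_char_of)
qed

text \<open>The nerve of the face relation is the barycentric subdivision of the cubed Euclidean
  space, so a cube, as a vertex of the nerve, is placed at its center.\<close>

definition barycenter :: "'v cube \<Rightarrow> 'v \<Rightarrow> real" where
  "barycenter c v = of_int (coord (fst c) v) + (if v \<in> snd c then 1/2 else 0)"

lemma barycenter_char_of [simp]:
  "z \<in> lattice \<Longrightarrow> barycenter (char_of z, E) v = of_int (z v) + (if v \<in> E then 1/2 else 0)"
  by (simp add: barycenter_def)

definition position :: "('v cube \<Rightarrow> real) \<Rightarrow> 'v \<Rightarrow> real" where
  "position x = (\<lambda>v. weighted_sum (\<lambda>c. barycenter c v) x)"

end

section \<open>The nerve of the cubes as a subdivision of Euclidean space\<close>

context unimodular_plumbing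
begin

abbreviation nerve :: "'v cube set set" where
  "nerve \<equiv> simplexes (cube_nerve H T)"

lemma nerve_iff: "\<sigma> \<in> nerve \<longleftrightarrow> \<sigma> \<noteq> {} \<and> finite \<sigma> \<and> \<sigma> \<subseteq> cubes H T \<and>
   (\<forall>c\<in>\<sigma>. \<forall>c'\<in>\<sigma>. is_face H c c' \<or> is_face H c' c)"
  by (simp add: cube_nerve_def)

lemma is_complex_nerve: "is_complex nerve"
  unfolding is_complex_def
proof (intro ballI conjI allI impI)
  fix \<sigma> \<rho> assume \<sigma>: "\<sigma> \<in> nerve" and \<rho>: "\<rho> \<subseteq> \<sigma>" "\<rho> \<noteq> {}"
  then have "finite \<rho>" by (auto simp: nerve_iff intro: finite_subset)
  then show "\<rho> \<in> nerve" using \<sigma> \<rho> unfolding nerve_iff by blast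
qed (simp add: nerve_iff)

lemma is_face_refl: "is_face H c c"
  by (cases c) (auto simp: translate_def PD_def fun_eq_iff intro!: exI[of _ "{}"])

lemma cubeE:
  assumes "c \<in> cubes H T"
  obtains z E where "z \<in> lattice" "E \<subseteq> verts H" "c = (char_of z, E)"
  using assms by (auto simp: cubes_iff)

lemma is_face_antisym:
  assumes "c \<in> cubes H T" "c' \<in> cubes H T" "is_face H c c'" "is_face H c' c"
  shows "c = c'"
proof -
  obtain z E where c: "z \<in> lattice" "E \<subseteq> verts H" "c = (char_of z, E)" using assms(1) by (rule cubeE)
  obtain z' E' where c': "z' \<in> lattice" "E' \<subseteq> verts H" "c' = (char_of z', E')" using assms(2) by (rule cubeE)
  have E: "E = E'" using assms(3,4) c c' by auto
  have "z = z'" using assms(3) c c' unfolding c(3) c'(3) E by (subst (asm) is_face_char_of) auto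
  then show ?thesis using E c c' by simp
qed

text \<open>The inverse of \<open>position\<close>: a point of Euclidean space and a threshold between 0 and 1 determine
  the cube that extends in the coordinates whose distance to the integers, scaled to be at most 1,
  is at least the threshold. The barycentric coordinate of a cube is the length of the set of
  thresholds that yield it.\<close>

definition level_set :: "('v \<Rightarrow> real) \<Rightarrow> real \<Rightarrow> 'v set" where
  "level_set y s = {v \<in> verts H. s \<le> int_dist (y v)}"

text \<open>Ties in \<open>round\<close> do not matter: at a half-integer \<open>int_dist\<close> is
  1, so for thresholds up to 1 that coordinate belongs to the level set.\<close>

definition level_coord :: "('v \<Rightarrow> real) \<Rightarrow> 'v set \<Rightarrow> 'v \<Rightarrow> int" where
  "level_coord y E v = (if v \<in> verts H then if v \<in> E then \<lfloor>y v\<rfloor> else round (y v) else 0)"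

definition level :: "('v \<Rightarrow> real) \<Rightarrow> real \<Rightarrow> 'v cube" where
  "level y s = (char_of (level_coord y (level_set y s)), level_set y s)"

definition spread :: "('v \<Rightarrow> real) \<Rightarrow> 'v cube \<Rightarrow> real" where
  "spread y c = measure lborel {s \<in> {0<..1}. level y s = c}"

lemma level_coord_lattice [simp]: "level_coord y E \<in> lattice"
  by (simp add: level_coord_def lattice_def)

lemma level_set_subset: "level_set y s \<subseteq> verts H"
  by (auto simp: level_set_def)

lemma level_in_cubes: "level y s \<in> cubes H T"
  unfolding level_def cubes_def using level_set_subset by auto

lemma level_eq_iff:
  assumes z: "z \<in> lattice" and E: "E \<subseteq> verts H" and s: "0 < s" "s \<le> 1"
  shows "level y s = (char_of z, E) \<longleftrightarrow>
     (\<forall>v\<in>E. s \<le> 1 - \<bar>2 * (y v - of_int (z v)) - 1\<bar>) \<and> (\<forall>v\<in>verts H - E. 2 * \<bar>y v - of_int (z v)\<bar> < s)"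
    (is "_ \<longleftrightarrow> ?R")
proof -
  have "?R \<longleftrightarrow> (\<forall>v\<in>E. s \<le> int_dist (y v) \<and> z v = \<lfloor>y v\<rfloor>) \<and>
      (\<forall>v\<in>verts H - E. \<not> s \<le> int_dist (y v) \<and> z v = round (y v))"
    using int_dist_edge[OF s] int_dist_vertex[OF s] by simp
  also have "\<dots> \<longleftrightarrow> level_set y s = E \<and> level_coord y E = z"
    using z E unfolding level_set_def level_coord_def lattice_def fun_eq_iff by auto
  also have "\<dots> \<longleftrightarrow> level y s = (char_of z, E)"
    using z by (auto simp: level_def)
  finally show ?thesis by simp
qed

text \<open>The elements 0 and 1 inserted into the two sets are the bounds on the thresholds
  themselves. Both ends depend continuously on \<open>y\<close>, which makes \<open>spread\<close>
  continuous.\<close>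

lemma level_interval:
  assumes z: "z \<in> lattice" and E: "E \<subseteq> verts H"
  shows "{s \<in> {0<..1}. level y s = (char_of z, E)} =
     {Max (insert 0 ((\<lambda>v. 2 * \<bar>y v - of_int (z v)\<bar>) ` (verts H - E))) <..
      Min (insert 1 ((\<lambda>v. 1 - \<bar>2 * (y v - of_int (z v)) - 1\<bar>) ` E))}"
proof -
  have fin: "finite E" using E finite_verts finite_subset by blast
  have Max: "Max (insert 0 ((\<lambda>v. 2 * \<bar>y v - of_int (z v)\<bar>) ` (verts H - E))) < s \<longleftrightarrow>
      0 < s \<and> (\<forall>v\<in>verts H - E. 2 * \<bar>y v - of_int (z v)\<bar> < s)" for s
    using finite_verts by (subst Max_less_iff) (simp_all only: ball_simps finite_insert finite_imageI finite_Diff, simp)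
  have Min: "s \<le> Min (insert 1 ((\<lambda>v. 1 - \<bar>2 * (y v - of_int (z v)) - 1\<bar>) ` E)) \<longleftrightarrow>
      s \<le> 1 \<and> (\<forall>v\<in>E. s \<le> 1 - \<bar>2 * (y v - of_int (z v)) - 1\<bar>)" for s
    using fin by (subst Min_ge_iff) (simp_all only: ball_simps finite_insert finite_imageI, simp)
  show ?thesis
    using level_eq_iff[OF z E, of _ y]
    unfolding set_eq_iff mem_Collect_eq greaterThanAtMost_iff Max Min by blast
qed

lemma spread_char_of:
  assumes z: "z \<in> lattice" and E: "E \<subseteq> verts H"
  shows "spread y (char_of z, E) =
     max 0 (Min (insert 1 ((\<lambda>v. 1 - \<bar>2 * (y v - of_int (z v)) - 1\<bar>) ` E)) -
            Max (insert 0 ((\<lambda>v. 2 * \<bar>y v - of_int (z v)\<bar>) ` (verts H - E))))"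
proof -
  have "measure lborel {lo<..hi} = max 0 (hi - lo)" for lo hi :: real
    by (cases "lo \<le> hi") auto
  then show ?thesis unfolding spread_def level_interval[OF z E] .
qed

lemma level_borel: "{s \<in> {0<..1}. level y s = c} \<in> sets lborel"
proof (cases "c \<in> cubes H T")
  case True
  then obtain z E where "z \<in> lattice" "E \<subseteq> verts H" "c = (char_of z, E)" by (rule cubeE)
  then show ?thesis by (simp only: level_interval) simp
next
  case False
  then have "{s \<in> {0<..1}. level y s = c} = {}" using level_in_cubes by blast
  then show ?thesis by (metis sets.empty_sets)
qed

lemma finite_levels: "finite (level y ` {0<..1})"
proof (rule finite_subset)
  show "level y ` {0<..1} \<subseteq> (\<lambda>E. (char_of (level_coord y E), E)) ` Pow (verts H)"
    using level_set_subset by (auto simp: level_def)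
qed (simp add: finite_verts)

text \<open>Additivity of length: sums of barycentric coordinates become measures of sets of
  thresholds, which can be read off directly.\<close>

lemma sum_spread:
  assumes "finite A" "level y ` {0<..1} \<subseteq> A"
  shows "(\<Sum>c\<in>{c\<in>A. P c}. spread y c) = measure lborel {s \<in> {0<..1}. P (level y s)}"
proof -
  have fin: "emeasure lborel {s \<in> {0<..1}. level y s = c} \<noteq> \<infinity>" for c
  proof -
    have "emeasure lborel {s \<in> {0<..1}. level y s = c} \<le> emeasure lborel {0<..1::real}"
      by (rule emeasure_mono) auto
    also have "\<dots> < \<infinity>" by simp
    finally show ?thesis by simp
  qed
  have "measure lborel (\<Union>c\<in>{c\<in>A. P c}. {s \<in> {0<..1}. level y s = c}) =
     (\<Sum>c\<in>{c\<in>A. P c}. measure lborel {s \<in> {0<..1}. level y s = c})"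
  proof (rule measure_finite_Union)
    show "(\<lambda>c. {s \<in> {0<..1}. level y s = c}) ` {c \<in> A. P c} \<subseteq> sets lborel"
      using level_borel by blast
    show "disjoint_family_on (\<lambda>c. {s \<in> {0<..1}. level y s = c}) {c \<in> A. P c}"
      unfolding disjoint_family_on_def by blast
  qed (use assms(1) fin in simp_all)
  moreover have "level y s \<in> A" if "s \<in> {0<..1}" for s using assms(2) that by blast
  then have "(\<Union>c\<in>{c\<in>A. P c}. {s \<in> {0<..1}. level y s = c}) = {s \<in> {0<..1}. P (level y s)}"
    by blast
  ultimately show ?thesis by (simp add: spread_def)
qed

lemma sum_spread_extends:
  assumes "finite A" "level y ` {0<..1} \<subseteq> A" "v \<in> verts H"
  shows "(\<Sum>c\<in>{c\<in>A. v \<in> snd c}. spread y c) = int_dist (y v)"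
    and "(\<Sum>c\<in>{c\<in>A. v \<notin> snd c}. spread y c) = 1 - int_dist (y v)"
proof -
  have "{s \<in> {0<..1}. v \<in> snd (level y s)} = {0<..int_dist (y v)}"
    using assms(3) int_dist_bounds[of "y v"] by (auto simp: level_def level_set_def)
  then show "(\<Sum>c\<in>{c\<in>A. v \<in> snd c}. spread y c) = int_dist (y v)"
    unfolding sum_spread[OF assms(1,2)] using int_dist_bounds[of "y v"] by simp
  have "{s \<in> {0<..1}. v \<notin> snd (level y s)} = {int_dist (y v)<..1}"
    using assms(3) int_dist_bounds[of "y v"] by (auto simp: level_def level_set_def)
  then show "(\<Sum>c\<in>{c\<in>A. v \<notin> snd c}. spread y c) = 1 - int_dist (y v)"
    unfolding sum_spread[OF assms(1,2)] using int_dist_bounds[of "y v"] by simp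
qed

lemma spread_nonneg: "0 \<le> spread y c"
  by (simp add: spread_def)

lemma support_spread: "support (spread y) \<subseteq> level y ` {0<..1}"
proof -
  have "spread y c = 0" if "c \<notin> level y ` {0<..1}" for c
  proof -
    have "{s \<in> {0<..1}. level y s = c} = {}" using that by auto
    then show ?thesis by (simp only: spread_def measure_empty)
  qed
  then show ?thesis by (auto simp: support_def)
qed

lemma sum_spread_1:
  assumes "finite A" "level y ` {0<..1} \<subseteq> A"
  shows "(\<Sum>c\<in>A. spread y c) = 1"
proof -
  have "{s \<in> {0<..1}. True} = {0<..1::real}" by auto
  then show ?thesis using sum_spread[OF assms, of "\<lambda>_. True"] by (simp only:) simp
qed

text \<open>Raising the threshold collapses the coordinates that drop out of the level set to their
  nearest integer; \<open>I\<close> collects those that go to the upper end. Hence the levels of a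
  point form a chain of faces, that is, a simplex of the nerve.\<close>

lemma level_face:
  assumes "s \<le> s'"
  shows "is_face H (level y s') (level y s)"
proof -
  have sub: "level_set y s' \<subseteq> level_set y s" using assms by (auto simp: level_set_def)
  define I where "I = {v \<in> level_set y s - level_set y s'. round (y v) = \<lfloor>y v\<rfloor> + 1}"
  have "level_coord y (level_set y s') = (\<lambda>v. level_coord y (level_set y s) v + indicator I v)"
  proof
    fix v show "level_coord y (level_set y s') v = level_coord y (level_set y s) v + indicator I v"
      using round_floor_cases[of "y v"] sub level_set_subset[of y s]
      by (auto simp: level_coord_def I_def indicator_def)
  qed
  moreover have "I \<subseteq> level_set y s - level_set y s'" by (auto simp: I_def)
  ultimately show ?thesis
    using sub unfolding level_def
      is_face_char_of[OF level_coord_lattice level_coord_lattice level_set_subset] by blast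
qed

lemma spread_in_nerve: "spread y \<in> polyhedron nerve"
proof (rule polyhedronI)
  have fin: "finite (support (spread y))" using support_spread finite_levels finite_subset by blast
  have "(\<Sum>c\<in>support (spread y). spread y c) = (\<Sum>c\<in>level y ` {0<..1}. spread y c)"
    by (rule sum.mono_neutral_left[OF finite_levels support_spread]) (auto simp: support_def)
  then show 1: "(\<Sum>c\<in>support (spread y). spread y c) = 1"
    using sum_spread_1[OF finite_levels subset_refl] by simp
  have "support (spread y) \<noteq> {}" using 1 by (metis sum.empty zero_neq_one)
  moreover have "is_face H c c' \<or> is_face H c' c"
    if c: "c \<in> support (spread y)" "c' \<in> support (spread y)" for c c'
  proof -
    obtain s s' where "c = level y s" "c' = level y s'" using c support_spread[of y] by blast
    then show ?thesis using level_face linear by metis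
  qed
  ultimately show "support (spread y) \<in> nerve"
    unfolding nerve_iff using fin support_spread level_in_cubes by blast
qed (rule spread_nonneg)

lemma position_spread:
  assumes "\<And>v. v \<notin> verts H \<Longrightarrow> y v = 0"
  shows "position (spread y) = y"
proof
  fix v
  let ?L = "level y ` {0<..1}"
  have pos: "position (spread y) v = (\<Sum>c\<in>?L. spread y c * barycenter c v)"
    unfolding position_def by (rule weighted_sum_superset[OF finite_levels support_spread])
  show "position (spread y) v = y v"
  proof (cases "v \<in> verts H")
    case True
    let ?a = "of_int \<lfloor>y v\<rfloor> + 1/2 :: real" and ?b = "of_int (round (y v)) :: real"
    have "barycenter c v = (if v \<in> snd c then ?a else ?b)" if "c \<in> ?L" for c
      using that True by (auto simp: level_def level_coord_def)
    then have "position (spread y) v = (\<Sum>c\<in>?L. if v \<in> snd c then spread y c * ?a else spread y c * ?b)"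
      unfolding pos by (intro sum.cong) auto
    also have "\<dots> = (\<Sum>c\<in>{c\<in>?L. v \<in> snd c}. spread y c * ?a) + (\<Sum>c\<in>{c\<in>?L. v \<notin> snd c}. spread y c * ?b)"
    proof -
      have "{c\<in>?L. v \<in> snd c} = ?L \<inter> {c. v \<in> snd c}" "{c\<in>?L. v \<notin> snd c} = ?L \<inter> - {c. v \<in> snd c}"
        by blast+
      then show ?thesis using sum.If_cases[OF finite_levels] by simp
    qed
    also have "\<dots> = int_dist (y v) * ?a + (1 - int_dist (y v)) * ?b"
      by (simp only: sum_spread_extends[OF finite_levels subset_refl True] flip: sum_distrib_right)
    finally show ?thesis by (simp only: int_dist_average)
  next
    case False
    then have "barycenter c v = 0" if "c \<in> ?L" for c
      using that by (auto simp: level_def level_coord_def level_set_def)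
    then show ?thesis unfolding pos using assms[OF False] by simp
  qed
qed

text \<open>Jensen's inequality for the absolute value of an affine function, as
  \<open>position x\<close> is a convex combination of barycenters.\<close>

lemma position_abs_le:
  assumes "x \<in> polyhedron nerve"
  shows "\<bar>k * position x v + q\<bar> \<le> (\<Sum>c\<in>support x. x c * \<bar>k * barycenter c v + q\<bar>)"
proof -
  note x = polyhedronD[OF assms is_complex_nerve]
  have "k * position x v + q = (\<Sum>c\<in>support x. x c * (k * barycenter c v + q))"
  proof -
    have "q = (\<Sum>c\<in>support x. x c * q)" using x(4) by (simp flip: sum_distrib_right)
    moreover have "k * position x v = (\<Sum>c\<in>support x. x c * (k * barycenter c v))"
      by (simp add: position_def weighted_sum_def sum_distrib_left mult.left_commute)
    ultimately show ?thesis by (simp add: distrib_left sum.distrib)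
  qed
  also have "\<bar>\<dots>\<bar> \<le> (\<Sum>c\<in>support x. \<bar>x c * (k * barycenter c v + q)\<bar>)" by (rule sum_abs)
  also have "\<dots> = (\<Sum>c\<in>support x. x c * \<bar>k * barycenter c v + q\<bar>)"
    using x(5) by (simp add: abs_mult)
  finally show ?thesis .
qed

text \<open>If the cubes of the chain are stacked along the thresholds, the largest ones lowest,
  then \<open>c\<close> occupies the interval from \<open>U - x c\<close> to \<open>U\<close>. The
  bounds say that this interval lies inside the one of \<open>level_interval\<close>. For
  \<open>v\<close> in \<open>E\<close>, cubes that contain \<open>c\<close> have the same barycenter
  coordinate as \<open>c\<close> and its faces differ by at most 1/2; for \<open>v\<close> outside
  \<open>E\<close> the roles are exchanged.\<close>

lemma position_cell_bounds:
  assumes x: "x \<in> polyhedron nerve" and c: "c \<in> support x" "c = (char_of z, E)" "z \<in> lattice" "E \<subseteq> verts H"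
  defines "U \<equiv> (\<Sum>c'\<in>{c'\<in>support x. is_face H c c'}. x c')"
  shows "v \<in> E \<Longrightarrow> \<bar>2 * (position x v - of_int (z v)) - 1\<bar> \<le> 1 - U"
    and "v \<in> verts H - E \<Longrightarrow> 2 * \<bar>position x v - of_int (z v)\<bar> \<le> U - x c"
proof -
  note xx = polyhedronD[OF x is_complex_nerve]
  have cmp: "\<exists>z' E'. c' = (char_of z', E') \<and> z' \<in> lattice \<and> E' \<subseteq> verts H \<and>
      (is_face H c c' \<and> E \<subseteq> E' \<and> (\<exists>I\<subseteq>E' - E. z = (\<lambda>v. z' v + indicator I v)) \<or>
       \<not> is_face H c c' \<and> E' \<subseteq> E \<and> (\<exists>I\<subseteq>E - E'. z' = (\<lambda>v. z v + indicator I v)))"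
    if c': "c' \<in> support x" for c'
  proof -
    have "c' \<in> cubes H T" using xx(2) c' by (auto simp: nerve_iff)
    then obtain z' E' where z': "z' \<in> lattice" "E' \<subseteq> verts H" "c' = (char_of z', E')" by (rule cubeE)
    show ?thesis
    proof (cases "is_face H c c'")
      case True
      then show ?thesis using z' is_face_char_of[OF z'(1) c(3) z'(2), of E] c(2) by blast
    next
      case False
      then have "is_face H c' c" using xx(2) c(1) c' by (auto simp: nerve_iff)
      then show ?thesis using False z' is_face_char_of[OF c(3) z'(1) c(4), of E'] c(2) by blast
    qed
  qed
  {
    assume v: "v \<in> E"
    have b: "\<bar>2 * barycenter c' v + (- 2 * of_int (z v) - 1)\<bar> \<le> (if is_face H c c' then 0 else 1)"
      if "c' \<in> support x" for c'
      using cmp[OF that] v by (auto simp: indicator_def)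
    have "\<bar>2 * (position x v - of_int (z v)) - 1\<bar> = \<bar>2 * position x v + (- 2 * of_int (z v) - 1)\<bar>"
      by (simp add: algebra_simps)
    also have "\<dots> \<le> (\<Sum>c'\<in>support x. x c' * \<bar>2 * barycenter c' v + (- 2 * of_int (z v) - 1)\<bar>)"
      by (rule position_abs_le[OF x])
    also have "\<dots> \<le> (\<Sum>c'\<in>support x. x c' - (if is_face H c c' then x c' else 0))"
    proof (rule sum_mono)
      fix c' assume "c' \<in> support x"
      from mult_left_mono[OF b[OF this] xx(5)[of c']]
      show "x c' * \<bar>2 * barycenter c' v + (- 2 * of_int (z v) - 1)\<bar> \<le> x c' - (if is_face H c c' then x c' else 0)"
        by (simp split: if_splits)
    qed
    also have "\<dots> = 1 - U"
      unfolding U_def using xx(1,4) by (simp add: sum_subtractf sum.inter_filter)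
    finally show "\<bar>2 * (position x v - of_int (z v)) - 1\<bar> \<le> 1 - U" .
  }
  {
    assume v: "v \<in> verts H - E"
    have b: "\<bar>2 * barycenter c' v + (- 2 * of_int (z v))\<bar> \<le> (if is_face H c c' \<and> c' \<noteq> c then 1 else 0)"
      if "c' \<in> support x" for c'
    proof (cases "c' = c")
      case True
      then show ?thesis using v c(2,3) by simp
    next
      case False
      then show ?thesis using cmp[OF that] v by (auto simp: indicator_def)
    qed
    have "2 * \<bar>position x v - of_int (z v)\<bar> = \<bar>2 * position x v + (- 2 * of_int (z v))\<bar>"
      by argo
    also have "\<dots> \<le> (\<Sum>c'\<in>support x. x c' * \<bar>2 * barycenter c' v + (- 2 * of_int (z v))\<bar>)"
      by (rule position_abs_le[OF x])
    also have "\<dots> \<le> (\<Sum>c'\<in>support x. (if is_face H c c' then x c' else 0) - (if c' = c then x c' else 0))"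
    proof (rule sum_mono)
      fix c' assume "c' \<in> support x"
      from mult_left_mono[OF b[OF this] xx(5)[of c']]
      show "x c' * \<bar>2 * barycenter c' v + (- 2 * of_int (z v))\<bar> \<le>
          (if is_face H c c' then x c' else 0) - (if c' = c then x c' else 0)"
        using is_face_refl[of c] by (cases "c' = c"; cases "is_face H c c'") simp_all
    qed
    also have "\<dots> = U - x c"
      unfolding U_def using xx(1,4) c(1) by (simp add: sum_subtractf sum.inter_filter)
    finally show "2 * \<bar>position x v - of_int (z v)\<bar> \<le> U - x c" .
  }
qed

text \<open>By the cell bounds every barycentric coordinate of \<open>x\<close> is at most the
  corresponding one of \<open>spread (position x)\<close>. Both families sum to 1, so all the
  inequalities are equalities.\<close>

lemma spread_position:
  assumes x: "x \<in> polyhedron nerve"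
  shows "spread (position x) = x"
proof
  fix c
  note xx = polyhedronD[OF x is_complex_nerve]
  have ge: "x c \<le> spread (position x) c" if c: "c \<in> support x" for c
  proof -
    have "c \<in> cubes H T" using xx(2) c by (auto simp: nerve_iff)
    then obtain z E where z: "z \<in> lattice" "E \<subseteq> verts H" "c = (char_of z, E)" by (rule cubeE)
    define U where "U = (\<Sum>c'\<in>{c'\<in>support x. is_face H c c'}. x c')"
    have fin: "finite E" using z(2) finite_verts finite_subset by blast
    have U1: "U \<le> 1" unfolding U_def xx(4)[symmetric] using xx by (intro sum_mono2) auto
    have Ux: "x c \<le> U" unfolding U_def using xx c is_face_refl by (intro member_le_sum) auto
    note b = position_cell_bounds[OF x c z(3,1,2), folded U_def]
    have "U \<le> Min (insert 1 ((\<lambda>v. 1 - \<bar>2 * (position x v - of_int (z v)) - 1\<bar>) ` E))"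
      using fin U1 b(1) by (subst Min_ge_iff) fastforce+
    moreover have "Max (insert 0 ((\<lambda>v. 2 * \<bar>position x v - of_int (z v)\<bar>) ` (verts H - E))) \<le> U - x c"
      using finite_verts Ux b(2) by (subst Max_le_iff) fastforce+
    ultimately show ?thesis using spread_char_of[OF z(1,2), of "position x"] z(3) by simp
  qed
  define A where "A = support x \<union> level (position x) ` {0<..1}"
  have A: "finite A" using xx(1) finite_levels by (simp add: A_def)
  have "(\<Sum>c\<in>A. x c) = 1"
    unfolding xx(4)[symmetric] using A by (intro sum.mono_neutral_right) (auto simp: A_def support_def)
  then have "(\<Sum>c\<in>A. spread (position x) c - x c) = 0"
    using sum_spread_1[OF A] by (simp add: A_def sum_subtractf)
  moreover have nn: "0 \<le> spread (position x) c - x c" for c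
    using ge[of c] spread_nonneg[of "position x" c] by (cases "c \<in> support x") (auto simp: support_def)
  ultimately have "spread (position x) c - x c = 0" if "c \<in> A" for c
    using that A by (subst (asm) sum_nonneg_eq_0_iff) auto
  moreover have "spread (position x) c = 0" "x c = 0" if "c \<notin> A"
    using that support_spread[of "position x"] by (auto simp: A_def support_def)
  ultimately show "spread (position x) c = x c" by (cases "c \<in> A") auto
qed

lemma position_outside: "v \<notin> verts H \<Longrightarrow> x \<in> polyhedron nerve \<Longrightarrow> position x v = 0"
proof -
  assume v: "v \<notin> verts H" and x: "x \<in> polyhedron nerve"
  note xx = polyhedronD[OF x is_complex_nerve]
  have "barycenter c v = 0" if "c \<in> support x" for c
  proof -
    have "c \<in> cubes H T" using xx(2) that by (auto simp: nerve_iff)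
    then obtain z E where "z \<in> lattice" "E \<subseteq> verts H" "c = (char_of z, E)" by (rule cubeE)
    then show ?thesis using v by (auto simp: lattice_def)
  qed
  then show ?thesis by (simp add: position_def weighted_sum_def)
qed

end

section \<open>Heights, continuity and symmetries in Euclidean coordinates\<close>

lemma square_minus:
  fixes k :: "'v \<Rightarrow> int"
  shows "square H (\<lambda>v. - k v) = square H k"
proof -
  have "(\<exists>x :: 'v \<Rightarrow> real. (\<forall>v\<in>verts H. (\<Sum>w\<in>verts H. x w * of_int (intersection H w v)) = of_int (k' v)) \<and>
         r = (\<Sum>v\<in>verts H. of_int (k' v) * x v))"
    if ex: "\<exists>x :: 'v \<Rightarrow> real. (\<forall>v\<in>verts H. (\<Sum>w\<in>verts H. x w * of_int (intersection H w v)) = of_int (k v)) \<and>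
         r = (\<Sum>v\<in>verts H. of_int (k v) * x v)" and k': "\<And>v. k' v = - k v" for k k' :: "'v \<Rightarrow> int" and r
  proof -
    obtain x :: "'v \<Rightarrow> real" where
      "\<forall>v\<in>verts H. (\<Sum>w\<in>verts H. x w * of_int (intersection H w v)) = of_int (k v)"
      "r = (\<Sum>v\<in>verts H. of_int (k v) * x v)" using ex by blast
    then show ?thesis
      by (intro exI[of _ "\<lambda>v. - x v"]) (auto simp: k' sum_negf)
  qed
  from this[of k _ "\<lambda>v. - k v"] this[of "\<lambda>v. - k v" _ k] show ?thesis
    unfolding square_def by (intro arg_cong[of _ _ The] ext iffI) auto
qed

lemma floor_near:
  fixes a b :: real
  assumes "\<bar>a - b\<bar> < 1"
  shows "\<lfloor>a\<rfloor> \<in> {\<lfloor>b\<rfloor> - 2..\<lfloor>b\<rfloor> + 2}"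
proof -
  have "a < b + 1" "b < a + 1" using assms by argo+
  then have "\<lfloor>b\<rfloor> - 2 \<le> \<lfloor>a\<rfloor>" "\<lfloor>a\<rfloor> \<le> \<lfloor>b\<rfloor> + 2" by linarith+
  then show ?thesis by simp
qed

lemma roundings_translate:
  assumes "\<And>v. v \<notin> V \<Longrightarrow> u v = 0"
  shows "roundings V (\<lambda>v. y v + of_int (u v)) = (\<lambda>z v. z v + u v) ` roundings V y"
proof (intro equalityI subsetI)
  fix z assume z: "z \<in> roundings V (\<lambda>v. y v + of_int (u v))"
  have "(\<lambda>v. z v - u v) \<in> roundings V y"
    unfolding roundings_def mem_Collect_eq
  proof
    fix v show "if v \<in> V then z v - u v \<in> near (y v) else z v - u v = 0"
      using z[unfolded roundings_def mem_Collect_eq, THEN spec, of v] assms[of v] by (auto split: if_splits)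
  qed
  then show "z \<in> (\<lambda>z v. z v + u v) ` roundings V y"
    by (intro image_eqI[of _ _ "\<lambda>v. z v - u v"]) auto
next
  fix z assume "z \<in> (\<lambda>z v. z v + u v) ` roundings V y"
  then obtain x where x: "x \<in> roundings V y" "z = (\<lambda>v. x v + u v)" by blast
  show "z \<in> roundings V (\<lambda>v. y v + of_int (u v))"
    unfolding roundings_def mem_Collect_eq
  proof
    fix v show "if v \<in> V then z v \<in> near (y v + of_int (u v)) else z v = 0"
      using x(1)[unfolded roundings_def mem_Collect_eq, THEN spec, of v] assms[of v]
      by (auto simp: x(2) split: if_splits)
  qed
qed

lemma roundings_minus: "roundings V (\<lambda>v. - y v) = (\<lambda>z v. - z v) ` roundings V y"
proof (intro equalityI subsetI)
  fix z assume z: "z \<in> roundings V (\<lambda>v. - y v)"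
  have "(\<lambda>v. - z v) \<in> roundings V y"
    unfolding roundings_def mem_Collect_eq
  proof
    fix v show "if v \<in> V then - z v \<in> near (y v) else - z v = 0"
      using z[unfolded roundings_def mem_Collect_eq, THEN spec, of v]
      by (auto simp: floor_minus ceiling_minus split: if_splits)
  qed
  then show "z \<in> (\<lambda>z v. - z v) ` roundings V y"
    by (intro image_eqI[of _ _ "\<lambda>v. - z v"]) auto
next
  fix z assume "z \<in> (\<lambda>z v. - z v) ` roundings V y"
  then obtain x where x: "x \<in> roundings V y" "z = (\<lambda>v. - x v)" by blast
  show "z \<in> roundings V (\<lambda>v. - y v)"
    unfolding roundings_def mem_Collect_eq
  proof
    fix v show "if v \<in> V then z v \<in> near (- y v) else z v = 0"
      using x(1)[unfolded roundings_def mem_Collect_eq, THEN spec, of v]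
      by (auto simp: x(2) floor_minus ceiling_minus split: if_splits)
  qed
qed

context unimodular_plumbing
begin

text \<open>The source of a chain is its member that extends in the most directions: a face that
  extends in equally many directions is the cube itself.\<close>

lemma source_cube_nerve:
  assumes "\<sigma> \<in> nerve"
  shows "source_cube H \<sigma> \<in> \<sigma> \<and> (\<forall>c'\<in>\<sigma>. is_face H c' (source_cube H \<sigma>))"
proof -
  have \<sigma>: "\<sigma> \<noteq> {}" "finite \<sigma>" "\<sigma> \<subseteq> cubes H T"
    and cmp: "\<And>c c'. c \<in> \<sigma> \<Longrightarrow> c' \<in> \<sigma> \<Longrightarrow> is_face H c c' \<or> is_face H c' c"
    using assms unfolding nerve_iff by simp_all
  have "Max ((\<lambda>c. card (snd c)) ` \<sigma>) \<in> (\<lambda>c. card (snd c)) ` \<sigma>" using \<sigma> by (intro Max_in) auto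
  then obtain c where c: "c \<in> \<sigma>" "Max ((\<lambda>c. card (snd c)) ` \<sigma>) = card (snd c)" by auto
  have max: "card (snd c') \<le> card (snd c)" if "c' \<in> \<sigma>" for c'
    using \<sigma> that unfolding c(2)[symmetric] by (intro Max_ge) auto
  have top: "is_face H c' c" if c': "c' \<in> \<sigma>" for c'
  proof (rule ccontr)
    assume n: "\<not> is_face H c' c"
    then have f: "is_face H c c'" using cmp c(1) c' by blast
    have "snd c \<subseteq> snd c'" using f by (cases c; cases c') auto
    moreover have "c' \<in> cubes H T" using c' \<sigma>(3) by blast
    then have "snd c' \<subseteq> verts H" by (auto simp: cubes_def)
    then have "finite (snd c')" using finite_verts by (rule finite_subset)
    ultimately have "snd c = snd c'" using max[OF c'] card_seteq by blast
    then have "c = c'" using f by (cases c; cases c') (auto simp: translate_def PD_def fun_eq_iff)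
    then show False using n is_face_refl by blast
  qed
  have "source_cube H \<sigma> = c"
    unfolding source_cube_def using c(1) top is_face_antisym \<sigma>(3) by (intro the_equality) blast+
  then show ?thesis using c(1) top by simp
qed

text \<open>The source cube has no other cube of the chain above it, so the weight \<open>U\<close>
  in \<open>position_cell_bounds\<close> is its own positive coordinate. The bounds then put the
  point strictly inside the cube in the directions of \<open>E\<close> and exactly at
  \<open>z\<close> in the others.\<close>

lemma roundings_position:
  assumes x: "x \<in> polyhedron nerve" and c: "source_cube H (support x) = (char_of z, E)" "z \<in> lattice" "E \<subseteq> verts H"
  shows "roundings (verts H) (position x) = (\<lambda>I v. z v + indicator I v) ` Pow E"
proof -
  let ?c = "(char_of z, E)"
  note xx = polyhedronD[OF x is_complex_nerve]
  have s: "?c \<in> support x" "\<And>c'. c' \<in> support x \<Longrightarrow> is_face H c' ?c"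
    using source_cube_nerve[OF xx(2)] unfolding c(1) by auto
  have "support x \<subseteq> cubes H T" using xx(2) by (simp add: nerve_iff)
  then have "{c'\<in>support x. is_face H ?c c'} = {?c}"
    using s is_face_antisym is_face_refl by blast
  then have U: "(\<Sum>c'\<in>{c'\<in>support x. is_face H ?c c'}. x c') = x ?c" by simp
  have pos: "0 < x ?c" using s(1) xx(5)[of ?c] by (simp add: support_def order_less_le)
  note b = position_cell_bounds[OF x s(1) refl c(2,3), unfolded U]
  have fl: "\<lfloor>position x v\<rfloor> = z v" "\<lceil>position x v\<rceil> = z v + 1" if "v \<in> E" for v
  proof -
    have "\<bar>2 * (position x v - of_int (z v)) - 1\<bar> < 1" using b(1)[OF that] pos by linarith
    then have "of_int (z v) < position x v" "position x v < of_int (z v) + 1" by argo+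
    then show "\<lfloor>position x v\<rfloor> = z v" "\<lceil>position x v\<rceil> = z v + 1" by linarith+
  qed
  have eq: "position x v = of_int (z v)" if "v \<in> verts H - E" for v
    using b(2)[OF that] by simp
  show ?thesis
  proof (intro equalityI subsetI)
    fix w assume w: "w \<in> roundings (verts H) (position x)"
    have "w = (\<lambda>v. z v + indicator {v \<in> E. w v = z v + 1} v)"
    proof
      fix v
      consider "v \<in> E" | "v \<in> verts H - E" | "v \<notin> verts H" by blast
      then show "w v = z v + indicator {v \<in> E. w v = z v + 1} v"
        using w[unfolded roundings_def mem_Collect_eq, THEN spec, of v] fl[of v] eq[of v] c(2,3)
        by cases (auto simp: indicator_def lattice_def)
    qed
    then show "w \<in> (\<lambda>I v. z v + indicator I v) ` Pow E" by blast
  next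
    fix w assume "w \<in> (\<lambda>I v. z v + indicator I v) ` Pow E"
    then obtain I where I: "I \<subseteq> E" "w = (\<lambda>v. z v + indicator I v)" by blast
    show "w \<in> roundings (verts H) (position x)"
      unfolding roundings_def mem_Collect_eq
    proof
      fix v
      consider "v \<in> E" | "v \<in> verts H - E" | "v \<notin> verts H" by blast
      then show "if v \<in> verts H then w v \<in> near (position x v) else w v = 0"
        using fl[of v] eq[of v] c(2,3) I
        by cases (auto simp: indicator_def lattice_def)
    qed
  qed
qed

definition ptU :: "('v \<Rightarrow> int) \<Rightarrow> real" where
  "ptU z = height_U H (char_of z)"

definition ptV :: "('v \<Rightarrow> int) \<Rightarrow> real" where
  "ptV z = ptU (\<lambda>v. z v + disk_dual v)"

lemma nerve_heights:
  assumes x: "x \<in> polyhedron nerve"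
  shows "ht1 (cube_nerve H T) (support x) = Min (ptU ` roundings (verts H) (position x))"
    and "ht2 (cube_nerve H T) (support x) = Min (ptV ` roundings (verts H) (position x))"
proof -
  note xx = polyhedronD[OF x is_complex_nerve]
  have "source_cube H (support x) \<in> cubes H T"
    using source_cube_nerve[OF xx(2)] xx(2) by (auto simp: nerve_iff)
  then obtain z E where c: "z \<in> lattice" "E \<subseteq> verts H" "source_cube H (support x) = (char_of z, E)"
    by (rule cubeE)
  note r = roundings_position[OF x c(3,1,2)]
  show "ht1 (cube_nerve H T) (support x) = Min (ptU ` roundings (verts H) (position x))"
    unfolding r by (simp add: cube_nerve_def c(3) image_image translate_char_of ptU_def)
  have "(\<lambda>v. z v + disk_dual v + indicator I v) = (\<lambda>v. z v + indicator I v + disk_dual v)" for I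
    by (auto simp: algebra_simps)
  then show "ht2 (cube_nerve H T) (support x) = Min (ptV ` roundings (verts H) (position x))"
    unfolding r by (simp add: cube_nerve_def c(3) image_image translate_char_of translate_disk_char_of
        cube_height_V_def ptV_def ptU_def)
qed

lemma CFK_simps:
  "space_of (CFK H t) = weak_topology (simplexes (cube_nerve H t))"
  "hU (CFK H t) x = ht1 (cube_nerve H t) (support x)"
  "hV (CFK H t) x = ht2 (cube_nerve H t) (support x)"
  "flip (CFK H t) = pushforward (flip_cube H)"
  "invI (CFK H t) = pushforward (invI_cube H)"
  "invJ (CFK H t) = pushforward (invJ_cube H)"
  by (simp_all add: CFK_def realization_def df_space.defs)

abbreviation plane :: "('v \<Rightarrow> real) set" where
  "plane \<equiv> {y. \<forall>v. v \<notin> verts H \<longrightarrow> y v = 0}"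

lemma continuous_map_position: "continuous_map (weak_topology nerve) (top_of_set plane) position"
  unfolding continuous_map_in_subtopology
proof
  have "continuous_map (weak_topology nerve) euclideanreal (\<lambda>x. position x v)" for v
    unfolding position_def by (rule continuous_map_weighted_sum[OF is_complex_nerve])
  then show "continuous_map (weak_topology nerve) euclidean position"
    by (simp add: continuous_map_componentwise_UNIV flip: euclidean_product_topology)
  show "position \<in> topspace (weak_topology nerve) \<rightarrow> plane"
    using position_outside by auto
qed

lemma continuous_map_spread: "continuous_map (top_of_set plane) (weak_topology nerve) spread"
proof (rule continuous_map_into_weak_topology[OF _ _ is_complex_nerve])
  fix c
  show "continuous_map (top_of_set plane) euclideanreal (\<lambda>y. spread y c)"
  proof (cases "c \<in> cubes H T")
    case True
    then obtain z E where z: "z \<in> lattice" "E \<subseteq> verts H" "c = (char_of z, E)" by (rule cubeE)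
    have fin: "finite E" using z(2) finite_verts finite_subset by blast
    have cv: "continuous_on plane (\<lambda>y. y v)" for v
      by (rule continuous_on_subset[OF continuous_on_product_coordinates]) simp
    have "continuous_on plane (\<lambda>y. spread y c)"
      unfolding z(3) spread_char_of[OF z(1,2)] using fin finite_verts
      by (intro continuous_intros continuous_on_Max_insert continuous_on_Min_insert cv) auto
    then show ?thesis by simp
  next
    case False
    have "spread y c = 0" for y
    proof -
      have "c \<notin> level y ` {0<..1}" using False level_in_cubes by auto
      then have "c \<notin> support (spread y)" using support_spread by blast
      then show ?thesis by (simp add: support_def)
    qed
    then show ?thesis by simp
  qed
next
  fix y assume "y \<in> topspace (top_of_set plane)"
  then have y: "y \<in> plane" by simp
  show "spread y \<in> polyhedron nerve" by (rule spread_in_nerve)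
  define N where "N = plane \<inter> (\<Inter>v\<in>verts H. {y'. \<bar>y' v - y v\<bar> < 1})"
  \<comment> \<open>The window of \<open>floor_near\<close>, enlarged by one at the top because
    \<open>round\<close> may exceed the floor by 1.\<close>
  define Z where "Z = {z. \<forall>v. if v \<in> verts H then z v \<in> {\<lfloor>y v\<rfloor> - 2..\<lfloor>y v\<rfloor> + 3} else z v = 0}"
  have "open {y'. \<bar>y' v - y v\<bar> < 1}" for v
    by (intro open_Collect_less continuous_intros continuous_on_product_coordinates)
  then have "open (\<Inter>v\<in>verts H. {y'. \<bar>y' v - y v\<bar> < 1})"
    using finite_verts by (intro open_INT) auto
  then have N: "openin (top_of_set plane) N" "y \<in> N"
    unfolding N_def using y by (auto intro: openin_open_Int)
  have finZ: "finite Z" unfolding Z_def using finite_verts by (intro finite_functions_on) auto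
  have "support (spread y') \<subseteq> char_of ` Z \<times> Pow (verts H)" if y': "y' \<in> N" for y'
  proof -
    have "level_coord y' E \<in> Z" for E
      unfolding Z_def mem_Collect_eq
    proof
      fix v
      have "v \<in> verts H \<Longrightarrow> \<bar>y' v - y v\<bar> < 1" using y' by (auto simp: N_def)
      then have "v \<in> verts H \<Longrightarrow> \<lfloor>y' v\<rfloor> \<in> {\<lfloor>y v\<rfloor> - 2..\<lfloor>y v\<rfloor> + 2}" by (rule floor_near)
      then show "if v \<in> verts H then level_coord y' E v \<in> {\<lfloor>y v\<rfloor> - 2..\<lfloor>y v\<rfloor> + 3} else level_coord y' E v = 0"
        using round_floor_cases[of "y' v"] by (auto simp: level_coord_def)
    qed
    then show ?thesis
      using support_spread[of y'] level_set_subset by (fastforce simp: level_def)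
  qed
  then show "\<exists>N W. openin (top_of_set plane) N \<and> y \<in> N \<and> finite W \<and> (\<forall>y'\<in>N. support (spread y') \<subseteq> W)"
    using N finZ finite_verts
    by (intro exI[of _ N] exI[of _ "char_of ` Z \<times> Pow (verts H)"]) auto
qed

lemma df_map_position: "df_map (CFK H T) (cube_space (verts H) ptU ptV) position"
  unfolding df_map_def doubly_filtered_def height_le_def
  using continuous_map_position by (simp add: CFK_simps cube_space_def nerve_heights)

lemma df_map_spread: "df_map (cube_space (verts H) ptU ptV) (CFK H T) spread"
  unfolding df_map_def doubly_filtered_def height_le_def
  using continuous_map_spread
  by (simp add: CFK_simps cube_space_def nerve_heights[OF spread_in_nerve] position_spread)

lemma df_homotopy_equivalence_position:
  "df_homotopy_equivalence (CFK H T) (cube_space (verts H) ptU ptV) position"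
  by (rule df_homotopy_equivalence_iso[OF df_map_position df_map_spread])
    (simp_all add: CFK_simps cube_space_def spread_position position_spread)

text \<open>Barycentric coordinates sum to 1, so a cube map that is affine on barycenters induces
  the same affine map on positions, constant term included.\<close>

lemma pushforward_cube_map:
  assumes x: "x \<in> polyhedron nerve"
    and cubes: "\<And>c. c \<in> cubes H T \<Longrightarrow> \<phi> c \<in> cubes H T"
    and face: "\<And>c c'. c \<in> cubes H T \<Longrightarrow> c' \<in> cubes H T \<Longrightarrow> is_face H c' c \<Longrightarrow> is_face H (\<phi> c') (\<phi> c)"
    and bary: "\<And>c v. c \<in> cubes H T \<Longrightarrow> barycenter (\<phi> c) v = a * barycenter c v + w v"
  shows "pushforward \<phi> x \<in> polyhedron nerve" and "position (pushforward \<phi> x) = (\<lambda>v. a * position x v + w v)"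
proof -
  note xx = polyhedronD[OF x is_complex_nerve]
  have sub: "support x \<subseteq> cubes H T" using xx(2) by (simp add: nerve_iff)
  show "pushforward \<phi> x \<in> polyhedron nerve"
  proof (rule polyhedronI)
    show "sum (pushforward \<phi> x) (support (pushforward \<phi> x)) = 1"
      using sum_support_pushforward[OF xx(1,5)] xx(4) by simp
    show "0 \<le> pushforward \<phi> x a" for a
      unfolding pushforward_def using xx(5) by (intro sum_nonneg)
    have "\<phi> ` support x \<subseteq> cubes H T" using cubes sub by blast
    moreover have "is_face H (\<phi> c) (\<phi> c') \<or> is_face H (\<phi> c') (\<phi> c)" if "c \<in> support x" "c' \<in> support x" for c c'
      using face xx(2) sub that unfolding nerve_iff by blast
    ultimately show "support (pushforward \<phi> x) \<in> nerve"
      unfolding support_pushforward[OF xx(1,5)] nerve_iff using xx(1,3) by blast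
  qed
  show "position (pushforward \<phi> x) = (\<lambda>v. a * position x v + w v)"
  proof
    fix v
    have w: "w v = (\<Sum>c\<in>support x. x c * w v)" using xx(4) by (simp flip: sum_distrib_right)
    have "position (pushforward \<phi> x) v = (\<Sum>c\<in>support x. x c * barycenter (\<phi> c) v)"
      unfolding position_def weighted_sum_pushforward[OF xx(1,5)] by (simp add: weighted_sum_def)
    also have "\<dots> = (\<Sum>c\<in>support x. x c * (a * barycenter c v + w v))"
      using sub bary by (intro sum.cong) auto
    also have "\<dots> = a * position x v + w v"
      by (subst (2) w) (simp add: position_def weighted_sum_def distrib_left sum.distrib sum_distrib_left mult.left_commute)
    finally show "position (pushforward \<phi> x) v = a * position x v + w v" .
  qed
qed

lemma flip_cube_char_of: "flip_cube H (char_of z, E) = (char_of (\<lambda>v. z v + disk_dual v), E)"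
  by (simp add: translate_disk_char_of)

text \<open>A reflection exchanges lowest and highest corners, so the displacement \<open>I\<close>
  of the face turns into its complement \<open>E - E' - I\<close> among the collapsed
  directions.\<close>

lemma is_face_reflect:
  assumes "z \<in> lattice" "z' \<in> lattice" "E \<subseteq> verts H" "E' \<subseteq> verts H"
    and "is_face H (char_of z', E') (char_of z, E)"
    and w: "(\<lambda>v. - (z v + indicator E v) - w v) \<in> lattice" "(\<lambda>v. - (z' v + indicator E' v) - w v) \<in> lattice"
  shows "is_face H (char_of (\<lambda>v. - (z' v + indicator E' v) - w v), E') (char_of (\<lambda>v. - (z v + indicator E v) - w v), E)"
proof -
  obtain I where I: "E' \<subseteq> E" "I \<subseteq> E - E'" "z' = (\<lambda>v. z v + indicator I v)"
    using assms(5) is_face_char_of[OF assms(1,2,3)] by blast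
  have ind: "indicator E v = indicator E' v + indicator I v + (indicator (E - E' - I) v :: int)" for v
    using I(1,2) by (auto simp: indicator_def)
  have eq: "(\<lambda>v. - (z' v + indicator E' v) - w v) =
      (\<lambda>v. - (z v + indicator E v) - w v + indicator (E - E' - I) v)"
  proof
    fix v show "- (z' v + indicator E' v) - w v = - (z v + indicator E v) - w v + indicator (E - E' - I) v"
      using ind[of v] unfolding I(3) by linarith
  qed
  show ?thesis
    unfolding is_face_char_of[OF w assms(3)]
  proof (intro conjI I(1) exI[of _ "E - E' - I"])
    show "E - E' - I \<subseteq> E - E'" by blast
  qed (rule eq)
qed

lemma position_flip:
  assumes "x \<in> polyhedron nerve"
  shows "pushforward (flip_cube H) x \<in> polyhedron nerve"
    and "position (pushforward (flip_cube H) x) = (\<lambda>v. position x v + of_int (disk_dual v))"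
proof -
  have 1: "flip_cube H c \<in> cubes H T" if c: "c \<in> cubes H T" for c
  proof -
    obtain z E where z: "z \<in> lattice" "E \<subseteq> verts H" "c = (char_of z, E)" using c by (rule cubeE)
    show ?thesis unfolding z(3) flip_cube_char_of cubes_iff using lattice_simps(2)[OF z(1) disk_dual(1)] z(2) by blast
  qed
  have 2: "is_face H (flip_cube H c') (flip_cube H c)"
    if "c \<in> cubes H T" "c' \<in> cubes H T" "is_face H c' c" for c c'
    using that by (cases c; cases c') (auto simp: translate_disk_def translate_def fun_eq_iff algebra_simps)
  have 3: "barycenter (flip_cube H c) v = 1 * barycenter c v + of_int (disk_dual v)"
    if c: "c \<in> cubes H T" for c v
  proof -
    obtain z E where z: "z \<in> lattice" "E \<subseteq> verts H" "c = (char_of z, E)" using c by (rule cubeE)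
    show ?thesis
      unfolding z(3) flip_cube_char_of barycenter_char_of[OF lattice_simps(2)[OF z(1) disk_dual(1)]] barycenter_char_of[OF z(1)]
      by (simp add: indicator_def)
  qed
  show "pushforward (flip_cube H) x \<in> polyhedron nerve"
    and "position (pushforward (flip_cube H) x) = (\<lambda>v. position x v + of_int (disk_dual v))"
    using pushforward_cube_map[where \<phi> = "flip_cube H" and a = 1, OF assms 1 2 3] by simp_all
qed

text \<open>The lowest corner of the reflected cube is the image of the highest corner
  \<open>z + indicator E\<close>; on barycenters the contribution of \<open>E\<close> becomes 1/2
  again, which leaves an affine map.\<close>

lemma position_reflect:
  assumes x: "x \<in> polyhedron nerve" and w: "w \<in> lattice"
    and \<phi>: "\<And>z E. \<phi> (char_of z, E) = (char_of (\<lambda>v. - (z v + indicator E v) - w v), E)"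
  shows "pushforward \<phi> x \<in> polyhedron nerve"
    and "position (pushforward \<phi> x) = (\<lambda>v. - position x v - of_int (w v))"
proof -
  have l: "(\<lambda>v. - (z v + indicator E v) - w v) \<in> lattice" if "z \<in> lattice" "E \<subseteq> verts H" for z E
    using that w by (auto simp: lattice_def indicator_def)
  have 1: "\<phi> c \<in> cubes H T" if c: "c \<in> cubes H T" for c
  proof -
    obtain z E where z: "z \<in> lattice" "E \<subseteq> verts H" "c = (char_of z, E)" using c by (rule cubeE)
    show ?thesis unfolding z(3) \<phi> cubes_iff using l[OF z(1,2)] z(2) by blast
  qed
  have 2: "is_face H (\<phi> c') (\<phi> c)" if cc: "c \<in> cubes H T" "c' \<in> cubes H T" "is_face H c' c" for c c'
  proof -
    obtain z E where z: "z \<in> lattice" "E \<subseteq> verts H" "c = (char_of z, E)" using cc(1) by (rule cubeE)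
    obtain z' E' where z': "z' \<in> lattice" "E' \<subseteq> verts H" "c' = (char_of z', E')" using cc(2) by (rule cubeE)
    show ?thesis
      unfolding z(3) z'(3) \<phi>
      by (rule is_face_reflect[OF z(1) z'(1) z(2) z'(2) cc(3)[unfolded z(3) z'(3)] l[OF z(1,2)] l[OF z'(1,2)]])
  qed
  have 3: "barycenter (\<phi> c) v = (- 1) * barycenter c v + (- of_int (w v))" if c: "c \<in> cubes H T" for c v
  proof -
    obtain z E where z: "z \<in> lattice" "E \<subseteq> verts H" "c = (char_of z, E)" using c by (rule cubeE)
    show ?thesis
      unfolding z(3) \<phi> barycenter_char_of[OF l[OF z(1,2)]] barycenter_char_of[OF z(1)]
      by (simp add: indicator_def)
  qed
  show "pushforward \<phi> x \<in> polyhedron nerve"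
    and "position (pushforward \<phi> x) = (\<lambda>v. - position x v - of_int (w v))"
    using pushforward_cube_map[where \<phi> = \<phi> and a = "- 1", OF x 1 2 3] by simp_all
qed

lemma invI_cube_char_of: "invI_cube H (char_of z, E) = (char_of (\<lambda>v. - (z v + indicator E v) - con_dual v), E)"
  by (simp add: translate_char_of minus_char_of)

lemma invJ_cube_char_of:
  "invJ_cube H (char_of z, E) = (char_of (\<lambda>v. - (z v + indicator E v) - (disk_dual v + con_dual v)), E)"
proof -
  have "(\<lambda>v. - (z v + indicator E v + disk_dual v) - con_dual v) =
      (\<lambda>v. - (z v + indicator E v) - (disk_dual v + con_dual v))" by (rule ext) simp
  then show ?thesis by (simp only: invJ_cube.simps translate_char_of translate_disk_char_of minus_char_of)
qed

lemmas position_invI = position_reflect[OF _ con_dual(1) invI_cube_char_of]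

lemmas position_invJ = position_reflect[OF _ lattice_simps(2)[OF disk_dual(1) con_dual(1)] invJ_cube_char_of]

lemma position_inject: "x \<in> polyhedron nerve \<Longrightarrow> x' \<in> polyhedron nerve \<Longrightarrow> position x = position x' \<Longrightarrow> x = x'"
  by (metis spread_position)

lemma continuous_map_from_position:
  assumes "\<And>x. x \<in> polyhedron nerve \<Longrightarrow> g x \<in> polyhedron nerve"
    and "\<And>x v. x \<in> polyhedron nerve \<Longrightarrow> position (g x) v = a * position x v + w v"
  shows "continuous_map (weak_topology nerve) (weak_topology nerve) g"
proof -
  let ?A = "\<lambda>y v. if v \<in> verts H then a * y v + w v else 0 :: real"
  have "continuous_on plane (\<lambda>y. ?A y v)" for v
  proof (cases "v \<in> verts H")
    case True
    have "continuous_on plane (\<lambda>y. y v)"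
      by (rule continuous_on_subset[OF continuous_on_product_coordinates]) simp
    then show ?thesis using True by (auto intro!: continuous_intros)
  qed simp
  then have "continuous_on plane ?A" by (rule continuous_on_coordinatewise_then_product)
  then have "continuous_map (top_of_set plane) (top_of_set plane) ?A"
    by (simp add: continuous_map_in_subtopology)
  then have *: "continuous_map (weak_topology nerve) (weak_topology nerve) (spread \<circ> ?A \<circ> position)"
    by (intro continuous_map_compose[OF _ continuous_map_spread] continuous_map_compose[OF continuous_map_position])
  show ?thesis
  proof (rule continuous_map_eq[OF *])
    fix x assume "x \<in> topspace (weak_topology nerve)"
    then have x: "x \<in> polyhedron nerve" by simp
    have "position (g x) = ?A (position x)"
      using assms(2)[OF x] position_outside[OF _ assms(1)[OF x]] by auto
    then show "(spread \<circ> ?A \<circ> position) x = g x"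
      using spread_position[OF assms(1)[OF x]] by simp
  qed
qed

lemma ptU_reflect: "ptU (\<lambda>v. - z v - con_dual v) = ptU z"
  unfolding ptU_def height_U_def minus_char_of[symmetric] square_minus ..

text \<open>All identities between the three maps are checked on positions, where the maps are
  translations and point reflections and \<open>position\<close> is injective. The heights under
  \<open>invJ\<close> follow from those under the flip map and \<open>invI\<close>.\<close>

lemma is_knot_space_CFK: "is_knot_space (CFK H T)"
proof -
  let ?F = "pushforward (flip_cube H)" and ?I = "pushforward (invI_cube H)" and ?J = "pushforward (invJ_cube H)"
  have u0: "v \<notin> verts H \<Longrightarrow> disk_dual v = 0" "v \<notin> verts H \<Longrightarrow> con_dual v = 0" for v
    using disk_dual(1) con_dual(1) by (auto simp: lattice_def)
  have hF: "hU (CFK H T) (?F x) = hV (CFK H T) x" if x: "x \<in> polyhedron nerve" for x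
    unfolding CFK_simps nerve_heights[OF x] nerve_heights[OF position_flip(1)[OF x]] position_flip(2)[OF x]
    using u0 by (subst roundings_translate) (auto simp: image_image ptV_def)
  have hI: "hU (CFK H T) (?I x) = hU (CFK H T) x" if x: "x \<in> polyhedron nerve" for x
  proof -
    have "roundings (verts H) (\<lambda>v. - position x v - of_int (con_dual v)) =
        (\<lambda>z v. z v + - con_dual v) ` roundings (verts H) (\<lambda>v. - position x v)"
      using u0 roundings_translate[of "verts H" "\<lambda>v. - con_dual v" "\<lambda>v. - position x v"] by simp
    then have "roundings (verts H) (\<lambda>v. - position x v - of_int (con_dual v)) =
        (\<lambda>z v. - z v - con_dual v) ` roundings (verts H) (position x)"
      unfolding roundings_minus image_image by simp
    then show ?thesis
      unfolding CFK_simps nerve_heights[OF x] nerve_heights[OF position_invI(1)[OF x]] position_invI(2)[OF x]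
      by (simp add: image_image ptU_reflect)
  qed
  have JF: "?J x = ?I (?F x)" if x: "x \<in> polyhedron nerve" for x
    using position_flip[OF x] position_invJ[OF x] position_invI[OF position_flip(1)[OF x]]
    by (intro position_inject) auto
  have FJ: "?F (?J x) = ?I x" if x: "x \<in> polyhedron nerve" for x
    using position_invI[OF x] position_invJ[OF x] position_flip[OF position_invJ(1)[OF x]]
    by (intro position_inject) auto
  have II: "?I (?I x) = x" if x: "x \<in> polyhedron nerve" for x
    using position_invI[OF x] position_invI[OF position_invI(1)[OF x]] x
    by (intro position_inject) auto
  have JJ: "?J (?J x) = x" if x: "x \<in> polyhedron nerve" for x
    using position_invJ[OF x] position_invJ[OF position_invJ(1)[OF x]] x
    by (intro position_inject) auto
  have hJ: "hU (CFK H T) (?J x) = hV (CFK H T) x" if x: "x \<in> polyhedron nerve" for x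
    using JF[OF x] hI[OF position_flip(1)[OF x]] hF[OF x] by simp
  have hJ': "hV (CFK H T) (?J x) = hU (CFK H T) x" if x: "x \<in> polyhedron nerve" for x
    using FJ[OF x] hF[OF position_invJ(1)[OF x]] hI[OF x] by simp
  have "continuous_map (weak_topology nerve) (weak_topology nerve) ?F"
    by (rule continuous_map_from_position[where a = 1 and w = "\<lambda>v. of_int (disk_dual v)"])
      (simp_all add: position_flip)
  moreover have "continuous_map (weak_topology nerve) (weak_topology nerve) ?I"
    by (rule continuous_map_from_position[where a = "- 1" and w = "\<lambda>v. - of_int (con_dual v)"])
      (simp_all add: position_invI)
  moreover have "continuous_map (weak_topology nerve) (weak_topology nerve) ?J"
    by (rule continuous_map_from_position[where a = "- 1" and w = "\<lambda>v. - of_int (disk_dual v) - of_int (con_dual v)"])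
      (simp_all add: position_invJ)
  ultimately show ?thesis
    unfolding is_knot_space_def CFK_simps(1,4-6) topspace_weak_topology
    using hF hI hJ hJ' II JJ JF by simp
qed

end

section \<open>Legs\<close>

text \<open>For a leg with weights \<open>- b\<close> attached to a vertex with coefficient \<open>a\<close>, \<open>leg_energy b a u\<close> is the
  contribution of the leg coefficients \<open>u\<close> to \<open>- (K + x) x\<close>. Eliminating the coefficients from the far end,
  the minimum over \<open>u\<close> is attained if every coefficient is the previous one times \<open>leg_ratio\<close> of
  the remaining leg, rounded up.\<close>

fun leg_ratio :: "int list \<Rightarrow> real" where
  "leg_ratio [] = 0"
| "leg_ratio (c # cs) = 1 / (of_int c - leg_ratio cs)"

fun leg_energy :: "int list \<Rightarrow> int \<Rightarrow> (nat \<Rightarrow> int) \<Rightarrow> int" where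
  "leg_energy [] a u = 0"
| "leg_energy (c # cs) a u = c * u 0 * (u 0 - 1) + 2 * u 0 - 2 * a * u 0 + leg_energy cs (u 0) (\<lambda>j. u (Suc j))"

fun leg_min :: "int list \<Rightarrow> int \<Rightarrow> int"
  and leg_val :: "int list \<Rightarrow> int \<Rightarrow> int \<Rightarrow> int" where
  "leg_min [] a = 0"
| "leg_min (c # cs) a = leg_val (c # cs) a \<lceil>of_int a * leg_ratio (c # cs)\<rceil>"
| "leg_val [] a x = 0"
| "leg_val (c # cs) a x = c * x * (x - 1) + 2 * x - 2 * a * x + leg_min cs x"

lemma leg_ratio_bounds:
  "\<forall>c\<in>set b. 2 \<le> c \<Longrightarrow> 0 \<le> leg_ratio b \<and> leg_ratio b < 1"
proof (induction b)
  case (Cons c cs)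
  then have "of_int c - leg_ratio cs > 1" by (auto simp: less_diff_eq)
  then show ?case by simp
qed simp

lemma leg_ratio_cont_frac: "b \<noteq> [] \<Longrightarrow> leg_ratio b = 1 / neg_cont_frac b"
  by (induction b rule: neg_cont_frac.induct) auto

text \<open>The values \<open>x\<close> that minimize \<open>leg_val (c # cs) a x\<close>, where \<open>r\<close> is the ratio of the leg.\<close>

definition optimal :: "real \<Rightarrow> int \<Rightarrow> int \<Rightarrow> bool" where
  "optimal r a x \<longleftrightarrow> of_int (a - 1) * r \<le> of_int x \<and> of_int x < of_int a * r + 1"

text \<open>The ranges of optimal values for \<open>a\<close> and \<open>a + 1\<close> overlap in
  the rounded-up product. This overlap drives both \<open>leg_min_step\<close> and
  \<open>follow_optimal\<close>.\<close>

lemma optimal_ceiling: "0 \<le> r \<Longrightarrow> optimal r a \<lceil>of_int a * r\<rceil>" "0 \<le> r \<Longrightarrow> optimal r (a + 1) \<lceil>of_int a * r\<rceil>"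
  unfolding optimal_def by (auto simp: algebra_simps) linarith+

text \<open>The increment of \<open>leg_val\<close> at \<open>x\<close> is twice
  \<open>c * x + 1 - a - \<lceil>x * leg_ratio cs\<rceil>\<close>, and here
  \<open>c * x - \<lceil>x * leg_ratio cs\<rceil>\<close> is the floor of \<open>x / r\<close>. It
  is monotone in \<open>x\<close>, so the function is convex and the sign of its increment is found
  by comparing \<open>x\<close> with multiples of \<open>r\<close>.\<close>

lemma leg_val_step:
  assumes step: "\<And>a. leg_min cs (a + 1) = leg_min cs a - 2 * \<lceil>of_int a * leg_ratio cs\<rceil>"
    and c: "\<forall>c\<in>set (c # cs). 2 \<le> c"
  defines "r \<equiv> leg_ratio (c # cs)"
  shows "of_int x < of_int a * r \<Longrightarrow> leg_val (c # cs) a (x + 1) \<le> leg_val (c # cs) a x"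
    and "of_int (a - 1) * r \<le> of_int x \<Longrightarrow> leg_val (c # cs) a x \<le> leg_val (c # cs) a (x + 1)"
proof -
  let ?d = "of_int c - leg_ratio cs"
  have d: "?d > 1" using leg_ratio_bounds[of cs] c by (auto simp: less_diff_eq)
  have r: "r = 1 / ?d" by (simp add: r_def)
  have diff: "leg_val (c # cs) a (x + 1) - leg_val (c # cs) a x = 2 * (c * x + 1 - a - \<lceil>of_int x * leg_ratio cs\<rceil>)"
    using step[of x] by (simp add: algebra_simps)
  have fl: "c * x - \<lceil>of_int x * leg_ratio cs\<rceil> = \<lfloor>of_int x * ?d\<rfloor>"
  proof -
    have "of_int x * ?d = of_int (c * x) + (- (of_int x * leg_ratio cs))" by (simp add: algebra_simps)
    then show ?thesis by (simp only: int_add_floor[symmetric] ceiling_def minus_minus diff_minus_eq_add)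
  qed
  {
    assume "of_int x < of_int a * r"
    then have "of_int x * ?d < of_int a" using d by (simp add: r field_simps)
    then have "\<lfloor>of_int x * ?d\<rfloor> < a" by (simp add: floor_less_iff)
    then have "c * x + 1 - a - \<lceil>of_int x * leg_ratio cs\<rceil> \<le> 0" unfolding fl[symmetric] by simp
    then show "leg_val (c # cs) a (x + 1) \<le> leg_val (c # cs) a x" using diff by simp
  }
  {
    assume "of_int (a - 1) * r \<le> of_int x"
    then have "of_int (a - 1) \<le> of_int x * ?d" using d by (simp add: r field_simps)
    then have "a - 1 \<le> \<lfloor>of_int x * ?d\<rfloor>" by (simp only: le_floor_iff)
    then have "0 \<le> c * x + 1 - a - \<lceil>of_int x * leg_ratio cs\<rceil>" unfolding fl[symmetric] by simp
    then show "leg_val (c # cs) a x \<le> leg_val (c # cs) a (x + 1)" using diff by simp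
  }
qed

lemma leg_val_mono:
  assumes step: "\<And>a. leg_min cs (a + 1) = leg_min cs a - 2 * \<lceil>of_int a * leg_ratio cs\<rceil>"
    and c: "\<forall>c\<in>set (c # cs). 2 \<le> c"
  defines "r \<equiv> leg_ratio (c # cs)"
  shows "x \<le> y \<Longrightarrow> of_int y < of_int a * r + 1 \<Longrightarrow> leg_val (c # cs) a y \<le> leg_val (c # cs) a x"
    and "y \<le> x \<Longrightarrow> of_int (a - 1) * r \<le> of_int y \<Longrightarrow> leg_val (c # cs) a y \<le> leg_val (c # cs) a x"
proof -
  show "leg_val (c # cs) a y \<le> leg_val (c # cs) a x" if "x \<le> y" "of_int y < of_int a * r + 1"
    using that
  proof (induction y rule: int_ge_induct)
    case (step y)
    then have "of_int y < of_int a * r" by simp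
    then have "leg_val (c # cs) a (y + 1) \<le> leg_val (c # cs) a y"
      unfolding r_def by (rule leg_val_step(1)[OF assms(1) c])
    then show ?case using step by simp
  qed simp
  show "leg_val (c # cs) a y \<le> leg_val (c # cs) a x" if "y \<le> x" "of_int (a - 1) * r \<le> of_int y"
    using that(1)
  proof (induction x rule: int_ge_induct)
    case (step x)
    then have "of_int (a - 1) * r \<le> of_int x" using that(2) by linarith
    then have "leg_val (c # cs) a x \<le> leg_val (c # cs) a (x + 1)"
      unfolding r_def by (rule leg_val_step(2)[OF assms(1) c])
    then show ?case using step by simp
  qed simp
qed

lemma leg_val_optimal:
  assumes step: "\<And>a. leg_min cs (a + 1) = leg_min cs a - 2 * \<lceil>of_int a * leg_ratio cs\<rceil>"
    and c: "\<forall>c\<in>set (c # cs). 2 \<le> c" and x: "optimal (leg_ratio (c # cs)) a x"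
  shows "leg_val (c # cs) a x \<le> leg_val (c # cs) a y"
proof (cases "x \<le> y")
  case True
  then show ?thesis using leg_val_mono(2)[OF step c] x by (simp add: optimal_def)
next
  case False
  then show ?thesis using leg_val_mono(1)[OF step c] x by (simp add: optimal_def)
qed

text \<open>The same first coefficient is optimal for \<open>a\<close> and for \<open>a + 1\<close>,
  and for a fixed first coefficient \<open>x\<close> the energy contains \<open>a\<close> only in
  the term \<open>- 2 * a * x\<close>.\<close>

lemma leg_min_step:
  "\<forall>c\<in>set b. 2 \<le> c \<Longrightarrow> leg_min b (a + 1) = leg_min b a - 2 * \<lceil>of_int a * leg_ratio b\<rceil>"
proof (induction b arbitrary: a)
  case (Cons c cs)
  let ?r = "leg_ratio (c # cs)"
  have r: "0 \<le> ?r" using leg_ratio_bounds[OF Cons.prems] by simp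
  have step: "\<And>a. leg_min cs (a + 1) = leg_min cs a - 2 * \<lceil>of_int a * leg_ratio cs\<rceil>"
    using Cons by simp
  have "leg_min (c # cs) (a + 1) = leg_val (c # cs) (a + 1) \<lceil>of_int (a + 1) * ?r\<rceil>" by simp
  also have "\<dots> = leg_val (c # cs) (a + 1) \<lceil>of_int a * ?r\<rceil>"
    by (rule antisym; rule leg_val_optimal[OF step Cons.prems]; rule optimal_ceiling[OF r])
  also have "\<dots> = leg_val (c # cs) a \<lceil>of_int a * ?r\<rceil> - 2 * \<lceil>of_int a * ?r\<rceil>"
    by (simp add: algebra_simps)
  finally show ?case by simp
qed simp

lemma leg_min_0: "leg_min b 0 = 0"
  by (induction b) auto

lemma leg_min_le: "\<forall>c\<in>set b. 2 \<le> c \<Longrightarrow> leg_min b a \<le> leg_energy b a u"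
proof (induction b arbitrary: a u)
  case (Cons c cs)
  have "leg_min (c # cs) a \<le> leg_val (c # cs) a (u 0)"
    using leg_val_optimal[OF leg_min_step Cons.prems optimal_ceiling(1)] leg_ratio_bounds[OF Cons.prems] Cons.prems
    by simp
  also have "\<dots> \<le> leg_energy (c # cs) a u"
    using Cons.IH[of "u 0" "\<lambda>j. u (Suc j)"] Cons.prems by simp
  finally show ?case .
qed simp

section \<open>Piecewise linear paths\<close>

definition interpolate :: "(int \<Rightarrow> int) \<Rightarrow> real \<Rightarrow> real" where
  "interpolate h x = of_int (h \<lfloor>x\<rfloor>) + of_int (h (\<lfloor>x\<rfloor> + 1) - h \<lfloor>x\<rfloor>) * frac x"

lemma interpolate_segment:
  assumes "of_int n \<le> x" "x \<le> of_int n + 1"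
  shows "interpolate h x = of_int (h n) + of_int (h (n + 1) - h n) * (x - of_int n)"
proof (cases "x = of_int n + 1")
  case True
  then have "x = of_int (n + 1)" by simp
  then show ?thesis by (simp only: interpolate_def floor_of_int frac_of_int) simp
next
  case False
  then have "\<lfloor>x\<rfloor> = n" using assms by linarith
  then show ?thesis by (simp add: interpolate_def frac_def)
qed

lemma continuous_on_interpolate: "continuous_on UNIV (interpolate h)"
proof (subst continuous_on_eq_continuous_at[OF open_UNIV], intro ballI)
  fix x :: real
  define n where "n = \<lfloor>x\<rfloor>"
  have seg: "continuous_on {of_int k..of_int k + 1} (interpolate h)" for k
    by (subst continuous_on_cong[OF refl interpolate_segment]) (auto intro!: continuous_intros)
  have "{of_int (n - 1)..of_int (n - 1) + 1} \<union> {of_int n..of_int n + 1} = {of_int n - 1..of_int n + 1 :: real}"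
    by auto
  then have "continuous_on {of_int n - 1..of_int n + 1} (interpolate h)"
    using continuous_on_closed_Un[OF _ _ seg[of "n - 1"] seg[of n]] by simp
  moreover have "x \<in> interior {of_int n - 1..of_int n + 1}"
    unfolding interior_atLeastAtMost_real n_def by simp linarith
  ultimately show "isCont (interpolate h) x" by (rule continuous_on_interior)
qed

lemma interpolate_rounding:
  assumes "mono h" "l \<in> near (interpolate h x)"
  shows "h \<lfloor>x\<rfloor> \<le> l" "l \<le> h (\<lfloor>x\<rfloor> + 1)"
proof -
  let ?d = "of_int (h (\<lfloor>x\<rfloor> + 1) - h \<lfloor>x\<rfloor>) :: real"
  have "0 \<le> ?d" using monoD[OF assms(1), of "\<lfloor>x\<rfloor>" "\<lfloor>x\<rfloor> + 1"] by simp
  then have "0 \<le> ?d * frac x" "?d * frac x \<le> ?d * 1"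
    using frac_ge_0[of x] frac_lt_1[of x] mult_left_mono[of "frac x" 1 ?d] by simp_all
  then have "of_int (h \<lfloor>x\<rfloor>) \<le> interpolate h x" "interpolate h x \<le> of_int (h (\<lfloor>x\<rfloor> + 1))"
    unfolding interpolate_def by auto
  then have "h \<lfloor>x\<rfloor> \<le> \<lfloor>interpolate h x\<rfloor>" "\<lceil>interpolate h x\<rceil> \<le> h (\<lfloor>x\<rfloor> + 1)"
    by (simp_all add: le_floor_iff ceiling_le_iff)
  then show "h \<lfloor>x\<rfloor> \<le> l" "l \<le> h (\<lfloor>x\<rfloor> + 1)" using assms(2) by (auto intro: order_trans floor_le_ceiling)
qed

text \<open>As \<open>w\<close> runs from \<open>n\<close> to \<open>n + 1\<close>, first \<open>delay w\<close> moves from \<open>n\<close> to \<open>n + 1\<close>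
  and then \<open>follow r w\<close> moves from \<open>n r\<close> to \<open>(n + 1) r\<close>, rounded up. Moving both
  coordinates at once would pass through cubes of smaller height.\<close>

definition delay :: "real \<Rightarrow> real" where
  "delay w = interpolate (\<lambda>n. (n + 1) div 2) (2 * w)"

definition follow :: "real \<Rightarrow> real \<Rightarrow> real" where
  "follow r w = interpolate (\<lambda>n. \<lceil>of_int (n div 2) * r\<rceil>) (2 * w)"

lemma continuous_on_delay: "continuous_on UNIV delay"
  unfolding delay_def
  by (intro continuous_on_compose2[OF continuous_on_interpolate] continuous_intros) auto

lemma continuous_on_follow: "continuous_on UNIV (follow r)"
  unfolding follow_def
  by (intro continuous_on_compose2[OF continuous_on_interpolate] continuous_intros) auto

lemma mono_half: "mono (\<lambda>n::int. (n + 1) div 2)"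
  by (auto intro!: monoI zdiv_mono1)

lemma mono_ceiling_half: "0 \<le> r \<Longrightarrow> mono (\<lambda>n::int. \<lceil>of_int (n div 2) * r\<rceil>)"
  by (auto intro!: monoI ceiling_mono mult_right_mono simp: zdiv_mono1)

text \<open>\<open>delay\<close> maps every closed unit interval between integers into itself, so
  applying it never leads to a new cube.\<close>

lemma delay_rounding:
  assumes "l \<in> near (delay w)"
  shows "l \<in> near w"
proof (cases "w = of_int \<lfloor>w\<rfloor>")
  case True
  have "2 * w = of_int (2 * \<lfloor>w\<rfloor>)" using True by simp
  then have "delay w = of_int \<lfloor>w\<rfloor>"
    unfolding delay_def interpolate_def by (simp only: floor_of_int frac_of_int) simp
  then show ?thesis using assms by simp
next
  case False
  then have c: "\<lceil>w\<rceil> = \<lfloor>w\<rfloor> + 1" by linarith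
  have "2 * \<lfloor>w\<rfloor> \<le> \<lfloor>2 * w\<rfloor>" "\<lfloor>2 * w\<rfloor> \<le> 2 * \<lfloor>w\<rfloor> + 1" by linarith+
  then show ?thesis using interpolate_rounding[OF mono_half assms[unfolded delay_def]] c by auto
qed

text \<open>The parity of the floor of \<open>2 * w\<close> tells which coordinate is moving. While
  \<open>delay\<close> moves from \<open>n\<close> to \<open>n + 1\<close>, \<open>x\<close> rests
  at a value optimal for both; while \<open>follow\<close> moves, \<open>l\<close> rests at
  \<open>n + 1\<close>, for which all values passed are optimal.\<close>

lemma follow_optimal:
  assumes r: "0 \<le> r" and l: "l \<in> near (delay w)" and x: "x \<in> near (follow r w)"
  shows "optimal r l x"
proof -
  note l = interpolate_rounding[OF mono_half l[unfolded delay_def]]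
  note x = interpolate_rounding[OF mono_ceiling_half[OF r] x[unfolded follow_def]]
  define n where "n = \<lfloor>2 * w\<rfloor> div 2"
  have "\<lfloor>2 * w\<rfloor> = 2 * n \<or> \<lfloor>2 * w\<rfloor> = 2 * n + 1" unfolding n_def by linarith
  then show ?thesis
  proof
    assume N: "\<lfloor>2 * w\<rfloor> = 2 * n"
    have "l = n \<or> l = n + 1" using l unfolding N by auto
    moreover have "x = \<lceil>of_int n * r\<rceil>" using x unfolding N by auto
    ultimately show ?thesis using optimal_ceiling[OF r, of n] by auto
  next
    assume N: "\<lfloor>2 * w\<rfloor> = 2 * n + 1"
    have "l = n + 1" using l unfolding N by auto
    moreover have "\<lceil>of_int n * r\<rceil> \<le> x" "x \<le> \<lceil>of_int (n + 1) * r\<rceil>"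
      using x unfolding N by (auto simp: add.commute)
    ultimately show ?thesis unfolding optimal_def by (auto simp: ceiling_le_iff) linarith
  qed
qed

text \<open>The argument \<open>p\<close> is the parameter of the preceding vertex before
  \<open>delay\<close> is applied. The actual coefficient there is \<open>delay p\<close>, which
  rests exactly while \<open>follow\<close> moves; hence \<open>delay\<close> is applied only to the
  final values and not inside the recursion.\<close>

fun leg_path :: "int list \<Rightarrow> (nat \<Rightarrow> real) \<Rightarrow> (nat \<Rightarrow> real) \<Rightarrow> real \<Rightarrow> nat \<Rightarrow> real" where
  "leg_path b \<theta> y p 0 = (1 - \<theta> 0) * y 0 + \<theta> 0 * follow (leg_ratio b) p"
| "leg_path b \<theta> y p (Suc j) =
     leg_path (tl b) (\<lambda>j. \<theta> (Suc j)) (\<lambda>j. y (Suc j)) ((1 - \<theta> 0) * y 0 + \<theta> 0 * follow (leg_ratio b) p) j"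

lemma continuous_on_leg_path:
  assumes "\<And>j. continuous_on S (\<lambda>s. \<theta> s j)" "\<And>j. continuous_on S (\<lambda>s. y s j)" "continuous_on S p"
  shows "continuous_on S (\<lambda>s. leg_path b (\<theta> s) (y s) (p s) j)"
  using assms
proof (induction j arbitrary: b \<theta> y p)
  case 0
  then show ?case
    by (auto intro!: continuous_intros continuous_on_compose2[OF continuous_on_follow])
next
  case (Suc j)
  have "continuous_on S (\<lambda>s. (1 - \<theta> s 0) * y s 0 + \<theta> s 0 * follow (leg_ratio b) (p s))"
    using Suc.prems by (auto intro!: continuous_intros continuous_on_compose2[OF continuous_on_follow])
  then show ?case using Suc.prems by (auto intro!: Suc.IH)
qed

lemma leg_path_0: "(\<And>k. k \<le> j \<Longrightarrow> \<theta> k = 0) \<Longrightarrow> leg_path b \<theta> y p j = y j"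
  by (induction j arbitrary: b \<theta> y p) auto

lemma leg_path_1: "(\<And>k. \<theta> k = 1) \<Longrightarrow> leg_path b \<theta> y p j = leg_path b \<theta> y' p j"
  by (induction j arbitrary: b \<theta> y y' p) auto

text \<open>At the end of the motion every coefficient is optimal for the one before it, at all
  corners of the cubes met. By induction along the leg each corner realizes the minimum.\<close>

lemma leg_path_energy_1:
  assumes "\<forall>c\<in>set b. 2 \<le> c" "\<And>k. \<theta> k = 1" "a \<in> near (delay p)"
    and "\<And>j. j < length b \<Longrightarrow> z j \<in> near (delay (leg_path b \<theta> y p j))"
  shows "leg_energy b a z = leg_min b a"
  using assms
proof (induction b arbitrary: \<theta> y p a z)
  case (Cons c cs)
  let ?r = "leg_ratio (c # cs)"
  have r: "0 \<le> ?r" using leg_ratio_bounds[OF Cons.prems(1)] by simp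
  have p0: "leg_path (c # cs) \<theta> y p 0 = follow ?r p" using Cons.prems(2) by simp
  have z0: "z 0 \<in> near (delay (follow ?r p))" using Cons.prems(4)[of 0] p0 by simp
  then have "optimal ?r a (z 0)" using follow_optimal[OF r Cons.prems(3)] delay_rounding by blast
  then have "leg_val (c # cs) a (z 0) = leg_val (c # cs) a \<lceil>of_int a * ?r\<rceil>"
    using leg_val_optimal[OF leg_min_step Cons.prems(1)] optimal_ceiling(1)[OF r] Cons.prems(1)
    by (intro antisym) auto
  moreover have "leg_energy cs (z 0) (\<lambda>j. z (Suc j)) = leg_min cs (z 0)"
  proof (rule Cons.IH)
    show "z (Suc j) \<in> near (delay (leg_path cs (\<lambda>j. \<theta> (Suc j)) (\<lambda>j. y (Suc j)) (follow ?r p) j))" if "j < length cs" for j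
      using Cons.prems(4)[of "Suc j"] that Cons.prems(2) by simp
  qed (use Cons.prems z0 in auto)
  ultimately show ?case by simp
qed simp

text \<open>The conditions on \<open>\<theta>\<close> say that only one coefficient of the leg is in motion: those before it have not
  moved yet, and those beyond it are already optimal.\<close>

lemma leg_path_descent:
  assumes "\<forall>c\<in>set b. 2 \<le> c" "\<And>k. 0 \<le> \<theta> k \<and> \<theta> k \<le> 1" "\<And>k. 0 < \<theta> k \<Longrightarrow> \<theta> (Suc k) = 1"
    and "a \<in> near (delay p)"
    and "\<And>j. j < length b \<Longrightarrow> z j \<in> near (delay (leg_path b \<theta> y p j))"
  shows "\<exists>z'. (\<forall>j. z' j \<in> near (y j)) \<and> leg_energy b a z \<le> leg_energy b a z'"
  using assms
proof (induction b arbitrary: \<theta> y p a z)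
  case Nil
  show ?case by (intro exI[of _ "\<lambda>j. \<lfloor>y j\<rfloor>"]) simp
next
  case (Cons c cs)
  let ?r = "leg_ratio (c # cs)"
  have r: "0 \<le> ?r" using leg_ratio_bounds[OF Cons.prems(1)] by simp
  have cs: "\<forall>c\<in>set cs. 2 \<le> c" using Cons.prems(1) by simp
  define w where "w = (1 - \<theta> 0) * y 0 + \<theta> 0 * follow ?r p"
  have z0: "z 0 \<in> near (delay w)" using Cons.prems(5)[of 0] by (simp add: w_def)
  then have z0': "z 0 \<in> near w" by (rule delay_rounding)
  have zs: "z (Suc j) \<in> near (delay (leg_path cs (\<lambda>j. \<theta> (Suc j)) (\<lambda>j. y (Suc j)) w j))" if "j < length cs" for j
    using Cons.prems(5)[of "Suc j"] that by (simp add: w_def)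
  show ?case
  proof (cases "\<theta> 0 = 0")
    case True
    \<comment> \<open>The first coefficient has not moved, so \<open>z 0\<close> is itself a
      rounding of \<open>y 0\<close>, and only the tail has to be compared.\<close>
    have "\<exists>z'. (\<forall>j. z' j \<in> near (y (Suc j))) \<and> leg_energy cs (z 0) (\<lambda>j. z (Suc j)) \<le> leg_energy cs (z 0) z'"
      by (rule Cons.IH[OF cs Cons.prems(2,3) z0 zs])
    then obtain z' where z': "\<And>j. z' j \<in> near (y (Suc j))"
      "leg_energy cs (z 0) (\<lambda>j. z (Suc j)) \<le> leg_energy cs (z 0) z'" by blast
    show ?thesis
    proof (intro exI[of _ "case_nat (z 0) z'"] conjI allI)
      show "case_nat (z 0) z' j \<in> near (y j)" for j
        using z'(1) z0' True by (cases j) (auto simp: w_def)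
    qed (use z'(2) in simp)
  next
    case False
    then have \<theta>0: "0 < \<theta> 0" using Cons.prems(2)[of 0] by simp
    have \<theta>1: "\<theta> (Suc k) = 1" for k
      by (induction k) (use Cons.prems(3) \<theta>0 in auto)
    have tail: "leg_energy cs (z 0) (\<lambda>j. z (Suc j)) = leg_min cs (z 0)"
      by (rule leg_path_energy_1[OF cs \<theta>1 z0 zs])
    define f where "f = follow ?r p"
    have opt: "optimal ?r a \<lfloor>f\<rfloor>" "optimal ?r a \<lceil>f\<rceil>"
      unfolding f_def by (rule follow_optimal[OF r Cons.prems(4)]; simp)+
    have t: "0 \<le> \<theta> 0" "\<theta> 0 \<le> 1" using Cons.prems(2) by auto
    \<comment> \<open>As the tail is at its minimum, \<open>leg_val\<close> at \<open>z 0\<close> is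
      the whole energy. The point \<open>w\<close> lies between \<open>y 0\<close> and
      \<open>f\<close>, and \<open>leg_val\<close> does not increase on the way from
      \<open>y 0\<close> to the optimal values around \<open>f\<close>.\<close>
    have "\<exists>x\<in>near (y 0). leg_val (c # cs) a (z 0) \<le> leg_val (c # cs) a x"
    proof (cases "y 0 \<le> f")
      case True
      have e: "w - y 0 = \<theta> 0 * (f - y 0)" "f - w = (1 - \<theta> 0) * (f - y 0)"
        unfolding w_def f_def by (simp_all add: left_diff_distrib right_diff_distrib)
      have "0 \<le> w - y 0" "0 \<le> f - w" unfolding e using True t by simp_all
      then have "\<lfloor>y 0\<rfloor> \<le> \<lfloor>w\<rfloor>" "\<lceil>y 0\<rceil> \<le> \<lceil>w\<rceil>" "\<lceil>w\<rceil> \<le> \<lceil>f\<rceil>" "\<lfloor>w\<rfloor> \<le> \<lceil>f\<rceil>"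
        by (auto intro: floor_mono ceiling_mono order_trans[OF floor_le_ceiling])
      then have "\<exists>x\<in>near (y 0). x \<le> z 0" "z 0 \<le> \<lceil>f\<rceil>"
        using z0' by auto
      then obtain x where x: "x \<in> near (y 0)" "x \<le> z 0" and z: "z 0 \<le> \<lceil>f\<rceil>" by blast
      have "of_int (z 0) < of_int a * ?r + 1" using z opt(2) unfolding optimal_def by linarith
      then show ?thesis
        using leg_val_mono(1)[OF leg_min_step Cons.prems(1) x(2)] cs x(1) by blast
    next
      case False
      have e: "y 0 - w = \<theta> 0 * (y 0 - f)" "w - f = (1 - \<theta> 0) * (y 0 - f)"
        unfolding w_def f_def by (simp_all add: left_diff_distrib right_diff_distrib)
      have "0 \<le> y 0 - w" "0 \<le> w - f" unfolding e using False t by simp_all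
      then have "\<lfloor>w\<rfloor> \<le> \<lfloor>y 0\<rfloor>" "\<lceil>w\<rceil> \<le> \<lceil>y 0\<rceil>" "\<lfloor>f\<rfloor> \<le> \<lfloor>w\<rfloor>" "\<lfloor>f\<rfloor> \<le> \<lceil>w\<rceil>"
        by (auto intro: floor_mono ceiling_mono order_trans[OF _ floor_le_ceiling])
      then have "\<exists>x\<in>near (y 0). z 0 \<le> x" "\<lfloor>f\<rfloor> \<le> z 0"
        using z0' by auto
      then obtain x where x: "x \<in> near (y 0)" "z 0 \<le> x" and z: "\<lfloor>f\<rfloor> \<le> z 0" by blast
      have "of_int (a - 1) * ?r \<le> of_int (z 0)" using z opt(1) unfolding optimal_def by linarith
      then show ?thesis
        using leg_val_mono(2)[OF leg_min_step Cons.prems(1) x(2)] cs x(1) by blast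
    qed
    then obtain x where x: "x \<in> near (y 0)" "leg_val (c # cs) a (z 0) \<le> leg_val (c # cs) a x" by blast
    show ?thesis
    \<comment> \<open>Beyond the first coefficient any roundings will do, since
      \<open>leg_min\<close> bounds the energy of the tail from below.\<close>
    proof (intro exI[of _ "case_nat x (\<lambda>j. \<lfloor>y (Suc j)\<rfloor>)"] conjI allI)
      show "case_nat x (\<lambda>j. \<lfloor>y (Suc j)\<rfloor>) j \<in> near (y j)" for j
        using x(1) by (cases j) auto
      show "leg_energy (c # cs) a z \<le> leg_energy (c # cs) a (case_nat x (\<lambda>j. \<lfloor>y (Suc j)\<rfloor>))"
        using x(2) tail leg_min_le[OF cs, of x "\<lambda>j. \<lfloor>y (Suc j)\<rfloor>"] by simp
    qed
  qed
qed

section \<open>The quadratic form\<close>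

context unimodular_plumbing
begin

definition pairing :: "('v \<Rightarrow> int) \<Rightarrow> ('v \<Rightarrow> int) \<Rightarrow> int" where
  "pairing k x = (\<Sum>v\<in>verts H. k v * x v)"

text \<open>Twice the Riemann-Roch function \<open>\<chi>(z) = - (K + z) z / 2\<close> of lattice
  homology.\<close>

definition energy :: "('v \<Rightarrow> int) \<Rightarrow> int" where
  "energy z = - pairing (\<lambda>v. K_con H v + PD H z v) z"

lemma pairing_add:
  "pairing (\<lambda>v. k v + l v) x = pairing k x + pairing l x"
  "pairing k (\<lambda>v. x v + y v) = pairing k x + pairing k y"
  by (simp_all add: pairing_def sum.distrib algebra_simps)

lemma pairing_PD_sym: "pairing (PD H x) y = pairing (PD H y) x"
proof -
  have "pairing (PD H x) y = (\<Sum>v\<in>verts H. \<Sum>w\<in>verts H. x w * intersection H w v * y v)" for x y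
    by (simp add: pairing_def PD_def sum_distrib_right)
  moreover have "(\<Sum>v\<in>verts H. \<Sum>w\<in>verts H. x w * intersection H w v * y v) =
      (\<Sum>v\<in>verts H. \<Sum>w\<in>verts H. y w * intersection H w v * x v)"
    by (subst sum.swap, intro sum.cong refl) (simp add: intersection_sym)
  ultimately show ?thesis by simp
qed

lemma pairing_PD_disk: "pairing (PD_disk H) x = x (base H)"
  unfolding pairing_def PD_disk_def using finite_verts base_in
  by (subst sum.remove[of _ "base H"]) (auto simp: indicator_def)

text \<open>By symmetry of the form, the value computed from a real solution \<open>x\<close> equals
  the pairing of the class with the integral preimage \<open>w\<close>; all solutions therefore give
  the same number.\<close>

lemma square_PD:
  assumes "w \<in> lattice"
  shows "square H (PD H w) = of_int (pairing (PD H w) w)"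
  unfolding square_def
proof (rule the_equality)
  show "\<exists>x :: 'v \<Rightarrow> real. (\<forall>v\<in>verts H. (\<Sum>w\<in>verts H. x w * of_int (intersection H w v)) = of_int (PD H w v)) \<and>
         real_of_int (pairing (PD H w) w) = (\<Sum>v\<in>verts H. of_int (PD H w v) * x v)"
    by (intro exI[of _ "\<lambda>v. of_int (w v)"]) (simp add: PD_def pairing_def)
next
  fix r
  assume "\<exists>x :: 'v \<Rightarrow> real. (\<forall>v\<in>verts H. (\<Sum>w\<in>verts H. x w * of_int (intersection H w v)) = of_int (PD H w v)) \<and>
         r = (\<Sum>v\<in>verts H. of_int (PD H w v) * x v)"
  then obtain x :: "'v \<Rightarrow> real" where
    x: "\<And>v. v \<in> verts H \<Longrightarrow> (\<Sum>w\<in>verts H. x w * of_int (intersection H w v)) = of_int (PD H w v)"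
      "r = (\<Sum>v\<in>verts H. of_int (PD H w v) * x v)" by blast
  have "r = (\<Sum>v\<in>verts H. \<Sum>w'\<in>verts H. of_int (w w') * of_int (intersection H w' v) * x v)"
    unfolding x(2) by (intro sum.cong refl) (simp add: PD_def sum_distrib_right)
  also have "\<dots> = (\<Sum>w'\<in>verts H. \<Sum>v\<in>verts H. of_int (w w') * of_int (intersection H w' v) * x v)"
    by (rule sum.swap)
  also have "\<dots> = (\<Sum>w'\<in>verts H. of_int (w w') * (\<Sum>v\<in>verts H. x v * of_int (intersection H v w')))"
    unfolding sum_distrib_left by (intro sum.cong refl) (simp add: intersection_sym)
  also have "\<dots> = of_int (pairing (PD H w) w)"
    using x(1) by (simp add: pairing_def mult.commute)
  finally show "r = of_int (pairing (PD H w) w)" .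
qed

lemma ptU_energy:
  assumes z: "z \<in> lattice"
  shows "ptU z = (square H (K_con H) + of_nat (card (verts H))) / 4 - of_int (energy z)"
proof -
  let ?w = "\<lambda>v. con_dual v + (z v + z v)"
  have w: "?w \<in> lattice" using z con_dual(1) by (auto simp: lattice_def)
  have PDw: "PD H ?w = char_of z"
    unfolding PD_add con_dual(2) char_of_def by (auto simp: fun_eq_iff)
  have kz: "pairing (PD H z) con_dual = pairing (K_con H) z"
    using pairing_PD_sym[of z con_dual] con_dual(2) by simp
  have K: "square H (K_con H) = of_int (pairing (K_con H) con_dual)"
    using square_PD[OF con_dual(1)] con_dual(2) by simp
  have ch: "char_of z = (\<lambda>v. K_con H v + (PD H z v + PD H z v))" by (auto simp: char_of_def)
  have "square H (char_of z) = of_int (pairing (char_of z) ?w)"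
    using square_PD[OF w] PDw by simp
  also have "pairing (char_of z) ?w = pairing (K_con H) con_dual + 4 * (pairing (K_con H) z + pairing (PD H z) z)"
    unfolding ch by (simp only: pairing_add kz) simp
  also have "\<dots> = pairing (K_con H) con_dual - 4 * energy z"
    by (simp add: energy_def pairing_add)
  finally show ?thesis by (simp add: ptU_def height_U_def K field_simps)
qed

text \<open>The cross terms are two copies of the pairing of the disk class with \<open>z\<close>,
  which is the coefficient of \<open>z\<close> at the base vertex.\<close>

lemma energy_disk: "energy (\<lambda>v. z v + disk_dual v) = energy z + energy disk_dual - 2 * z (base H)"
proof -
  have "pairing (PD H z) disk_dual = z (base H)" "pairing (PD H disk_dual) z = z (base H)"
    using pairing_PD_sym[of z disk_dual] disk_dual(2) pairing_PD_disk by auto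
  then show ?thesis unfolding energy_def PD_add by (simp add: pairing_add)
qed

lemma ptV_mono:
  assumes "z \<in> lattice" "z' \<in> lattice" "z (base H) = z' (base H)" "ptU z \<le> ptU z'"
  shows "ptV z \<le> ptV z'"
  using assms(3,4) lattice_simps(2)[OF assms(1) disk_dual(1)] lattice_simps(2)[OF assms(2) disk_dual(1)]
  unfolding ptV_def by (simp add: ptU_energy assms(1,2) energy_disk)

text \<open>Symmetry of the form moves the computation to \<open>disk_dual\<close>, whose equations
  are homogeneous along the legs.\<close>

lemma con_dual_base: "con_dual (base H) = pairing (K_con H) disk_dual"
  using pairing_PD_sym[of disk_dual con_dual] disk_dual(2) con_dual(2) pairing_PD_disk by simp

end

section \<open>Continuants\<close>

text \<open>Continuants: numerator and denominator of \<open>neg_cont_frac\<close>. Up to sign,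
  \<open>leg_num\<close> is the determinant of the leg and \<open>leg_den\<close> that of the leg
  without its first vertex.\<close>

fun leg_num :: "int list \<Rightarrow> int" and leg_den :: "int list \<Rightarrow> int" where
  "leg_num [] = 1"
| "leg_num (c # cs) = c * leg_num cs - leg_den cs"
| "leg_den [] = 0"
| "leg_den (c # cs) = leg_num cs"

lemma leg_den_num: "\<forall>c\<in>set b. 2 \<le> c \<Longrightarrow> 0 \<le> leg_den b \<and> leg_den b < leg_num b"
proof (induction b)
  case (Cons c cs)
  then have IH: "0 \<le> leg_den cs" "leg_den cs < leg_num cs" "2 \<le> c" by auto
  then have "2 * leg_num cs \<le> c * leg_num cs" by (intro mult_right_mono) auto
  then have "leg_num cs < c * leg_num cs - leg_den cs" using IH by linarith
  then show ?case using IH by simp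
qed simp

lemma leg_ratio_eq: "\<forall>c\<in>set b. 2 \<le> c \<Longrightarrow> leg_ratio b = of_int (leg_den b) / of_int (leg_num b)"
proof (induction b)
  case (Cons c cs)
  then have "0 < leg_num cs" "0 < leg_num (c # cs)"
    using leg_den_num[of cs] leg_den_num[of "c # cs"] by auto
  then have N: "0 < real_of_int (leg_num cs)" "0 < real_of_int c * leg_num cs - leg_den cs"
    by (simp_all flip: of_int_mult of_int_diff)
  have "real_of_int c - leg_ratio cs = (real_of_int c * leg_num cs - leg_den cs) / leg_num cs"
    using Cons N by (simp add: diff_divide_distrib)
  then show ?case by simp
qed simp

lemma coprime_leg_num_den: "coprime (leg_num b) (leg_den b)"
proof (induction b)
  case (Cons c cs)
  have "gcd (c * leg_num cs - leg_den cs) (leg_num cs) = gcd (leg_den cs) (leg_num cs)"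
    by (metis gcd_diff2 gcd.commute gcd_add_mult add.commute diff_add_cancel gcd_diff1 gcd_neg1 minus_diff_eq mult.commute)
  then show ?case using Cons by (simp add: coprime_iff_gcd_eq_1 gcd.commute)
qed simp

text \<open>The linear system \<open>PD z = n\<close> at the vertices of a leg, where
  \<open>a\<close> is the coefficient at the vertex to which the leg is attached.\<close>

fun leg_eq :: "int list \<Rightarrow> int \<Rightarrow> (nat \<Rightarrow> int) \<Rightarrow> (nat \<Rightarrow> int) \<Rightarrow> bool" where
  "leg_eq [] a u n \<longleftrightarrow> True"
| "leg_eq (c # cs) a u n \<longleftrightarrow> a - c * u 0 + (if cs = [] then 0 else u 1) = n 0 \<and>
     leg_eq cs (u 0) (\<lambda>j. u (Suc j)) (\<lambda>j. n (Suc j))"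

lemma leg_eq_iff: "leg_eq b a u n \<longleftrightarrow>
   (\<forall>j<length b. (case j of 0 \<Rightarrow> a | Suc k \<Rightarrow> u k) - b ! j * u j + (if Suc j < length b then u (Suc j) else 0) = n j)"
proof (induction b arbitrary: a u n)
  case (Cons c cs)
  have "(\<forall>j<length cs. (case j of 0 \<Rightarrow> u 0 | Suc k \<Rightarrow> u (Suc k)) - cs ! j * u (Suc j) +
       (if Suc j < length cs then u (Suc (Suc j)) else 0) = n (Suc j)) \<longleftrightarrow>
      (\<forall>j<length cs. u j - cs ! j * u (Suc j) + (if Suc j < length cs then u (Suc (Suc j)) else 0) = n (Suc j))"
    by (intro all_cong) (auto split: nat.split)
  then show ?case using Cons by (simp add: All_less_Suc2)
qed simp

text \<open>Solving inwards from the far end, whose coefficient \<open>y\<close> is free, each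
  equation gives the coefficient before it. The coefficient at the attaching vertex thus runs
  through a residue class modulo \<open>leg_num b\<close>.\<close>

lemma leg_eq_solvable:
  "\<exists>c d. \<forall>y. \<exists>u. leg_eq b (leg_num b * y + c) u n \<and> (if b = [] then 0 else u 0) = leg_den b * y + d"
proof (induction b arbitrary: n)
  case Nil
  show ?case by (intro exI[of _ 0]) simp
next
  case (Cons k cs)
  obtain c d where cd: "\<And>y. \<exists>u. leg_eq cs (leg_num cs * y + c) u (\<lambda>j. n (Suc j)) \<and>
      (if cs = [] then 0 else u 0) = leg_den cs * y + d"
    using Cons.IH[of "\<lambda>j. n (Suc j)"] by blast
  show ?case
  proof (rule exI[of _ "n 0 + k * c - d"], rule exI[of _ c], rule allI)
    fix y
    obtain u where u: "leg_eq cs (leg_num cs * y + c) u (\<lambda>j. n (Suc j))" "(if cs = [] then 0 else u 0) = leg_den cs * y + d"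
      using cd by blast
    show "\<exists>u'. leg_eq (k # cs) (leg_num (k # cs) * y + (n 0 + k * c - d)) u' n \<and>
       (if k # cs = [] then 0 else u' 0) = leg_den (k # cs) * y + c"
      using u by (intro exI[of _ "case_nat (leg_num cs * y + c) u"]) (auto simp: algebra_simps split: if_splits)
  qed
qed

text \<open>Here \<open>y\<close> is the coefficient at the far end. By the equations
  \<open>(b ! j - 2) * u j\<close> is a second difference of the coefficients, so the sum telescopes
  to a difference of first differences.\<close>

lemma leg_eq_homogeneous:
  "leg_eq b a u (\<lambda>_. 0) \<Longrightarrow> \<exists>y. a = leg_num b * y \<and> (if b = [] then 0 else u 0) = leg_den b * y \<and>
     (b \<noteq> [] \<longrightarrow> (\<Sum>j<length b. (b ! j - 2) * u j) = a - u 0 - y)"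
proof (induction b arbitrary: a u)
  case (Cons c cs)
  then have "leg_eq cs (u 0) (\<lambda>j. u (Suc j)) (\<lambda>_. 0)" by simp
  from Cons.IH[OF this] obtain y where y: "u 0 = leg_num cs * y" "(if cs = [] then 0 else u 1) = leg_den cs * y"
    "cs \<noteq> [] \<longrightarrow> (\<Sum>j<length cs. (cs ! j - 2) * u (Suc j)) = u 0 - u 1 - y"
    unfolding One_nat_def by blast
  have a: "a = c * u 0 - (if cs = [] then 0 else u 1)" using Cons.prems by simp
  have s: "(\<Sum>j<length (c # cs). ((c # cs) ! j - 2) * u j) = (c - 2) * u 0 + (\<Sum>j<length cs. (cs ! j - 2) * u (Suc j))"
    by (simp add: sum.lessThan_Suc_shift del: sum.lessThan_Suc)
  show ?case
  proof (intro exI[of _ y] conjI impI)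
    show "a = leg_num (c # cs) * y" using a y(1,2) by (simp add: algebra_simps split: if_splits)
    show "(\<Sum>j<length (c # cs). ((c # cs) ! j - 2) * u j) = a - u 0 - y"
      unfolding s using y a by (cases "cs = []") (auto simp: algebra_simps)
  qed (use y in simp)
qed simp

lemma leg_eq_zero:
  "leg_eq b 0 u (\<lambda>_. 0) \<Longrightarrow> (b \<noteq> [] \<Longrightarrow> u 0 = 0) \<Longrightarrow> j < length b \<Longrightarrow> u j = 0"
proof (induction b arbitrary: u j)
  case (Cons c cs)
  have "leg_eq cs 0 (\<lambda>j. u (Suc j)) (\<lambda>_. 0)" "cs \<noteq> [] \<Longrightarrow> u (Suc 0) = 0" using Cons.prems by auto
  then show ?case using Cons by (cases j) auto
qed simp

text \<open>\<open>leg_energy\<close> counts the edge to the attaching vertex twice, the pairing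
  over the leg only once; the term with \<open>a\<close> is the other half, which is accounted for
  at that vertex.\<close>

lemma leg_eq_energy:
  "leg_eq b a u n \<Longrightarrow> - (\<Sum>j<length b. (b ! j - 2 + n j) * u j) = leg_energy b a u + a * (if b = [] then 0 else u 0)"
proof (induction b arbitrary: a u n)
  case (Cons c cs)
  have IH: "- (\<Sum>j<length cs. (cs ! j - 2 + n (Suc j)) * u (Suc j)) =
      leg_energy cs (u 0) (\<lambda>j. u (Suc j)) + u 0 * (if cs = [] then 0 else u 1)"
    using Cons.IH[of "u 0" "\<lambda>j. u (Suc j)" "\<lambda>j. n (Suc j)"] Cons.prems by simp
  have s: "(\<Sum>j<length (c # cs). ((c # cs) ! j - 2 + n j) * u j) =
     (c - 2 + n 0) * u 0 + (\<Sum>j<length cs. (cs ! j - 2 + n (Suc j)) * u (Suc j))"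
    by (simp add: sum.lessThan_Suc_shift del: sum.lessThan_Suc)
  have n0: "n 0 = a - c * u 0 + (if cs = [] then 0 else u 1)" using Cons.prems by simp
  show ?case
    unfolding s minus_add_distrib IH n0 by (simp add: algebra_simps)
qed simp

section \<open>Star-shaped graphs\<close>

locale star_plumbing =
  fixes m :: nat and p q :: "nat \<Rightarrow> int" and b :: "nat \<Rightarrow> int list" and e0 :: int
  assumes p_ge: "\<And>i. i \<in> {1..m} \<Longrightarrow> 2 \<le> p i"
    and q_ge: "\<And>i. i \<in> {1..m} \<Longrightarrow> 1 \<le> q i"
    and e0_eq: "e0 * (\<Prod>i\<in>{1..m}. p i) + (\<Sum>i\<in>{1..m}. q i * (\<Prod>j\<in>{1..m} - {i}. p j)) = - 1"
    and legs_nonempty: "\<And>i. i \<in> {1..m} \<Longrightarrow> b i \<noteq> []"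
    and legs_ge: "\<And>i. i \<in> {1..m} \<Longrightarrow> \<forall>c\<in>set (b i). 2 \<le> c"
    and legs_frac: "\<And>i. i \<in> {1..m} \<Longrightarrow> neg_cont_frac (b i) = of_int (p i) / of_int (q i)"
begin

definition G :: "star_vertex plumbing" where
  "G = star_graph m e0 b"

definition \<alpha> :: int where
  "\<alpha> = (\<Prod>i\<in>{1..m}. p i)"

definition cofactor :: "nat \<Rightarrow> int" where
  "cofactor i = (\<Prod>j\<in>{1..m} - {i}. p j)"

lemma \<alpha>_cofactor: "i \<in> {1..m} \<Longrightarrow> \<alpha> = p i * cofactor i"
  by (simp add: \<alpha>_def cofactor_def prod.remove)

lemma p_dvd_cofactor: "i \<in> {1..m} \<Longrightarrow> j \<in> {1..m} \<Longrightarrow> i \<noteq> j \<Longrightarrow> p i dvd cofactor j"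
  unfolding cofactor_def by (intro dvd_prodI) auto

lemma \<alpha>_pos: "0 < \<alpha>"
  unfolding \<alpha>_def using p_ge by (intro prod_pos) fastforce

lemma e0_\<alpha>: "e0 * \<alpha> + (\<Sum>i\<in>{1..m}. q i * cofactor i) = - 1"
  using e0_eq by (simp add: \<alpha>_def cofactor_def)

text \<open>A common divisor of \<open>p i\<close> and \<open>q i\<close> divides every term on the
  left of the equation for \<open>e0\<close>, hence it divides 1.\<close>

lemma coprime_p_q: "i \<in> {1..m} \<Longrightarrow> coprime (p i) (q i)"
proof (rule coprimeI)
  fix d assume i: "i \<in> {1..m}" and d: "d dvd p i" "d dvd q i"
  have "d dvd q j * cofactor j" if "j \<in> {1..m}" for j
    using d p_dvd_cofactor[OF i that] by (cases "j = i") (auto intro: dvd_trans)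
  then have "d dvd (\<Sum>j\<in>{1..m}. q j * cofactor j)" by (rule dvd_sum)
  moreover have "d dvd e0 * \<alpha>" using d(1) \<alpha>_cofactor[OF i] by simp
  ultimately have "d dvd - 1" using e0_\<alpha> dvd_add by metis
  then show "is_unit d" by simp
qed

text \<open>Both quotients are reduced fractions with positive entries and the same value.\<close>

lemma leg_num_den_eq:
  assumes i: "i \<in> {1..m}"
  shows "leg_num (b i) = p i" "leg_den (b i) = q i"
proof -
  let ?N = "leg_num (b i)" and ?D = "leg_den (b i)"
  have pos: "0 < ?N" "0 < p i" "0 < q i" using leg_den_num[OF legs_ge[OF i]] p_ge[OF i] q_ge[OF i] by auto
  have "real_of_int ?D / ?N = q i / p i"
    using leg_ratio_eq[OF legs_ge[OF i]] leg_ratio_cont_frac[OF legs_nonempty[OF i]] legs_frac[OF i] by simp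
  then have "real_of_int (?D * p i) = of_int (q i * ?N)" using pos by (simp add: field_simps)
  then have eq: "?D * p i = q i * ?N" by (simp only: of_int_eq_iff)
  have "p i dvd q i * ?N" using eq by (metis dvd_triv_right)
  then have 1: "p i dvd ?N" using coprime_p_q[OF i] by (simp add: coprime_dvd_mult_right_iff)
  have "?N dvd ?D * p i" using eq by (metis dvd_triv_right)
  then have 2: "?N dvd p i" using coprime_leg_num_den by (simp add: coprime_dvd_mult_right_iff)
  show N: "?N = p i" using zdvd_antisym_nonneg[of ?N "p i"] 1 2 pos by simp
  show "?D = q i" using eq pos unfolding N by simp
qed

lemma leg_ratio_q_p: "i \<in> {1..m} \<Longrightarrow> leg_ratio (b i) = of_int (q i) / of_int (p i)"
  by (simp add: leg_ratio_eq legs_ge leg_num_den_eq)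

section \<open>Poincare duality on the star-shaped graph\<close>

lemma verts_G: "verts G = insert Center {Leg i j | i j. i \<in> {1..m} \<and> j < length (b i)}"
  by (simp add: G_def star_graph_def)

lemma finite_verts_G: "finite (verts G)"
proof -
  have "verts G = insert Center (\<Union>i\<in>{1..m}. Leg i ` {..<length (b i)})" by (auto simp: verts_G)
  then show ?thesis by simp
qed

lemma sum_verts_G: "(\<Sum>v\<in>verts G. f v) = f Center + (\<Sum>i\<in>{1..m}. \<Sum>j<length (b i). f (Leg i j))"
proof -
  have V: "verts G = insert Center (\<Union>i\<in>{1..m}. Leg i ` {..<length (b i)})" by (auto simp: verts_G)
  have "(\<Sum>v\<in>(\<Union>i\<in>{1..m}. Leg i ` {..<length (b i)}). f v) = (\<Sum>i\<in>{1..m}. \<Sum>v\<in>Leg i ` {..<length (b i)}. f v)"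
    by (rule sum.UNION_disjoint) auto
  also have "\<dots> = (\<Sum>i\<in>{1..m}. \<Sum>j<length (b i). f (Leg i j))"
    by (intro sum.cong refl) (simp add: sum.reindex inj_on_def)
  finally show ?thesis unfolding V by (subst sum.insert) auto
qed

lemma intersection_G:
  "intersection G Center Center = e0"
  "intersection G Center (Leg i j) = (if j = 0 then 1 else 0)"
  "intersection G (Leg i j) Center = (if j = 0 then 1 else 0)"
  "intersection G (Leg i' j') (Leg i j) = (if i' = i then if j' = j then - b i ! j
     else if j = Suc j' \<or> j' = Suc j then 1 else 0 else 0)"
  by (auto simp: intersection_def G_def star_graph_def)

lemma PD_Center: "PD G z Center = e0 * z Center + (\<Sum>i\<in>{1..m}. z (Leg i 0))"
proof -
  have "(\<Sum>j<length (b i). z (Leg i j) * intersection G (Leg i j) Center) = z (Leg i 0)" if "i \<in> {1..m}" for i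
  proof -
    have "(\<Sum>j<length (b i). z (Leg i j) * intersection G (Leg i j) Center) =
        (\<Sum>j<length (b i). if j = 0 then z (Leg i j) else 0)"
      by (intro sum.cong refl) (simp add: intersection_G)
    then show ?thesis using legs_nonempty[OF that] by simp
  qed
  then have "(\<Sum>w\<in>verts G. z w * intersection G w Center) = e0 * z Center + (\<Sum>i\<in>{1..m}. z (Leg i 0))"
    unfolding sum_verts_G by (simp add: intersection_G)
  then show ?thesis by (simp add: PD_def verts_G)
qed

lemma PD_Leg:
  assumes i: "i \<in> {1..m}" and j: "j < length (b i)"
  shows "PD G z (Leg i j) = (case j of 0 \<Rightarrow> z Center | Suc k \<Rightarrow> z (Leg i k)) - b i ! j * z (Leg i j) +
     (if Suc j < length (b i) then z (Leg i (Suc j)) else 0)"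
proof -
  let ?n = "length (b i)"
  have c: "z Center * intersection G Center (Leg i j) = (if j = 0 then z Center else 0)"
    by (simp add: intersection_G)
  have "(\<Sum>i'\<in>{1..m}. \<Sum>j'<length (b i'). z (Leg i' j') * intersection G (Leg i' j') (Leg i j)) =
      (\<Sum>i'\<in>{1..m}. if i' = i then \<Sum>j'<?n. z (Leg i j') * intersection G (Leg i j') (Leg i j) else 0)"
    by (intro sum.cong refl) (simp add: intersection_G)
  also have "\<dots> = (\<Sum>j'<?n. z (Leg i j') * intersection G (Leg i j') (Leg i j))"
    using i by simp
  also have "\<dots> = (\<Sum>j'<?n. (if j' = j then - b i ! j * z (Leg i j') else 0) +
      (if j = Suc j' then z (Leg i j') else 0) + (if j' = Suc j then z (Leg i j') else 0))"
    by (intro sum.cong refl) (simp add: intersection_G)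
  also have "\<dots> = - b i ! j * z (Leg i j) + (case j of 0 \<Rightarrow> 0 | Suc k \<Rightarrow> z (Leg i k)) +
      (if Suc j < ?n then z (Leg i (Suc j)) else 0)"
    unfolding sum.distrib using j by (auto split: nat.split)
  finally have "(\<Sum>w\<in>verts G. z w * intersection G w (Leg i j)) = (if j = 0 then z Center else 0) +
     (- b i ! j * z (Leg i j) + (case j of 0 \<Rightarrow> 0 | Suc k \<Rightarrow> z (Leg i k)) + (if Suc j < ?n then z (Leg i (Suc j)) else 0))"
    unfolding sum_verts_G c by simp
  then show ?thesis using i j by (auto simp: PD_def verts_G split: nat.split)
qed

lemma leg_eq_PD:
  assumes i: "i \<in> {1..m}"
  shows "leg_eq (b i) (z Center) (\<lambda>j. z (Leg i j)) (\<lambda>j. n (Leg i j)) \<longleftrightarrow>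
     (\<forall>j<length (b i). PD G z (Leg i j) = n (Leg i j))"
  unfolding leg_eq_iff using PD_Leg[OF i] by simp

text \<open>The legs are homogeneous, so the central coefficient is \<open>p i * y i\<close> on each
  of them. Multiplying the central equation by \<open>\<alpha>\<close> collects everything into
  \<open>(e0 * \<alpha> + \<dots>) * z Center\<close>, which is \<open>- z Center\<close>. The case
  \<open>s = 1\<close> computes \<open>disk_dual\<close>, the case \<open>s = 0\<close> gives
  injectivity of \<open>PD\<close>.\<close>

lemma PD_concentrated:
  assumes "\<And>v. v \<in> verts G \<Longrightarrow> PD G z v = (if v = Center then s else 0)"
  shows "z Center = - \<alpha> * s"
    and "i \<in> {1..m} \<Longrightarrow> z (Leg i 0) = - q i * cofactor i * s"
    and "i \<in> {1..m} \<Longrightarrow> (\<Sum>j<length (b i). (b i ! j - 2) * z (Leg i j)) = z Center - z (Leg i 0) + cofactor i * s"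
proof -
  have leg0: "leg_eq (b i) (z Center) (\<lambda>j. z (Leg i j)) (\<lambda>j. 0)" if "i \<in> {1..m}" for i
  proof -
    have "PD G z (Leg i j) = 0" if "j < length (b i)" for j
      using assms[of "Leg i j"] that \<open>i \<in> {1..m}\<close> by (simp add: verts_G)
    then show ?thesis using leg_eq_PD[OF that, of z "\<lambda>_. 0"] by simp
  qed
  have "\<exists>y. \<forall>i\<in>{1..m}. z Center = p i * y i \<and> z (Leg i 0) = q i * y i \<and>
      (\<Sum>j<length (b i). (b i ! j - 2) * z (Leg i j)) = z Center - z (Leg i 0) - y i"
  proof (intro bchoice ballI)
    fix i assume i: "i \<in> {1..m}"
    show "\<exists>y. z Center = p i * y \<and> z (Leg i 0) = q i * y \<and>
      (\<Sum>j<length (b i). (b i ! j - 2) * z (Leg i j)) = z Center - z (Leg i 0) - y"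
      using leg_eq_homogeneous[OF leg0[OF i]] legs_nonempty[OF i] leg_num_den_eq[OF i] by auto
  qed
  then obtain y where y: "\<And>i. i \<in> {1..m} \<Longrightarrow> z Center = p i * y i" "\<And>i. i \<in> {1..m} \<Longrightarrow> z (Leg i 0) = q i * y i"
    "\<And>i. i \<in> {1..m} \<Longrightarrow> (\<Sum>j<length (b i). (b i ! j - 2) * z (Leg i j)) = z Center - z (Leg i 0) - y i"
    by blast
  have "s = e0 * z Center + (\<Sum>i\<in>{1..m}. q i * y i)"
    using assms[of Center] y(2) by (simp add: verts_G PD_Center)
  then have "\<alpha> * s = e0 * \<alpha> * z Center + (\<Sum>i\<in>{1..m}. \<alpha> * (q i * y i))"
    by (simp add: distrib_left sum_distrib_left)
  also have "(\<Sum>i\<in>{1..m}. \<alpha> * (q i * y i)) = (\<Sum>i\<in>{1..m}. q i * cofactor i * z Center)"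
    by (intro sum.cong refl) (simp add: \<alpha>_cofactor y(1))
  also have "e0 * \<alpha> * z Center + \<dots> = (e0 * \<alpha> + (\<Sum>i\<in>{1..m}. q i * cofactor i)) * z Center"
    by (simp add: distrib_right sum_distrib_right)
  finally have zC: "z Center = - \<alpha> * s" unfolding e0_\<alpha> by simp
  then show "z Center = - \<alpha> * s" .
  have yi: "y i = - cofactor i * s" if i: "i \<in> {1..m}" for i
  proof -
    have "p i * y i = p i * (- cofactor i * s)" using y(1)[OF i] zC \<alpha>_cofactor[OF i] by simp
    then have "p i = 0 \<or> y i = - cofactor i * s" by (simp only: mult_cancel_left)
    then show ?thesis using p_ge[OF i] by auto
  qed
  show "i \<in> {1..m} \<Longrightarrow> z (Leg i 0) = - q i * cofactor i * s"
    using y(2) yi by simp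
  show "i \<in> {1..m} \<Longrightarrow> (\<Sum>j<length (b i). (b i ! j - 2) * z (Leg i j)) = z Center - z (Leg i 0) + cofactor i * s"
    using y(3) yi by simp
qed

text \<open>Each leg is solvable exactly when suitably parametrized by a residue class of the
  central coefficient modulo \<open>p i\<close>. The Chinese remainder theorem meets all these
  classes at once, and the remaining freedom, multiples of \<open>\<alpha>\<close>, is used for the
  central equation.\<close>

lemma PD_solvable:
  fixes n :: "star_vertex \<Rightarrow> int"
  shows "\<exists>z. (\<forall>v. v \<notin> verts G \<longrightarrow> z v = 0) \<and> (\<forall>v\<in>verts G. PD G z v = n v)"
proof -
  have "\<exists>c d. \<forall>y. \<exists>u. leg_eq (b i) (p i * y + c) u (\<lambda>j. n (Leg i j)) \<and> u 0 = q i * y + d" if "i \<in> {1..m}" for i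
    using leg_eq_solvable[of "b i" "\<lambda>j. n (Leg i j)"] legs_nonempty[OF that] leg_num_den_eq[OF that] by simp
  then obtain c d where cd: "\<And>i y. i \<in> {1..m} \<Longrightarrow>
      \<exists>u. leg_eq (b i) (p i * y + c i) u (\<lambda>j. n (Leg i j)) \<and> u 0 = q i * y + d i"
    by metis
  text \<open>By the equation for \<open>e0\<close>, the integers \<open>- q i * cofactor i\<close> are the idempotents of the Chinese
    remainder theorem for the moduli \<open>p i\<close>.\<close>
  define X where "X = - (\<Sum>i\<in>{1..m}. c i * (q i * cofactor i))"
  have "p i dvd X - c i" if i: "i \<in> {1..m}" for i
  proof -
    have "p i dvd c j * (q j * cofactor j)" if "j \<in> {1..m} - {i}" for j
      using p_dvd_cofactor[OF i, of j] that by auto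
    then have 1: "p i dvd (\<Sum>j\<in>{1..m} - {i}. c j * (q j * cofactor j))" by (rule dvd_sum)
    have "p i dvd q j * cofactor j" if "j \<in> {1..m} - {i}" for j
      using p_dvd_cofactor[OF i, of j] that by auto
    then have 2: "p i dvd (\<Sum>j\<in>{1..m} - {i}. q j * cofactor j)" by (rule dvd_sum)
    have 3: "p i dvd e0 * \<alpha>" using \<alpha>_cofactor[OF i] by simp
    have e: "q i * cofactor i = - 1 - e0 * \<alpha> - (\<Sum>j\<in>{1..m} - {i}. q j * cofactor j)"
      using e0_\<alpha> i by (simp add: sum.remove)
    have X: "X = - (c i * (q i * cofactor i)) - (\<Sum>j\<in>{1..m} - {i}. c j * (q j * cofactor j))"
      unfolding X_def using i by (simp add: sum.remove)
    have "X - c i = c i * (e0 * \<alpha> + (\<Sum>j\<in>{1..m} - {i}. q j * cofactor j))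
        - (\<Sum>j\<in>{1..m} - {i}. c j * (q j * cofactor j))"
      by (simp only: X e) (simp add: algebra_simps)
    then show ?thesis using 1 2 3 by simp
  qed
  then have "\<exists>Y. X = p i * Y + c i" if "i \<in> {1..m}" for i
    using that by (metis dvd_def diff_add_cancel)
  then obtain Y where Y: "\<And>i. i \<in> {1..m} \<Longrightarrow> X = p i * Y i + c i" by metis
  \<comment> \<open>The defect of the central equation at \<open>X\<close>. Adding
    \<open>\<alpha> * k\<close> to the central coefficient changes its left side by
    \<open>(e0 * \<alpha> + \<dots>) * k = - k\<close>, which cancels the defect.\<close>
  define k where "k = e0 * X + (\<Sum>i\<in>{1..m}. q i * Y i + d i) - n Center"
  define x where "x = X + \<alpha> * k"
  have x: "x = p i * (Y i + cofactor i * k) + c i" if "i \<in> {1..m}" for i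
    using Y[OF that] \<alpha>_cofactor[OF that] by (simp add: x_def algebra_simps)
  have "\<exists>u. leg_eq (b i) x u (\<lambda>j. n (Leg i j)) \<and> u 0 = q i * (Y i + cofactor i * k) + d i" if "i \<in> {1..m}" for i
    using cd[OF that, of "Y i + cofactor i * k"] x[OF that] by simp
  then obtain u where u: "\<And>i. i \<in> {1..m} \<Longrightarrow> leg_eq (b i) x (u i) (\<lambda>j. n (Leg i j))"
    "\<And>i. i \<in> {1..m} \<Longrightarrow> u i 0 = q i * (Y i + cofactor i * k) + d i" by metis
  define z where "z v = (case v of Center \<Rightarrow> x | Leg i j \<Rightarrow> if Leg i j \<in> verts G then u i j else 0)" for v
  have zC: "z Center = x" by (simp add: z_def)
  have zL: "z (Leg i j) = u i j" if "i \<in> {1..m}" "j < length (b i)" for i j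
    using that by (simp add: z_def verts_G)
  have legs: "PD G z (Leg i j) = n (Leg i j)" if ij: "i \<in> {1..m}" "j < length (b i)" for i j
  proof -
    have "leg_eq (b i) (z Center) (\<lambda>j. z (Leg i j)) (\<lambda>j. n (Leg i j))"
      unfolding leg_eq_iff zC
    proof (intro allI impI)
      fix j assume j: "j < length (b i)"
      have "(case j of 0 \<Rightarrow> x | Suc k \<Rightarrow> z (Leg i k)) = (case j of 0 \<Rightarrow> x | Suc k \<Rightarrow> u i k)"
        using ij(1) j by (cases j) (auto simp: zL)
      then show "(case j of 0 \<Rightarrow> x | Suc k \<Rightarrow> z (Leg i k)) - b i ! j * z (Leg i j) +
          (if Suc j < length (b i) then z (Leg i (Suc j)) else 0) = n (Leg i j)"
        using u(1)[OF ij(1), unfolded leg_eq_iff, rule_format, OF j] ij(1) j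
        by (cases "Suc j < length (b i)") (simp_all add: zL)
    qed
    then show ?thesis using leg_eq_PD[OF ij(1)] ij(2) by blast
  qed
  have "PD G z Center = e0 * x + (\<Sum>i\<in>{1..m}. q i * (Y i + cofactor i * k) + d i)"
    unfolding PD_Center zC using zL legs_nonempty u(2) by simp
  also have "\<dots> = e0 * X + (\<Sum>i\<in>{1..m}. q i * Y i + d i) + (e0 * \<alpha> + (\<Sum>i\<in>{1..m}. q i * cofactor i)) * k"
    by (simp add: x_def algebra_simps sum.distrib sum_distrib_left)
  also have "\<dots> = n Center" unfolding e0_\<alpha> by (simp add: k_def)
  finally have "PD G z Center = n Center" .
  moreover have "z v = 0" if "v \<notin> verts G" for v
    using that by (cases v) (auto simp: z_def verts_G)
  ultimately show ?thesis using legs by (intro exI[of _ z]) (auto simp: verts_G)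
qed

sublocale unimodular_plumbing G
proof
  show "finite (verts G)" by (rule finite_verts_G)
  show "base G \<in> verts G" by (simp add: G_def star_graph_def)
  show "intersection G v w = intersection G w v" for v w
    by (cases v; cases w) (auto simp: intersection_G)
  show "bij_betw (PD G) {z. \<forall>v. v \<notin> verts G \<longrightarrow> z v = 0} {z. \<forall>v. v \<notin> verts G \<longrightarrow> z v = 0}"
    unfolding bij_betw_def
  proof
    show "inj_on (PD G) {z. \<forall>v. v \<notin> verts G \<longrightarrow> z v = 0}"
    proof (rule inj_onI, rule ext)
      fix z z' v
      assume z: "z \<in> {z. \<forall>v. v \<notin> verts G \<longrightarrow> z v = 0}" "z' \<in> {z. \<forall>v. v \<notin> verts G \<longrightarrow> z v = 0}"
        and eq: "PD G z = PD G z'"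
      define w where "w v = z v + - z' v" for v
      have "PD G w = (\<lambda>v. PD G z v + - PD G z' v)"
        unfolding w_def by (simp only: PD_add PD_minus)
      then have PDw: "PD G w v = 0" for v using eq by simp
      \<comment> \<open>The central coefficient and the first one of each leg vanish; the equations
        then carry the vanishing outwards along the leg.\<close>
      have C: "w Center = 0" using PD_concentrated(1)[of w 0] PDw by simp
      have L0: "w (Leg i 0) = 0" if "i \<in> {1..m}" for i
        using PD_concentrated(2)[of w 0 i] PDw that by simp
      have L: "w (Leg i j) = 0" if "i \<in> {1..m}" "j < length (b i)" for i j
        using leg_eq_zero[of "b i" "\<lambda>j. w (Leg i j)" j] leg_eq_PD[OF that(1), of w "\<lambda>_. 0"] PDw C L0 that by simp
      have "w v = 0" using z C L by (cases "v \<in> verts G") (auto simp: verts_G w_def)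
      then show "z v = z' v" by (simp add: w_def)
    qed
    show "PD G ` {z. \<forall>v. v \<notin> verts G \<longrightarrow> z v = 0} = {z. \<forall>v. v \<notin> verts G \<longrightarrow> z v = 0}"
    proof (intro equalityI subsetI)
      fix n :: "star_vertex \<Rightarrow> int"
      assume n: "n \<in> {z. \<forall>v. v \<notin> verts G \<longrightarrow> z v = 0}"
      obtain z where z: "\<forall>v. v \<notin> verts G \<longrightarrow> z v = 0" "\<forall>v\<in>verts G. PD G z v = n v"
        using PD_solvable by blast
      have "PD G z v = n v" for v using z n by (cases "v \<in> verts G") (auto simp: PD_def)
      then have "n = PD G z" by (intro ext) simp
      then show "n \<in> PD G ` {z. \<forall>v. v \<notin> verts G \<longrightarrow> z v = 0}" using z(1) by blast
    qed (auto simp: PD_def)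
  qed
qed

lemma base_G: "base G = Center"
  by (simp add: G_def star_graph_def)

lemma disk_dual_Center: "disk_dual Center = - \<alpha>"
  using PD_concentrated(1)[of disk_dual 1] disk_dual(2) base_G by (simp add: PD_disk_def indicator_def)

lemma K_con_G:
  "K_con G Center = - e0 - 2"
  "i \<in> {1..m} \<Longrightarrow> j < length (b i) \<Longrightarrow> K_con G (Leg i j) = b i ! j - 2"
  by (simp_all add: K_con_def verts_G) (simp_all add: G_def star_graph_def)

text \<open>This is \<open>- (1 + \<gamma>)\<close>. It is \<open>K_con\<close> evaluated on
  \<open>disk_dual\<close>, and the contribution of each leg is the telescoping sum of
  \<open>PD_concentrated\<close>.\<close>

lemma con_dual_Center: "con_dual Center = \<alpha> * (2 - int m) + (\<Sum>i\<in>{1..m}. cofactor i) - 1"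
proof -
  have d: "\<And>v. v \<in> verts G \<Longrightarrow> PD G disk_dual v = (if v = Center then 1 else 0)"
    using disk_dual(2) base_G by (simp add: PD_disk_def indicator_def)
  have "con_dual Center = (- e0 - 2) * disk_dual Center +
      (\<Sum>i\<in>{1..m}. \<Sum>j<length (b i). (b i ! j - 2) * disk_dual (Leg i j))"
    using con_dual_base unfolding base_G pairing_def sum_verts_G by (simp add: K_con_G)
  also have "(\<Sum>i\<in>{1..m}. \<Sum>j<length (b i). (b i ! j - 2) * disk_dual (Leg i j)) =
      (\<Sum>i\<in>{1..m}. - \<alpha> + q i * cofactor i + cofactor i)"
    using PD_concentrated[OF d] by (intro sum.cong refl) simp
  also have "(- e0 - 2) * disk_dual Center + \<dots> =
      (e0 * \<alpha> + (\<Sum>i\<in>{1..m}. q i * cofactor i)) + \<alpha> * (2 - int m) + (\<Sum>i\<in>{1..m}. cofactor i)"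
    by (simp add: disk_dual_Center sum.distrib sum_subtractf algebra_simps)
  finally show ?thesis unfolding e0_\<alpha> by simp
qed

lemma energy_G:
  "energy z = - e0 * z Center * (z Center - 1) + 2 * z Center +
     (\<Sum>i\<in>{1..m}. leg_energy (b i) (z Center) (\<lambda>j. z (Leg i j)))"
proof -
  have leg: "(\<Sum>j<length (b i). (K_con G (Leg i j) + PD G z (Leg i j)) * z (Leg i j)) =
      - leg_energy (b i) (z Center) (\<lambda>j. z (Leg i j)) - z Center * z (Leg i 0)" if i: "i \<in> {1..m}" for i
  proof -
    have "leg_eq (b i) (z Center) (\<lambda>j. z (Leg i j)) (\<lambda>j. PD G z (Leg i j))"
      using leg_eq_PD[OF i, of z "PD G z"] by simp
    from leg_eq_energy[OF this] show ?thesis using legs_nonempty[OF i] i by (simp add: K_con_G)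
  qed
  have "energy z = - ((- e0 - 2 + (e0 * z Center + (\<Sum>i\<in>{1..m}. z (Leg i 0)))) * z Center +
      (\<Sum>i\<in>{1..m}. - leg_energy (b i) (z Center) (\<lambda>j. z (Leg i j)) - z Center * z (Leg i 0)))"
    unfolding energy_def pairing_def sum_verts_G using leg by (simp add: K_con_G PD_Center)
  then show ?thesis
    by (simp add: sum_subtractf sum_negf algebra_simps sum_distrib_left)
qed

end

lemma leg_energy_cong: "(\<And>j. j < length b \<Longrightarrow> u j = u' j) \<Longrightarrow> leg_energy b a u = leg_energy b a u'"
proof (induction b arbitrary: a u u')
  case (Cons c cs)
  have "u 0 = u' 0" using Cons.prems[of 0] by simp
  moreover have "leg_energy cs (u 0) (\<lambda>j. u (Suc j)) = leg_energy cs (u 0) (\<lambda>j. u' (Suc j))"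
    using Cons.prems by (intro Cons.IH) simp
  ultimately show ?case by simp
qed simp

text \<open>The interval between floor and ceiling of \<open>w\<close> is convex and contains both
  \<open>w\<close> and \<open>delay w\<close>.\<close>

lemma delay_segment_rounding:
  assumes t: "0 \<le> t" "t \<le> 1" and l: "l \<in> near ((1 - t) * w + t * delay w)"
  shows "l \<in> near w"
proof -
  have d: "of_int \<lfloor>w\<rfloor> \<le> delay w" "delay w \<le> of_int \<lceil>w\<rceil>"
    using delay_rounding[of "\<lfloor>delay w\<rfloor>" w] delay_rounding[of "\<lceil>delay w\<rceil>" w] by auto linarith+
  have "(1 - t) * w + t * delay w \<le> of_int \<lceil>w\<rceil>"
    using d(2) t by (intro convex_bound_le) auto
  moreover have "- ((1 - t) * w + t * delay w) \<le> - of_int \<lfloor>w\<rfloor>"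
    using d(1) t convex_bound_le[of "- w" "- of_int \<lfloor>w\<rfloor>" "- delay w" "1 - t" t] by simp
  ultimately have "\<lfloor>w\<rfloor> \<le> l" "l \<le> \<lceil>w\<rceil>" using l by auto linarith+
  moreover have "\<lceil>w\<rceil> \<le> \<lfloor>w\<rfloor> + 1" by linarith
  ultimately show ?thesis by auto
qed

lemma mono_on_int_step:
  fixes h :: "int \<Rightarrow> real"
  assumes "\<And>l. l < a \<Longrightarrow> h l \<le> h (l + 1)"
  shows "mono_on {..a} h"
proof (rule mono_onI)
  fix x y assume "x \<in> {..a}" "y \<in> {..a}" "x \<le> y"
  from \<open>x \<le> y\<close> \<open>y \<in> {..a}\<close> show "h x \<le> h y"
  proof (induction y rule: int_ge_induct)
    case (step y)
    then show ?case using assms[of y] by auto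
  qed simp
qed

lemma antimono_on_int_step:
  fixes h :: "int \<Rightarrow> real"
  assumes "\<And>l. b \<le> l \<Longrightarrow> h (l + 1) \<le> h l"
  shows "antimono_on {b..} h"
proof (rule monotone_onI)
  fix x y assume "x \<in> {b..}" "y \<in> {b..}" "x \<le> y"
  from \<open>x \<le> y\<close> show "h y \<le> h x"
  proof (induction y rule: int_ge_induct)
    case (step y)
    then show ?case using assms[of y] \<open>x \<in> {b..}\<close> by auto
  qed simp
qed

section \<open>The flip map and the involutions of the line\<close>

lemma pushforward_bij:
  assumes "\<And>c. \<phi> (\<psi> c) = c" "\<And>a. \<psi> (\<phi> a) = a"
  shows "pushforward \<phi> x = (\<lambda>c. x (\<psi> c))"
proof
  fix c
  have "{a \<in> support x. \<phi> a = c} = (if x (\<psi> c) = 0 then {} else {\<psi> c})"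
    using assms by (auto simp: support_def)
  then show "pushforward \<phi> x c = x (\<psi> c)" by (simp add: pushforward_def)
qed

abbreviation line_topology :: "(int \<Rightarrow> real) topology" where
  "line_topology \<equiv> weak_topology (line_simplexes UNIV)"

lemma pushforward_tent_shift: "pushforward (\<lambda>l. l - a) (tent r) = tent (r - of_int a)"
  by (subst pushforward_bij[where \<psi> = "\<lambda>l. l + a"]) (auto simp: tent_def algebra_simps)

lemma pushforward_tent_reflect: "pushforward (\<lambda>l. N - l) (tent r) = tent (of_int N - r)"
proof (subst pushforward_bij[where \<psi> = "\<lambda>l. N - l"])
  have "\<bar>r - of_int (N - c)\<bar> = \<bar>of_int N - r - of_int c\<bar>" for c by simp
  then show "(\<lambda>c. tent r (N - c)) = tent (of_int N - r)" unfolding tent_def by simp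
qed auto

lemma filtered_line_simps:
  "space_of (filtered_line h1 h2 g i j) = weak_topology (line_simplexes UNIV)"
  "hU (filtered_line h1 h2 g i j) x = Min (h1 ` support x)"
  "hV (filtered_line h1 h2 g i j) x = Min (h2 ` support x)"
  "flip (filtered_line h1 h2 g i j) = pushforward g"
  "invI (filtered_line h1 h2 g i j) = pushforward i"
  "invJ (filtered_line h1 h2 g i j) = pushforward j"
  by (simp_all add: filtered_line_def realization_def line_complex_def df_space.defs)

lemma continuous_map_line:
  assumes "continuous_on UNIV A" and "\<And>r. g (tent r) = tent (A r)"
  shows "continuous_map line_topology line_topology g"
proof -
  have ws: "continuous_map line_topology euclideanreal (weighted_sum real_of_int)"
    by (rule continuous_map_weighted_sum[OF is_complex_line])
  have A: "continuous_map euclideanreal euclideanreal A"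
    using assms(1) by simp
  have tent: "continuous_map euclideanreal line_topology tent"
    using line_complex_chart_inverse[of UNIV]
    by (simp add: df_map_def line_space_def realization_def line_complex_def)
  show ?thesis
  proof (rule continuous_map_eq[OF continuous_map_compose[OF ws continuous_map_compose[OF A tent]]])
    fix x assume "x \<in> topspace line_topology"
    then have "tent (weighted_sum real_of_int x) = x"
      unfolding topspace_weak_topology by (rule tent_weighted_sum)
    then show "(tent \<circ> A \<circ> weighted_sum real_of_int) x = g x" using assms(2) by (metis comp_apply)
  qed
qed

lemma is_knot_space_line:
  fixes h1 h2 :: "int \<Rightarrow> real"
  assumes sym: "\<And>l. h1 (N - l) = h1 l" and h2: "\<And>l. h2 l = h1 (l - a)"
  shows "is_knot_space (filtered_line h1 h2 (\<lambda>l. l - a) (\<lambda>l. N - l) (\<lambda>l. N + a - l))"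
proof -
  let ?L = "filtered_line h1 h2 (\<lambda>l. l - a) (\<lambda>l. N - l) (\<lambda>l. N + a - l)"
  have tent: "\<exists>r. x = tent r" if "x \<in> polyhedron (line_simplexes UNIV)" for x
    using tent_weighted_sum[OF that] by metis
  have c1: "continuous_map line_topology line_topology (pushforward (\<lambda>l. l - a))"
    by (rule continuous_map_line[where A = "\<lambda>r. r - of_int a", OF _ pushforward_tent_shift]) (intro continuous_intros)
  have c2: "continuous_map line_topology line_topology (pushforward (\<lambda>l. N - l))" for N
    by (rule continuous_map_line[where A = "\<lambda>r. of_int N - r", OF _ pushforward_tent_reflect]) (intro continuous_intros)
  have sym': "h2 (N + a - l) = h1 l" for l using sym[of l] h2[of "N + a - l"] by simp
  have sym'': "h1 (N + a - l) = h2 l" for l using sym[of "l - a"] h2[of l] by (simp add: algebra_simps)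
  have "hV ?L x \<le> hU ?L (flip ?L x) \<and>
        hU ?L (invI ?L x) = hU ?L x \<and> invI ?L (invI ?L x) = x \<and>
        hU ?L (invJ ?L x) = hV ?L x \<and> hV ?L (invJ ?L x) = hU ?L x \<and> invJ ?L (invJ ?L x) = x \<and>
        invJ ?L x = invI ?L (flip ?L x)" if "x \<in> polyhedron (line_simplexes UNIV)" for x
  proof -
    obtain r where x: "x = tent r" using tent \<open>x \<in> _\<close> by blast
    have fl: "\<lfloor>of_int k - r\<rfloor> = k - \<lceil>r\<rceil>" "\<lceil>of_int k - r\<rceil> = k - \<lfloor>r\<rfloor>" for k
      by linarith+
    have fl': "\<lfloor>r - of_int a\<rfloor> = \<lfloor>r\<rfloor> - a" "\<lceil>r - of_int a\<rceil> = \<lceil>r\<rceil> - a" by linarith+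
    show ?thesis
      unfolding x filtered_line_simps(2-6) pushforward_tent_shift pushforward_tent_reflect support_tent fl fl'
      by (auto simp: sym sym' sym'' h2[symmetric] insert_commute algebra_simps)
  qed
  then show ?thesis
    unfolding is_knot_space_def filtered_line_simps(1,4-6) topspace_weak_topology
    using c1 c2[of N] c2[of "N + a"] by blast
qed

section \<open>The deformation\<close>

context star_plumbing
begin

text \<open>This is \<open>2 * \<tau>\<close>: the minimum of \<open>energy\<close> over the lattice
  points with central coefficient \<open>l\<close>.\<close>

definition min_energy :: "int \<Rightarrow> int" where
  "min_energy l = - e0 * l * (l - 1) + 2 * l + (\<Sum>i\<in>{1..m}. leg_min (b i) l)"

lemma min_energy_0: "min_energy 0 = 0"
  by (simp add: min_energy_def leg_min_0)

lemma min_energy_step: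
  "min_energy (l + 1) = min_energy l +
     2 * (1 - e0 * l - (\<Sum>i\<in>{1..m}. \<lceil>of_int (l * q i) / (of_int (p i) :: real)\<rceil>))"
proof -
  have "(\<Sum>i\<in>{1..m}. leg_min (b i) (l + 1)) =
      (\<Sum>i\<in>{1..m}. leg_min (b i) l - 2 * \<lceil>of_int (l * q i) / (of_int (p i) :: real)\<rceil>)"
    by (intro sum.cong refl) (simp add: leg_min_step[OF legs_ge] leg_ratio_q_p)
  then show ?thesis
    unfolding min_energy_def by (simp add: sum_subtractf sum_distrib_left algebra_simps)
qed

lemma min_energy_le: "min_energy (z Center) \<le> energy z"
  unfolding min_energy_def energy_G using leg_min_le[OF legs_ge] by (intro add_mono sum_mono) auto

text \<open>Without the ceilings, the sum of \<open>l * q i / p i\<close> is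
  \<open>- l / \<alpha> - e0 * l\<close> by the equation for \<open>e0\<close>. Rounding up only
  increases it, so for \<open>l < 0\<close> the integer \<open>e0 * l\<close> plus the sum of the
  ceilings is positive, hence at least 1.\<close>

lemma min_energy_decreasing:
  assumes "l < 0"
  shows "min_energy (l + 1) \<le> min_energy l"
proof -
  have \<alpha>: "0 < real_of_int \<alpha>" using \<alpha>_pos by simp
  have "real_of_int (q i) / of_int (p i) = of_int (q i * cofactor i) / of_int \<alpha>" if i: "i \<in> {1..m}" for i
  proof -
    have "cofactor i \<noteq> 0" using \<alpha>_pos \<alpha>_cofactor[OF i] by auto
    then show ?thesis unfolding \<alpha>_cofactor[OF i] by simp
  qed
  then have "(\<Sum>i\<in>{1..m}. real_of_int (l * q i) / of_int (p i)) =
      (\<Sum>i\<in>{1..m}. of_int l * (of_int (q i * cofactor i) / of_int \<alpha>))"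
    by (intro sum.cong refl) (metis of_int_mult times_divide_eq_right)
  also have "\<dots> = of_int l * (of_int (\<Sum>i\<in>{1..m}. q i * cofactor i) / of_int \<alpha>)"
    by (simp add: sum_distrib_left sum_divide_distrib)
  also have "(\<Sum>i\<in>{1..m}. q i * cofactor i) = - 1 - e0 * \<alpha>" using e0_\<alpha> by simp
  also have "of_int l * (of_int (- 1 - e0 * \<alpha>) / real_of_int \<alpha>) = - of_int l / of_int \<alpha> - of_int (e0 * l)"
    using \<alpha> by (simp add: field_simps)
  finally have s: "(\<Sum>i\<in>{1..m}. real_of_int (l * q i) / of_int (p i)) = - of_int l / of_int \<alpha> - of_int (e0 * l)" .
  have "(\<Sum>i\<in>{1..m}. real_of_int (l * q i) / of_int (p i)) \<le>
      (\<Sum>i\<in>{1..m}. of_int \<lceil>of_int (l * q i) / (of_int (p i) :: real)\<rceil>)"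
    by (intro sum_mono) (rule le_of_int_ceiling)
  moreover have "0 < - real_of_int l / of_int \<alpha>" using assms \<alpha> by (simp add: divide_neg_pos)
  ultimately have "0 < real_of_int (e0 * l + (\<Sum>i\<in>{1..m}. \<lceil>of_int (l * q i) / (of_int (p i) :: real)\<rceil>))"
    unfolding s by simp
  then have "0 < e0 * l + (\<Sum>i\<in>{1..m}. \<lceil>of_int (l * q i) / (of_int (p i) :: real)\<rceil>)"
    by (simp only: of_int_0_less_iff)
  then show ?thesis unfolding min_energy_step by simp
qed

text \<open>A common bound for the lengths of the legs, so that all legs run on one clock.\<close>

definition leg_bound :: real where
  "leg_bound = (\<Sum>i\<in>{1..m}. real (length (b i)))"

lemma length_le_leg_bound: "i \<in> {1..m} \<Longrightarrow> real (length (b i)) \<le> leg_bound"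
  unfolding leg_bound_def by (rule member_le_sum) auto

text \<open>The coefficient in position \<open>j\<close> moves while
  \<open>leg_bound * (1 - t)\<close> falls from \<open>j + 1\<close> to \<open>j\<close>. These time
  windows follow one another from the far end inwards, and at \<open>t = 0\<close> none has begun
  for positions below \<open>leg_bound\<close>.\<close>

definition blend :: "real \<Rightarrow> nat \<Rightarrow> real" where
  "blend t j = max 0 (min 1 (real j + 1 - leg_bound * (1 - t)))"

text \<open>As \<open>t\<close> runs from 0 to 1, the coefficients on all legs are moved to their optimal values, those
  furthest from the center first.\<close>

definition stage :: "real \<Rightarrow> (star_vertex \<Rightarrow> real) \<Rightarrow> star_vertex \<Rightarrow> real" where
  "stage t y v = (if v \<in> verts G then case v of Center \<Rightarrow> delay (y Center)
     | Leg i j \<Rightarrow> delay (leg_path (b i) (blend t) (\<lambda>j. y (Leg i j)) (y Center) j) else 0)"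

lemma stage_0: "v \<in> verts G \<Longrightarrow> stage 0 y v = delay (y v)"
proof (cases v)
  case (Leg i j)
  assume "v \<in> verts G"
  then have ij: "i \<in> {1..m}" "j < length (b i)" by (auto simp: Leg verts_G)
  have "blend 0 k = 0" if "k \<le> j" for k
    using that ij length_le_leg_bound[OF ij(1)] by (auto simp: blend_def)
  then have "leg_path (b i) (blend 0) (\<lambda>j. y (Leg i j)) (y Center) j = y (Leg i j)"
    by (rule leg_path_0)
  then show ?thesis using \<open>v \<in> verts G\<close> by (simp add: stage_def Leg)
qed (simp add: stage_def)

lemma stage_0_eq: "stage 0 y = (\<lambda>v. if v \<in> verts G then delay (y v) else 0)"
proof
  fix v show "stage 0 y v = (if v \<in> verts G then delay (y v) else 0)"
    by (cases "v \<in> verts G") (simp add: stage_0, simp add: stage_def)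
qed

lemma blend_1: "blend 1 k = 1"
  by (simp add: blend_def)

lemma stage_1: "y Center = y' Center \<Longrightarrow> stage 1 y = stage 1 y'"
  by (rule ext) (auto simp: stage_def intro!: leg_path_1 blend_1 arg_cong[of _ _ delay] split: star_vertex.split)

lemma roundings_G:
  assumes "z \<in> roundings (verts G) y"
  shows "z \<in> lattice" "z Center \<in> near (y Center)"
    and "i \<in> {1..m} \<Longrightarrow> j < length (b i) \<Longrightarrow> z (Leg i j) \<in> near (y (Leg i j))"
proof -
  have r: "if v \<in> verts G then z v \<in> near (y v) else z v = 0" for v
    using assms[unfolded roundings_def mem_Collect_eq, THEN spec] .
  have "z v = 0" if "v \<notin> verts G" for v using r[of v] that by simp
  then show "z \<in> lattice" by (simp add: lattice_def)
  show "z Center \<in> near (y Center)" using r[of Center] by (simp add: verts_G)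
  show "i \<in> {1..m} \<Longrightarrow> j < length (b i) \<Longrightarrow> z (Leg i j) \<in> near (y (Leg i j))"
    using r[of "Leg i j"] by (simp add: verts_G)
qed

lemma roundings_stage:
  assumes "z \<in> roundings (verts G) (stage t y)"
  shows "z Center \<in> near (delay (y Center))"
    and "i \<in> {1..m} \<Longrightarrow> j < length (b i) \<Longrightarrow>
      z (Leg i j) \<in> near (delay (leg_path (b i) (blend t) (\<lambda>j. y (Leg i j)) (y Center) j))"
  using roundings_G(2,3)[OF assms] by (simp_all add: stage_def verts_G)

text \<open>The legs interact only through the central coefficient, which \<open>z'\<close> inherits
  from \<open>z\<close>, so the descent is applied to each leg separately.\<close>

lemma stage_energy:
  assumes t: "0 \<le> t" "t \<le> 1" and z: "z \<in> roundings (verts G) (stage t y)"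
  shows "\<exists>z'\<in>roundings (verts G) y. z' Center = z Center \<and> energy z \<le> energy z'"
proof -
  have bl: "0 \<le> blend t k \<and> blend t k \<le> 1" "0 < blend t k \<Longrightarrow> blend t (Suc k) = 1" for k
    by (auto simp: blend_def)
  have "\<exists>w. (\<forall>j. w j \<in> near (y (Leg i j))) \<and>
      leg_energy (b i) (z Center) (\<lambda>j. z (Leg i j)) \<le> leg_energy (b i) (z Center) w" if "i \<in> {1..m}" for i
    by (rule leg_path_descent[OF legs_ge[OF that] bl roundings_stage(1)[OF z] roundings_stage(2)[OF z that]])
  then obtain w where w: "\<And>i j. i \<in> {1..m} \<Longrightarrow> w i j \<in> near (y (Leg i j))"
    "\<And>i. i \<in> {1..m} \<Longrightarrow> leg_energy (b i) (z Center) (\<lambda>j. z (Leg i j)) \<le> leg_energy (b i) (z Center) (w i)"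
    by metis
  define z' where "z' v = (if v \<in> verts G then case v of Center \<Rightarrow> z Center | Leg i j \<Rightarrow> w i j else 0)" for v
  have C: "z' Center = z Center" by (simp add: z'_def verts_G)
  have "z Center \<in> near (y Center)" by (rule delay_rounding[OF roundings_stage(1)[OF z]])
  then have "z' \<in> roundings (verts G) y"
    unfolding roundings_def mem_Collect_eq
  proof (intro allI)
    fix v show "if v \<in> verts G then z' v \<in> near (y v) else z' v = 0"
      using w(1) \<open>z Center \<in> _\<close> by (cases v) (auto simp: z'_def verts_G)
  qed
  moreover have "leg_energy (b i) (z' Center) (\<lambda>j. z' (Leg i j)) = leg_energy (b i) (z Center) (w i)"
    if "i \<in> {1..m}" for i
    unfolding C using that by (intro leg_energy_cong) (simp add: z'_def verts_G)
  then have "energy z \<le> energy z'"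
    unfolding energy_G C using w(2) by (intro add_mono sum_mono) auto
  ultimately show ?thesis using C by blast
qed

lemma stage_1_energy:
  assumes z: "z \<in> roundings (verts G) (stage 1 y)"
  shows "energy z = min_energy (z Center)"
proof -
  have "leg_energy (b i) (z Center) (\<lambda>j. z (Leg i j)) = leg_min (b i) (z Center)" if "i \<in> {1..m}" for i
    by (rule leg_path_energy_1[OF legs_ge[OF that] blend_1 roundings_stage(1)[OF z] roundings_stage(2)[OF z that]])
  then show ?thesis unfolding energy_G min_energy_def by simp
qed

text \<open>The homotopy inverse of the central coordinate. By \<open>stage_1\<close> the final
  stage depends on the central coordinate only, and the zeros are placeholders.\<close>

definition path :: "real \<Rightarrow> star_vertex \<Rightarrow> real" where
  "path r = stage 1 (\<lambda>v. if v = Center then r else 0)"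

lemma stage_1_path: "stage 1 y = path (y Center)"
  unfolding path_def by (rule stage_1) simp

lemma continuous_on_stage:
  assumes "continuous_on S t" "\<And>v. continuous_on S (\<lambda>s. y s v)"
  shows "continuous_on S (\<lambda>s. stage (t s) (y s))"
proof (rule continuous_on_coordinatewise_then_product)
  have bl: "continuous_on S (\<lambda>s. blend (t s) j)" for j
    unfolding blend_def using assms(1) by (intro continuous_intros)
  have "continuous_on S (\<lambda>s. leg_path (b i) (blend (t s)) (\<lambda>j. y s (Leg i j)) (y s Center) j)" for i j
    by (rule continuous_on_leg_path[OF bl assms(2) assms(2)])
  then have L: "continuous_on S (\<lambda>s. delay (leg_path (b i) (blend (t s)) (\<lambda>j. y s (Leg i j)) (y s Center) j))" for i j
    by (intro continuous_on_compose2[OF continuous_on_delay]) auto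
  have C: "continuous_on S (\<lambda>s. delay (y s Center))"
    by (intro continuous_on_compose2[OF continuous_on_delay] assms(2)) auto
  show "continuous_on S (\<lambda>s. stage (t s) (y s) v)" for v
  proof (cases "v \<in> verts G")
    case True
    then show ?thesis using C L by (cases v) (simp_all add: stage_def)
  qed (simp add: stage_def)
qed

definition line_height :: "int \<Rightarrow> real" where
  "line_height l = (square G (K_con G) + real (card (verts G))) / 4 - of_int (min_energy l)"

lemma ptU_le: "z \<in> lattice \<Longrightarrow> ptU z \<le> line_height (z Center)"
  using min_energy_le[of z] by (simp add: ptU_energy line_height_def)

lemma ptU_path: "z \<in> roundings (verts G) (path r) \<Longrightarrow> ptU z = line_height (z Center)"
  using stage_1_energy roundings_G(1) by (simp add: ptU_energy line_height_def path_def)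

lemma path_Center: "z \<in> roundings (verts G) (path r) \<Longrightarrow> z Center \<in> near r"
  unfolding path_def by (drule roundings_stage(1)) (rule delay_rounding, simp)

lemma line_height_attained: "\<exists>z\<in>lattice. z Center = l \<and> ptU z = line_height l"
proof -
  obtain z where z: "z \<in> roundings (verts G) (path (of_int l))" using roundings_nonempty by blast
  then have "z Center = l" using path_Center[OF z] by simp
  then show ?thesis using ptU_path[OF z] roundings_G(1)[OF z] by blast
qed

lemma ptV_le: "z \<in> lattice \<Longrightarrow> ptV z \<le> line_height (z Center - \<alpha>)"
  unfolding ptV_def using ptU_le[of "\<lambda>v. z v + disk_dual v"] disk_dual(1) disk_dual_Center by simp

text \<open>On the slice of \<open>z\<close> the value \<open>ptU z\<close> is maximal, and on a
  slice \<open>ptV\<close> is ordered as \<open>ptU\<close>, so \<open>ptV z\<close> is maximal too.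
  Translation by \<open>disk_dual\<close> identifies that maximum with \<open>line_height\<close> on
  the slice shifted by \<open>- \<alpha>\<close>.\<close>

lemma ptV_path:
  assumes z: "z \<in> roundings (verts G) (path r)"
  shows "ptV z = line_height (z Center - \<alpha>)"
proof (rule antisym)
  show "ptV z \<le> line_height (z Center - \<alpha>)" by (rule ptV_le[OF roundings_G(1)[OF z]])
  obtain w where w: "w \<in> lattice" "w Center = z Center - \<alpha>" "ptU w = line_height (z Center - \<alpha>)"
    using line_height_attained by blast
  let ?w = "\<lambda>v. w v - disk_dual v"
  have l: "?w \<in> lattice" "?w Center = z Center" using w disk_dual(1) disk_dual_Center by simp_all
  have "ptU ?w \<le> ptU z" using ptU_le[OF l(1)] l(2) ptU_path[OF z] by simp
  then have "ptV ?w \<le> ptV z" using ptV_mono[OF l(1) roundings_G(1)[OF z]] l(2) base_G by simp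
  then show "line_height (z Center - \<alpha>) \<le> ptV z" using w(3) by (simp add: ptV_def)
qed

text \<open>\<open>line_height l\<close> is the maximum of \<open>ptU\<close> over a slice, and the
  reflection \<open>z \<mapsto> - z - con_dual\<close> preserves \<open>ptU\<close> and exchanges
  slices. The reverse inequality is the same one at the reflected point.\<close>

lemma line_height_sym: "line_height (- con_dual Center - l) = line_height l"
proof -
  have "line_height l \<le> line_height (- con_dual Center - l)" for l
  proof -
    obtain z where z: "z \<in> lattice" "z Center = l" "ptU z = line_height l" using line_height_attained by blast
    have "(\<lambda>v. - z v - con_dual v) \<in> lattice" using z(1) con_dual(1) by simp
    from ptU_le[OF this] have "line_height l \<le> line_height (- z Center - con_dual Center)"
      unfolding ptU_reflect z(3) .
    moreover have "- z Center - con_dual Center = - con_dual Center - l" using z(2) by simp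
    ultimately show ?thesis by (simp only:)
  qed
  from this[of l] this[of "- con_dual Center - l"] show ?thesis by simp
qed

abbreviation line :: "real df_space" where
  "line \<equiv> line_space UNIV line_height (\<lambda>l. line_height (l - \<alpha>))"

abbreviation cube :: "(star_vertex \<Rightarrow> real) df_space" where
  "cube \<equiv> cube_space (verts G) ptU ptV"

text \<open>Every integer next to \<open>y Center\<close> is the central coordinate of a corner of
  the cube, and the heights of corners are bounded by those of the line.\<close>

lemma df_map_Center: "df_map cube line (\<lambda>y. y Center)"
proof -
  have "\<exists>z\<in>roundings (verts G) y. z Center = l" if "l \<in> near (y Center)" for y l
    using that by (intro bexI[of _ "\<lambda>v. if v = Center then l else if v \<in> verts G then \<lfloor>y v\<rfloor> else 0"])
      (auto simp: roundings_def verts_G)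
  then have "\<exists>z\<in>roundings (verts G) y. ptU z \<le> line_height l"
    "\<exists>z\<in>roundings (verts G) y. ptV z \<le> line_height (l - \<alpha>)"
    if "l \<in> near (y Center)" for y l
    using that ptU_le ptV_le roundings_G(1) by metis+
  then have "Min (ptU ` roundings (verts G) y) \<le> line_height l"
    "Min (ptV ` roundings (verts G) y) \<le> line_height (l - \<alpha>)"
    if "l \<in> near (y Center)" for y l
    using that finite_roundings[OF finite_verts_G] by (meson Min_le finite_imageI image_eqI order_trans)+
  moreover have "continuous_on plane (\<lambda>y. y Center)"
    by (rule continuous_on_subset[OF continuous_on_product_coordinates]) simp
  ultimately show ?thesis
    unfolding df_map_def doubly_filtered_def height_le_def by (simp add: cube_space_def line_space_def)
qed

lemma df_map_path: "df_map line cube path"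
proof -
  have "min (line_height \<lfloor>r\<rfloor>) (line_height \<lceil>r\<rceil>) \<le> ptU z"
    "min (line_height (\<lfloor>r\<rfloor> - \<alpha>)) (line_height (\<lceil>r\<rceil> - \<alpha>)) \<le> ptV z"
    if "z \<in> roundings (verts G) (path r)" for z r
    using path_Center[OF that] ptU_path[OF that] ptV_path[OF that] by auto
  moreover have "continuous_on UNIV (\<lambda>r. if v = Center then r else (0::real))" for v
    by (cases "v = Center") (auto intro!: continuous_intros)
  then have "continuous_on UNIV path"
    unfolding path_def by (intro continuous_on_stage continuous_intros)
  ultimately show ?thesis
    unfolding df_map_def doubly_filtered_def height_le_def
    using finite_roundings[OF finite_verts_G] roundings_nonempty[of "verts G"]
    by (simp add: cube_space_def line_space_def continuous_map_in_subtopology path_def stage_def)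
qed

lemma doubly_filtered_cube:
  assumes "\<And>y z. z \<in> roundings (verts G) (f y) \<Longrightarrow>
    \<exists>z'\<in>roundings (verts G) y. z' Center = z Center \<and> energy z \<le> energy z'"
  shows "doubly_filtered cube cube f"
proof -
  have "\<exists>z'\<in>roundings (verts G) y. ptU z' \<le> ptU z" "\<exists>z'\<in>roundings (verts G) y. ptV z' \<le> ptV z"
    if z: "z \<in> roundings (verts G) (f y)" for y z
  proof -
    obtain z' where z': "z' \<in> roundings (verts G) y" "z' Center = z Center" "energy z \<le> energy z'"
      using assms[OF z] by blast
    note l = roundings_G(1)[OF z] roundings_G(1)[OF z'(1)]
    have "ptU z' \<le> ptU z" using z'(3) l by (simp add: ptU_energy)
    moreover have "ptV z' \<le> ptV z" using ptV_mono[OF l(2,1)] z'(2) base_G calculation by simp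
    ultimately show "\<exists>z'\<in>roundings (verts G) y. ptU z' \<le> ptU z" "\<exists>z'\<in>roundings (verts G) y. ptV z' \<le> ptV z"
      using z'(1) by blast+
  qed
  then show ?thesis
    unfolding doubly_filtered_def height_le_def
    by (auto simp: cube_space_def intro!: Min_roundings_le[OF finite_verts_G])
qed

text \<open>The motion stays within the closed cube of each point, so the set of corners can only
  shrink.\<close>

lemma df_homotopic_delay: "df_homotopic cube cube id (stage 0)"
proof (rule df_homotopicI[where h = "\<lambda>t y v. if v \<in> verts G then (1 - t) * y v + t * delay (y v) else 0"])
  let ?h = "\<lambda>p v. if v \<in> verts G then (1 - fst p) * snd p v + fst p * delay (snd p v) else (0::real)"
  have c: "continuous_on S (\<lambda>p. snd p v)" for S :: "(real \<times> (star_vertex \<Rightarrow> real)) set" and v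
    by (rule continuous_on_product_then_coordinatewise[OF continuous_on_snd[OF continuous_on_id]])
  have "continuous_on ({0..1} \<times> plane) (\<lambda>p. ?h p v)" for v
    by (cases "v \<in> verts G") (auto intro!: continuous_intros c continuous_on_compose2[OF continuous_on_delay])
  then have "continuous_on ({0..1} \<times> plane) ?h" by (rule continuous_on_coordinatewise_then_product)
  then show "continuous_map (prod_topology (top_of_set {0..1}) (space_of cube)) (space_of cube) ?h"
    by (simp add: cube_space_def continuous_map_in_subtopology)
next
  fix t :: real assume t: "0 \<le> t" "t \<le> 1"
  show "doubly_filtered cube cube (\<lambda>y v. if v \<in> verts G then (1 - t) * y v + t * delay (y v) else 0)"
  proof (rule doubly_filtered_cube)
    fix y z
    assume z: "z \<in> roundings (verts G) (\<lambda>v. if v \<in> verts G then (1 - t) * y v + t * delay (y v) else 0)"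
    have "z \<in> roundings (verts G) y"
      unfolding roundings_def mem_Collect_eq
    proof
      fix v show "if v \<in> verts G then z v \<in> near (y v) else z v = 0"
        using z[unfolded roundings_def mem_Collect_eq, THEN spec, of v] delay_segment_rounding[OF t, of "z v" "y v"]
        by (simp split: if_splits)
    qed
    then show "\<exists>z'\<in>roundings (verts G) y. z' Center = z Center \<and> energy z \<le> energy z'" by blast
  qed
qed (auto simp: cube_space_def stage_0_eq fun_eq_iff)

lemma df_homotopic_stage: "df_homotopic cube cube (stage 0) (stage 1)"
proof (rule df_homotopicI[where h = stage])
  have c: "continuous_on S (\<lambda>p. snd p v)" for S :: "(real \<times> (star_vertex \<Rightarrow> real)) set" and v
    by (rule continuous_on_product_then_coordinatewise[OF continuous_on_snd[OF continuous_on_id]])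
  have "continuous_on ({0..1} \<times> plane) (\<lambda>p. stage (fst p) (snd p))"
    by (intro continuous_on_stage c continuous_intros)
  then show "continuous_map (prod_topology (top_of_set {0..1}) (space_of cube)) (space_of cube) (\<lambda>p. stage (fst p) (snd p))"
    by (simp add: cube_space_def continuous_map_in_subtopology stage_def)
next
  fix t :: real assume t: "0 \<le> t" "t \<le> 1"
  show "doubly_filtered cube cube (stage t)"
    by (rule doubly_filtered_cube[OF stage_energy[OF t]])
qed auto

text \<open>The central coordinate of \<open>path r\<close> is \<open>delay r\<close> and not
  \<open>r\<close>, so this composite is only homotopic to the identity.\<close>

lemma df_homotopic_line: "df_homotopic line line id ((\<lambda>y. y Center) \<circ> path)"
proof (rule df_homotopicI[where h = "\<lambda>t r. (1 - t) * r + t * delay r"])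
  have "continuous_on ({0..1} \<times> UNIV) (\<lambda>p::real\<times>real. (1 - fst p) * snd p + fst p * delay (snd p))"
    by (intro continuous_intros continuous_on_compose2[OF continuous_on_delay]) auto
  then show "continuous_map (prod_topology (top_of_set {0..1}) (space_of line)) (space_of line)
      (\<lambda>p. (1 - fst p) * snd p + fst p * delay (snd p))"
    using prod_topology_subtopology_eu[of "{0..1::real}" "UNIV::real set"] by (simp add: line_space_def)
next
  fix t :: real assume t: "0 \<le> t" "t \<le> 1"
  have "min (h \<lfloor>r\<rfloor>) (h \<lceil>r\<rceil>) \<le> min (h \<lfloor>(1 - t) * r + t * delay r\<rfloor>) (h \<lceil>(1 - t) * r + t * delay r\<rceil>)"
    for h :: "int \<Rightarrow> real" and r
    by (rule min_rounding_le) (use delay_segment_rounding[OF t] in blast)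
  from this[of line_height] this[of "\<lambda>l. line_height (l - \<alpha>)"]
  show "doubly_filtered line line (\<lambda>r. (1 - t) * r + t * delay r)"
    unfolding doubly_filtered_def height_le_def by (simp add: line_space_def)
qed (auto simp: line_space_def path_def stage_def verts_G)

lemma df_homotopy_equivalence_Center: "df_homotopy_equivalence cube line (\<lambda>y. y Center)"
  unfolding df_homotopy_equivalence_def
proof (intro conjI exI[of _ path] df_map_Center df_map_path)
  have "path \<circ> (\<lambda>y. y Center) = stage 1" by (rule ext) (simp add: stage_1_path)
  then show "df_homotopic cube cube (path \<circ> (\<lambda>y. y Center)) id"
    using df_homotopic_sym[OF df_homotopic_trans[OF df_homotopic_delay df_homotopic_stage]] by simp
  show "df_homotopic line line ((\<lambda>y. y Center) \<circ> path) id"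
    by (rule df_homotopic_sym[OF df_homotopic_line])
qed

end

section \<open>From strict equivariance to equivalence of knot spaces\<close>

lemma coherently_equivariantI:
  assumes "continuous_map X Y f" "P f" "\<And>x. x \<in> topspace X \<Longrightarrow> f (a x) = b (f x)"
  shows "coherently_equivariant P X a Y b f"
  unfolding coherently_equivariant_def
\<comment> \<open>All coherence homotopies are constant: the map ignores the point of the
  sphere.\<close>
proof (intro exI[of _ "\<lambda>p. f (snd p)"] conjI allI ballI)
  show "continuous_map (prod_topology (nsphere n) X) Y (\<lambda>p. f (snd p))" for n
    using continuous_map_compose[OF continuous_map_snd assms(1)] by (simp add: o_def)
qed (use assms in auto)

lemma knot_space_equivalentI:
  assumes X: "is_knot_space X" and Y: "is_knot_space Y" and f: "df_homotopy_equivalence X Y f"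
    and flip: "\<And>x. x \<in> topspace (space_of X) \<Longrightarrow> f (flip X x) = flip Y (f x)"
    and I: "\<And>x. x \<in> topspace (space_of X) \<Longrightarrow> f (invI X x) = invI Y (f x)"
    and J: "\<And>x. x \<in> topspace (space_of X) \<Longrightarrow> f (invJ X x) = invJ Y (f x)"
  shows "knot_space_equivalent X Y"
proof -
  have cf: "continuous_map (space_of X) (space_of Y) f" and df: "doubly_filtered X Y f"
    using f by (auto simp: df_homotopy_equivalence_def df_map_def)
  have flX: "continuous_map (space_of X) (space_of X) (flip X)"
    and fl: "\<And>x. x \<in> topspace (space_of X) \<Longrightarrow> hV X x \<le> hU X (flip X x)"
    using X by (auto simp: is_knot_space_def)
  have "flip X x \<in> topspace (space_of X)" if "x \<in> topspace (space_of X)" for x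
    using flX that by (auto simp: continuous_map_def)
  then have h: "height_le (space_of X) (hV X) (hU Y) (f \<circ> flip X)"
    using df fl unfolding doubly_filtered_def height_le_def by (metis comp_apply order_trans)
  have "homotopic_with (height_le (space_of X) (hV X) (hU Y)) (space_of X) (space_of Y) (f \<circ> flip X) (flip Y \<circ> f)"
  proof (rule homotopic_with_equal)
    show "height_le (space_of X) (hV X) (hU Y) (flip Y \<circ> f)"
      using h flip unfolding height_le_def by simp
  qed (use h flip in \<open>auto intro: continuous_map_compose[OF flX cf]\<close>)
  moreover have "coherently_equivariant (height_le (space_of X) (hU X) (hU Y)) (space_of X) (invI X) (space_of Y) (invI Y) f"
    using cf df I by (intro coherently_equivariantI) (auto simp: doubly_filtered_def)
  moreover have "coherently_equivariant (doubly_filtered X Y) (space_of X) (invJ X) (space_of Y) (invJ Y) f"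
    using cf df J by (intro coherently_equivariantI) auto
  ultimately show ?thesis
    unfolding knot_space_equivalent_def using X Y f by blast
qed

context star_plumbing
begin

lemma df_homotopy_equivalence_CFK_line:
  "df_homotopy_equivalence (CFK G T) line ((\<lambda>y. y Center) \<circ> position)"
  by (rule df_homotopy_equivalence_compose[OF df_homotopy_equivalence_position df_homotopy_equivalence_Center])

lemma knot_space_equivalent_CFK_line:
  fixes N :: int
  assumes N: "con_dual Center = - N"
  shows "knot_space_equivalent (CFK G T)
    (filtered_line line_height (\<lambda>l. line_height (l - \<alpha>)) (\<lambda>l. l - \<alpha>) (\<lambda>l. N - l) (\<lambda>l. N + \<alpha> - l))"
    (is "knot_space_equivalent _ ?L")
proof (rule knot_space_equivalentI[where f = "tent \<circ> ((\<lambda>y. y Center) \<circ> position)"])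
  show "is_knot_space (CFK G T)" by (rule is_knot_space_CFK)
  show "is_knot_space ?L"
    using line_height_sym N by (intro is_knot_space_line) simp_all
  have eq: "df_homotopy_equivalence (CFK G T) (realization (line_complex UNIV line_height (\<lambda>l. line_height (l - \<alpha>))))
      (tent \<circ> ((\<lambda>y. y Center) \<circ> position))"
    by (rule df_homotopy_equivalence_compose[OF df_homotopy_equivalence_CFK_line line_complex_df_equivalence])
  show "df_homotopy_equivalence (CFK G T) ?L (tent \<circ> ((\<lambda>y. y Center) \<circ> position))"
    using eq unfolding df_homotopy_equivalence_def df_map_def df_homotopic_def doubly_filtered_def[abs_def]
    by (simp add: filtered_line_def df_space.defs realization_def)
next
  fix x assume "x \<in> topspace (space_of (CFK G T))"
  then have x: "x \<in> polyhedron nerve" by (simp add: CFK_simps)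
  let ?f = "tent \<circ> ((\<lambda>y. y Center) \<circ> position)"
  show "?f (flip (CFK G T) x) = flip ?L (?f x)"
    by (simp add: CFK_simps filtered_line_simps(2-6) position_flip(2)[OF x] disk_dual_Center pushforward_tent_shift)
  show "?f (invI (CFK G T) x) = invI ?L (?f x)"
    by (simp add: CFK_simps filtered_line_simps(2-6) position_invI(2)[OF x] N pushforward_tent_reflect)
  show "?f (invJ (CFK G T) x) = invJ ?L (?f x)"
    using pushforward_tent_reflect[of "N + \<alpha>" "position x Center"]
    by (simp add: CFK_simps filtered_line_simps(2-6) position_invJ(2)[OF x] N disk_dual_Center algebra_simps)
qed

text \<open>The first height is monotone below 0, and by the symmetry about \<open>N / 2\<close>
  also above \<open>N\<close>; the second is its shift by \<open>\<alpha>\<close>. Both are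
  therefore monotone below 0 and above \<open>N + \<alpha>\<close>, and the line retracts to the
  segment between.\<close>

lemma df_homotopy_equivalent_CFK_segment:
  fixes N :: int
  assumes N: "con_dual Center = - N" and pos: "0 < N"
  shows "df_homotopy_equivalent (CFK G T) (filtered_segment 0 (N + \<alpha>) line_height (\<lambda>l. line_height (l - \<alpha>)))"
proof -
  have up: "line_height l \<le> line_height (l + 1)" if "l < 0" for l
    using min_energy_decreasing[OF that] by (simp add: line_height_def)
  have down: "line_height (l + 1) \<le> line_height l" if "N \<le> l" for l
  proof -
    have "line_height (l + 1) = line_height (N - l - 1)" "line_height l = line_height (N - l - 1 + 1)"
      using line_height_sym[of "l + 1"] line_height_sym[of l] N by (simp_all add: algebra_simps)
    then show ?thesis using up[of "N - l - 1"] that by simp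
  qed
  have shift: "line_height (l + 1 - \<alpha>) = line_height (l - \<alpha> + 1)" for l
    by (simp add: algebra_simps)
  have "df_homotopy_equivalence line (line_space {0..N + \<alpha>} line_height (\<lambda>l. line_height (l - \<alpha>)))
      (\<lambda>y. max (of_int 0) (min (of_int (N + \<alpha>)) y))"
    using pos \<alpha>_pos up down
    by (intro line_space_retract mono_on_int_step antimono_on_int_step) (auto simp: shift)
  then have "df_homotopy_equivalence (CFK G T)
      (realization (line_complex {0..N + \<alpha>} line_height (\<lambda>l. line_height (l - \<alpha>))))
      (tent \<circ> ((\<lambda>y. max (of_int 0) (min (of_int (N + \<alpha>)) y)) \<circ> ((\<lambda>y. y Center) \<circ> position)))"
    by (intro df_homotopy_equivalence_compose[OF _ line_complex_df_equivalence]
        df_homotopy_equivalence_compose[OF df_homotopy_equivalence_CFK_line])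
  then show ?thesis unfolding df_homotopy_equivalent_def filtered_segment_def by blast
qed

end

theorem corollary8p10:
  fixes m :: nat
    and p q :: "nat \<Rightarrow> int"
    and b :: "nat \<Rightarrow> int list"
    and e0 \<alpha> \<gamma> :: int
    and \<tau> :: "int \<Rightarrow> int"
    and h1 h2 :: "int \<Rightarrow> real"
    and H :: "star_vertex plumbing"
    and t :: "(star_vertex \<Rightarrow> int) set"
  assumes m: "m \<ge> 2"
    and p: "\<forall>i\<in>{1..m}. p i \<ge> 2"
    and coprime: "pairwise (\<lambda>i j. coprime (p i) (p j)) {1..m}"
    and q: "\<forall>i\<in>{1..m}. 1 \<le> q i \<and> q i \<le> p i - 1"
    and e0: "e0 * (\<Prod>i\<in>{1..m}. p i) + (\<Sum>i\<in>{1..m}. q i * (\<Prod>j\<in>{1..m} - {i}. p j)) = - 1"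
    and legs: "\<forall>i\<in>{1..m}. b i \<noteq> [] \<and> (\<forall>c\<in>set (b i). c \<ge> 2) \<and>
                 neg_cont_frac (b i) = of_int (p i) / of_int (q i)"
    and H: "H = star_graph m e0 b"
    and t: "t \<in> spinc H"
    and \<alpha>: "\<alpha> = (\<Prod>i\<in>{1..m}. p i)"
    and \<gamma>: "real_of_int \<gamma> =
               real_of_int \<alpha> * (real m - 2 - (\<Sum>i\<in>{1..m}. 1 / real_of_int (p i)))"
    and \<tau>0: "\<tau> 0 = 0"
    and \<tau>_step: "\<forall>l. \<tau> (l + 1) - \<tau> l =
               1 - e0 * l - (\<Sum>i\<in>{1..m}. \<lceil>real_of_int (l * q i) / real_of_int (p i)\<rceil>)"
    and h1: "\<forall>l. h1 l = (square H (K_con H) + real (card (verts H))) / 4 - 2 * real_of_int (\<tau> l)"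
    and h2: "\<forall>l. h2 l = h1 (l - \<alpha>)"
  shows "knot_space_equivalent (CFK H t)
           (filtered_line h1 h2 (\<lambda>l. l - \<alpha>) (\<lambda>l. 1 + \<gamma> - l) (\<lambda>l. 1 + \<gamma> + \<alpha> - l)) \<and>
         (1 + \<gamma> > 0 \<longrightarrow>
           df_homotopy_equivalent (CFK H t) (filtered_segment 0 (1 + \<gamma> + \<alpha>) h1 h2))"
proof -
  interpret S: star_plumbing m p q b e0
    using p q e0 legs by unfold_locales auto
  have H: "H = S.G" by (simp add: H S.G_def)
  have t: "t = S.T" using S.spinc_eq t unfolding H by blast
  have \<alpha>: "\<alpha> = S.\<alpha>" by (simp add: \<alpha> S.\<alpha>_def)
  \<comment> \<open>The quotients of \<open>\<alpha>\<close> by the \<open>p i\<close> are the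
    integral cofactors; this turns the real formula for \<open>\<gamma>\<close> into the integral
    one for the central coordinate of \<open>con_dual\<close>.\<close>
  have "real_of_int S.\<alpha> * (1 / real_of_int (p i)) = real_of_int (S.cofactor i)" if "i \<in> {1..m}" for i
    using S.p_ge[OF that] unfolding S.\<alpha>_cofactor[OF that] by simp
  then have "real_of_int S.\<alpha> * (\<Sum>i\<in>{1..m}. 1 / real_of_int (p i)) = (\<Sum>i\<in>{1..m}. real_of_int (S.cofactor i))"
    unfolding sum_distrib_left by (intro sum.cong refl)
  then have "real_of_int \<gamma> = real_of_int (S.\<alpha> * (int m - 2) - (\<Sum>i\<in>{1..m}. S.cofactor i))"
    unfolding \<gamma> \<alpha> by (simp add: algebra_simps)
  then have "\<gamma> = S.\<alpha> * (int m - 2) - (\<Sum>i\<in>{1..m}. S.cofactor i)" by (simp only: of_int_eq_iff)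
  then have N: "S.con_dual Center = - (1 + \<gamma>)"
    unfolding S.con_dual_Center by (simp add: algebra_simps)
  \<comment> \<open>\<open>min_energy\<close> and \<open>2 * \<tau>\<close> satisfy the same
    recursion and vanish at 0, so they agree by induction in both directions.\<close>
  have step: "S.min_energy (l + 1) - S.min_energy l = 2 * (\<tau> (l + 1) - \<tau> l)" for l
    using S.min_energy_step[of l] \<tau>_step by simp
  have "2 * \<tau> l = S.min_energy l" for l
  proof (induction l rule: int_induct[where k = 0])
    case base
    show ?case by (simp add: \<tau>0 S.min_energy_0)
  next
    case (step1 l)
    then show ?case using step[of l] by simp
  next
    case (step2 l)
    then show ?case using step[of "l - 1"] by simp
  qed
  then have "h1 l = S.line_height l" for l
    using h1 unfolding S.line_height_def H by (metis of_int_mult of_int_numeral)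
  then have h1: "h1 = S.line_height" by blast
  then have h2: "h2 = (\<lambda>l. S.line_height (l - S.\<alpha>))" using h2 \<alpha> by auto
  show ?thesis
    unfolding H t h1 h2 \<alpha>
    using S.knot_space_equivalent_CFK_line[OF N] S.df_homotopy_equivalent_CFK_segment[OF N] by blast
qed

end
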